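(* Let $\mathcal C$ be a strict monoidal category with coequalizers, and assume that every object of $\mathcal C$ is left coflat. Let $(A,X,\psi)$ be a cowreath in $\mathcal C$. If $X\dashv Y$ in $\mathcal C$ and every left $A$-module is robust, then the following assertions are equivalent: (i) $(X,\psi)$ is a coseparable coalgebra in $\mathcal T_A^\#$; (ii) $(Y,\varphi)$ is a separable algebra in ${}_A^\#\mathcal T$, where $\varphi=YAd\circ Y\psi Y\circ bAY:AY\to YA$; (iii) the smash product (wreath product) $YA$ is a separable algebra extension of $A$ in $\mathcal C$; (iv) $YA$ is a separable $A$-ring, that is, a separable algebra in ${}_A\mathcal C_A$. If $\underline 1$ is a left $\otimes$-generator in $\mathcal C$, then (i)-(iv) are also equivalent to (v) the restriction of scalars functor $F':\mathcal C_{YA}\to\mathcal C_A$ is separable.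
   Context: Conventions: $\mathcal C$ is a strict monoidal category with unit object $\underline 1$; the tensor product is written by juxtaposition, and the identity morphism of $X$ is written $X$ (so $fA=f\otimes \mathrm{Id}_A$). $(A,m,\eta)$ is an algebra in $\mathcal C$. Right (left) actions are denoted $\mu$ ($\nu$). $X\dashv Y$ means there are $b:\underline 1\to YX$, $d:XY\to\underline 1$ with $Yd\circ bY=Y$, $dX\circ Xb=X$; put $d^2=d\circ XdY:XXYY\to\underline 1$. $P\in\mathcal C$ is a left $\otimes$-generator if, for all $f,g:YZ\to W$, $f\circ hZ=g\circ hZ$ for all $h:P\to Y$ implies $f=g$. A functor $F:\mathcal D\to\mathcal E$ is separable if $\mathcal D(-,-)\to\mathcal E(F-,F-)$ has a natural left inverse. $\mathcal T_A^\#$: objects $(X,\psi)$, $\psi:XA\to AX$ with $\psi\circ Xm=mX\circ A\psi\circ\psi A$, $\psi\circ X\eta=\eta X$. Morphisms $(X,\psi_X)\to(Y,\psi_Y)$: $f:X\to AY$ in $\mathcal C$ with $mY\circ Af\circ\psi_X=mY\circ A\psi_Y\circ fA$; composition $g\bullet f=mZ\circ Ag\circ f$, identity $\eta X$; tensor product of objects $(XY,\psi_XY\circ X\psi_Y)$, of morphisms $f:X\to AX'$, $g:Y\to AY'$: $mX'Y'\circ A\psi_{X'}Y'\circ fg$; unit $(\underline 1,A)$. ${}_A^\#\mathcal T$ (mirror image): objects $(Y,\varphi)$, $\varphi:AY\to YA$ with $\varphi\circ mY=Ym\circ\varphi A\circ A\varphi$, $\varphi\circ\eta Y=Y\eta$.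 Morphisms $(X,\varphi_X)\to (Y,\varphi_Y)$: $f:X\to YA$ with $Ym\circ fA\circ\varphi_X=Ym\circ\varphi_YA\circ Af$; composition $g\bullet f=Zm\circ gA\circ f$, identity $X\eta$; tensor product of objects $(XY,X\varphi_Y\circ\varphi_XY)$, of morphisms $f:X\to X'A$, $g:Y\to Y'A$: $X'Y'm\circ X'\varphi_{Y'}A\circ fg$; unit $(\underline 1,A)$. Cowreath: $(A,X,\psi)$ with $(X,\psi)$ a coalgebra in $\mathcal T_A^\#$; explicitly there are $\delta:X\to AXX$, $\epsilon:X\to A$ with $mXX\circ A\psi X\circ AX\psi\circ\delta A=mXX\circ A\delta\circ\psi$; $mXXX\circ A\delta X\circ\delta=mXXX\circ A\psi XX\circ AX\delta\circ\delta$; $m\circ A\epsilon\circ\psi=m\circ\epsilon A$; $mX\circ A\epsilon X\circ\delta=\eta X=mX\circ A\psi\circ AX\epsilon\circ\delta$. The dual side: $(Y,\varphi)$ is an algebra in ${}_A^\#\mathcal T$ with multiplication $YAd^2\circ Y\delta YY\circ bYY:YY\to YA$ and unit $Y\epsilon\circ b:\underline 1\to YA$. The wreath (smash) product $YA$ is an algebra in $\mathcal C$ with multiplication $m_\#=Ym\circ YmA\circ YAAdA\circ YA\psi YA\circ YAXdAYA\circ Y\delta YAYA\circ bYAYA$ and unit $\eta_\#=Y\epsilon\circ b$. $Ym\circ\eta_\#A:A\to YA$ is an algebra morphism; it makes $YA$ an algebra extension of $A$, i.e. an $A$-ring, and defines the restriction of scalars functor. Bimodules: $X$ is left coflat if $-\otimes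 X$ preserves coequalizers. For $X\in\mathcal C_A$, $Y\in{}_A\mathcal C$, $q:XY\to X\otimes_AY$ is the coequalizer of $\mu Y,X\nu:XAY\to XY$. $Y\in{}_A\mathcal C$ is robust if $Mq$ is the coequalizer of $M\mu Y,MX\nu:MXAY\to MXY$ for all $M\in\mathcal C$, $X\in\mathcal C_A$. Under the present hypotheses $({}_A\mathcal C_A,\otimes_A,A)$ is monoidal; an $A$-ring is an algebra in it, and $A$-rings correspond to algebra morphisms $A\to S$ in $\mathcal C$. (Co)separability: a coalgebra $(C,\Delta,\varepsilon)$ in a monoidal category is coseparable if $\Delta$ has a $C$-bicolinear left inverse $CC\to C$. An algebra $S$ in a monoidal category is separable if its multiplication $SS\to S$ has an $S$-bilinear right inverse. An algebra extension $A\to S$ in $\mathcal C$ is separable if the induced multiplication $S\otimes_AS\to S$ has an $S$-bilinear right inverse. *)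

theory Defs
  imports Main
begin

section \<open>Categories and functors\<close>

record ('o, 'a) category =
  objs :: "'o set"
  arrs :: "'a set"
  source :: "'a \<Rightarrow> 'o"
  target :: "'a \<Rightarrow> 'o"
  ident :: "'o \<Rightarrow> 'a"
  cmp :: "'a \<Rightarrow> 'a \<Rightarrow> 'a" (infixl "\<cdot>\<index>" 70)

definition hom :: "('o, 'a, 'r) category_scheme \<Rightarrow> 'o \<Rightarrow> 'o \<Rightarrow> 'a set" where
  "hom C X Y = {f \<in> arrs C. source C f = X \<and> target C f = Y}"

locale category =
  fixes C :: "('o, 'a, 'r) category_scheme" (structure)
  assumes source_obj: "f \<in> arrs C \<Longrightarrow> source C f \<in> objs C"
    and target_obj: "f \<in> arrs C \<Longrightarrow> target C f \<in> objs C"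
    and ident_hom: "X \<in> objs C \<Longrightarrow> ident C X \<in> hom C X X"
    and cmp_hom: "\<lbrakk>f \<in> hom C X Y; g \<in> hom C Y Z\<rbrakk> \<Longrightarrow> g \<cdot> f \<in> hom C X Z"
    and cmp_assoc:
      "\<lbrakk>f \<in> hom C X Y; g \<in> hom C Y Z; h \<in> hom C Z W\<rbrakk> \<Longrightarrow> (h \<cdot> g) \<cdot> f = h \<cdot> (g \<cdot> f)"
    and ident_left: "f \<in> hom C X Y \<Longrightarrow> ident C Y \<cdot> f = f"
    and ident_right: "f \<in> hom C X Y \<Longrightarrow> f \<cdot> ident C X = f"

definition is_inverse :: "('o, 'a, 'r) category_scheme \<Rightarrow> 'a \<Rightarrow> 'a \<Rightarrow> bool" where
  "is_inverse C f g \<longleftrightarrow> f \<in> arrs C \<and> g \<in> hom C (target C f) (source C f) \<and>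
     g \<cdot>\<^bsub>C\<^esub> f = ident C (source C f) \<and> f \<cdot>\<^bsub>C\<^esub> g = ident C (target C f)"

definition inverse_arr :: "('o, 'a, 'r) category_scheme \<Rightarrow> 'a \<Rightarrow> 'a" where
  "inverse_arr C f = (THE g. is_inverse C f g)"

definition is_functor ::
  "('o, 'a, 'r) category_scheme \<Rightarrow> ('p, 'b, 's) category_scheme \<Rightarrow>
   ('o \<Rightarrow> 'p) \<Rightarrow> ('a \<Rightarrow> 'b) \<Rightarrow> bool" where
  "is_functor D E Fo Fa \<longleftrightarrow>
     (\<forall>X \<in> objs D. Fo X \<in> objs E \<and> Fa (ident D X) = ident E (Fo X)) \<and>
     (\<forall>X Y f. f \<in> hom D X Y \<longrightarrow> Fa f \<in> hom E (Fo X) (Fo Y)) \<and>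
     (\<forall>X Y Z f g. f \<in> hom D X Y \<and> g \<in> hom D Y Z \<longrightarrow>
        Fa (g \<cdot>\<^bsub>D\<^esub> f) = Fa g \<cdot>\<^bsub>E\<^esub> Fa f)"

definition separable_functor ::
  "('o, 'a, 'r) category_scheme \<Rightarrow> ('p, 'b, 's) category_scheme \<Rightarrow>
   ('o \<Rightarrow> 'p) \<Rightarrow> ('a \<Rightarrow> 'b) \<Rightarrow> bool" where
  "separable_functor D E Fo Fa \<longleftrightarrow> is_functor D E Fo Fa \<and>
     (\<exists>P :: 'o \<Rightarrow> 'o \<Rightarrow> 'b \<Rightarrow> 'a.
        (\<forall>X \<in> objs D. \<forall>Y \<in> objs D. \<forall>f \<in> hom E (Fo X) (Fo Y). P X Y f \<in> hom D X Y) \<and>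
        (\<forall>X' \<in> objs D. \<forall>X \<in> objs D. \<forall>Y \<in> objs D. \<forall>Y' \<in> objs D.
           \<forall>g \<in> hom D X' X. \<forall>f \<in> hom E (Fo X) (Fo Y). \<forall>h \<in> hom D Y Y'.
             P X' Y' (Fa h \<cdot>\<^bsub>E\<^esub> f \<cdot>\<^bsub>E\<^esub> Fa g) = h \<cdot>\<^bsub>D\<^esub> P X Y f \<cdot>\<^bsub>D\<^esub> g) \<and>
        (\<forall>X \<in> objs D. \<forall>Y \<in> objs D. \<forall>f \<in> hom D X Y. P X Y (Fa f) = f))"

definition is_coequalizer :: "('o, 'a, 'r) category_scheme \<Rightarrow> 'a \<Rightarrow> 'a \<Rightarrow> 'a \<Rightarrow> bool" where
  "is_coequalizer C f g q \<longleftrightarrow>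
     f \<in> arrs C \<and> g \<in> hom C (source C f) (target C f) \<and>
     q \<in> arrs C \<and> source C q = target C f \<and> q \<cdot>\<^bsub>C\<^esub> f = q \<cdot>\<^bsub>C\<^esub> g \<and>
     (\<forall>h \<in> arrs C. source C h = target C f \<and> h \<cdot>\<^bsub>C\<^esub> f = h \<cdot>\<^bsub>C\<^esub> g \<longrightarrow>
        (\<exists>!k. k \<in> hom C (target C q) (target C h) \<and> k \<cdot>\<^bsub>C\<^esub> q = h))"

definition has_coequalizers :: "('o, 'a, 'r) category_scheme \<Rightarrow> bool" where
  "has_coequalizers C \<longleftrightarrow>
     (\<forall>X Y. \<forall>f \<in> hom C X Y. \<forall>g \<in> hom C X Y. \<exists>q. is_coequalizer C f g q)"

definition coequalizer :: "('o, 'a, 'r) category_scheme \<Rightarrow> 'a \<Rightarrow> 'a \<Rightarrow> 'a" where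
  "coequalizer C f g = (SOME q. is_coequalizer C f g q)"

text \<open>The arrow induced by \<open>h\<close> on the target of an epimorphism \<open>q\<close>.\<close>

definition induced :: "('o, 'a, 'r) category_scheme \<Rightarrow> 'a \<Rightarrow> 'a \<Rightarrow> 'a" where
  "induced C q h = (THE k. k \<in> hom C (target C q) (target C h) \<and> k \<cdot>\<^bsub>C\<^esub> q = h)"


section \<open>Monoidal categories\<close>

record ('o, 'a) moncat = "('o, 'a) category" +
  unit_ob :: "'o" ("\<one>\<index>")
  tensor_ob :: "'o \<Rightarrow> 'o \<Rightarrow> 'o" (infixr "\<otimes>\<index>" 80)
  tensor_arr :: "'a \<Rightarrow> 'a \<Rightarrow> 'a" (infixr "\<boxtimes>\<index>" 75)
  associator :: "'o \<Rightarrow> 'o \<Rightarrow> 'o \<Rightarrow> 'a"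
  left_unitor :: "'o \<Rightarrow> 'a"
  right_unitor :: "'o \<Rightarrow> 'a"

text \<open>Tensoring with an identity: \<open>X \<triangleleft> f\<close> and \<open>f \<triangleright> X\<close> stand for the juxtapositions
  \<open>Xf\<close> and \<open>fX\<close>; \<open>X \<triangleleft> f \<triangleright> Y\<close> is \<open>XfY\<close>.\<close>

abbreviation whisker_left ::
  "('o, 'a, 'r) moncat_scheme \<Rightarrow> 'o \<Rightarrow> 'a \<Rightarrow> 'a" (infixr "\<triangleleft>\<index>" 75) where
  "X \<triangleleft>\<^bsub>C\<^esub> f \<equiv> ident C X \<boxtimes>\<^bsub>C\<^esub> f"

abbreviation whisker_right ::
  "('o, 'a, 'r) moncat_scheme \<Rightarrow> 'a \<Rightarrow> 'o \<Rightarrow> 'a" (infixl "\<triangleright>\<index>" 76) where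
  "f \<triangleright>\<^bsub>C\<^esub> X \<equiv> f \<boxtimes>\<^bsub>C\<^esub> ident C X"

locale monoidal_category = category C for C :: "('o, 'a) moncat" (structure) +
  assumes unit_obj: "\<one> \<in> objs C"
    and tensor_obj: "\<lbrakk>X \<in> objs C; Y \<in> objs C\<rbrakk> \<Longrightarrow> X \<otimes> Y \<in> objs C"
    and tensor_hom:
      "\<lbrakk>f \<in> hom C X X'; g \<in> hom C Y Y'\<rbrakk> \<Longrightarrow> f \<boxtimes> g \<in> hom C (X \<otimes> Y) (X' \<otimes> Y')"
    and tensor_ident:
      "\<lbrakk>X \<in> objs C; Y \<in> objs C\<rbrakk> \<Longrightarrow> ident C X \<boxtimes> ident C Y = ident C (X \<otimes> Y)"
    and tensor_cmp:
      "\<lbrakk>f \<in> hom C X X'; f' \<in> hom C X' X''; g \<in> hom C Y Y'; g' \<in> hom C Y' Y''\<rbrakk> \<Longrightarrow>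
        (f' \<cdot> f) \<boxtimes> (g' \<cdot> g) = (f' \<boxtimes> g') \<cdot> (f \<boxtimes> g)"
    and associator_hom:
      "\<lbrakk>X \<in> objs C; Y \<in> objs C; Z \<in> objs C\<rbrakk> \<Longrightarrow>
        associator C X Y Z \<in> hom C ((X \<otimes> Y) \<otimes> Z) (X \<otimes> (Y \<otimes> Z))"
    and associator_iso:
      "\<lbrakk>X \<in> objs C; Y \<in> objs C; Z \<in> objs C\<rbrakk> \<Longrightarrow> \<exists>g. is_inverse C (associator C X Y Z) g"
    and associator_natural:
      "\<lbrakk>f \<in> hom C X X'; g \<in> hom C Y Y'; h \<in> hom C Z Z'\<rbrakk> \<Longrightarrow>
        associator C X' Y' Z' \<cdot> ((f \<boxtimes> g) \<boxtimes> h) = (f \<boxtimes> (g \<boxtimes> h)) \<cdot> associator C X Y Z"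
    and left_unitor_hom: "X \<in> objs C \<Longrightarrow> left_unitor C X \<in> hom C (\<one> \<otimes> X) X"
    and left_unitor_iso: "X \<in> objs C \<Longrightarrow> \<exists>g. is_inverse C (left_unitor C X) g"
    and left_unitor_natural:
      "f \<in> hom C X Y \<Longrightarrow> left_unitor C Y \<cdot> (\<one> \<triangleleft> f) = f \<cdot> left_unitor C X"
    and right_unitor_hom: "X \<in> objs C \<Longrightarrow> right_unitor C X \<in> hom C (X \<otimes> \<one>) X"
    and right_unitor_iso: "X \<in> objs C \<Longrightarrow> \<exists>g. is_inverse C (right_unitor C X) g"
    and right_unitor_natural:
      "f \<in> hom C X Y \<Longrightarrow> right_unitor C Y \<cdot> (f \<triangleright> \<one>) = f \<cdot> right_unitor C X"
    and pentagon:
      "\<lbrakk>W \<in> objs C; X \<in> objs C; Y \<in> objs C; Z \<in> objs C\<rbrakk> \<Longrightarrow>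
        associator C W X (Y \<otimes> Z) \<cdot> associator C (W \<otimes> X) Y Z =
        (W \<triangleleft> associator C X Y Z) \<cdot> associator C W (X \<otimes> Y) Z \<cdot> (associator C W X Y \<triangleright> Z)"
    and triangle:
      "\<lbrakk>X \<in> objs C; Y \<in> objs C\<rbrakk> \<Longrightarrow>
        (X \<triangleleft> left_unitor C Y) \<cdot> associator C X \<one> Y = right_unitor C X \<triangleright> Y"

locale strict_monoidal_category = monoidal_category +
  assumes strict_assoc:
      "\<lbrakk>X \<in> objs C; Y \<in> objs C; Z \<in> objs C\<rbrakk> \<Longrightarrow> (X \<otimes> Y) \<otimes> Z = X \<otimes> (Y \<otimes> Z)"
    and strict_unit_left: "X \<in> objs C \<Longrightarrow> \<one> \<otimes> X = X"
    and strict_unit_right: "X \<in> objs C \<Longrightarrow> X \<otimes> \<one> = X"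
    and strict_associator:
      "\<lbrakk>X \<in> objs C; Y \<in> objs C; Z \<in> objs C\<rbrakk> \<Longrightarrow> associator C X Y Z = ident C (X \<otimes> Y \<otimes> Z)"
    and strict_left_unitor: "X \<in> objs C \<Longrightarrow> left_unitor C X = ident C X"
    and strict_right_unitor: "X \<in> objs C \<Longrightarrow> right_unitor C X = ident C X"


section \<open>Algebras and coalgebras in a monoidal category\<close>

context
  fixes M :: "('o, 'a) moncat" (structure)
begin

definition algebra :: "'o \<Rightarrow> 'a \<Rightarrow> 'a \<Rightarrow> bool" where
  "algebra S m u \<longleftrightarrow>
     S \<in> objs M \<and> m \<in> hom M (S \<otimes> S) S \<and> u \<in> hom M \<one> S \<and>
     m \<cdot> (m \<triangleright> S) = m \<cdot> (S \<triangleleft> m) \<cdot> associator M S S S \<and>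
     m \<cdot> (u \<triangleright> S) = left_unitor M S \<and>
     m \<cdot> (S \<triangleleft> u) = right_unitor M S"

definition algebra_morphism :: "'o \<Rightarrow> 'a \<Rightarrow> 'a \<Rightarrow> 'o \<Rightarrow> 'a \<Rightarrow> 'a \<Rightarrow> 'a \<Rightarrow> bool" where
  "algebra_morphism A mA uA S mS uS i \<longleftrightarrow>
     i \<in> hom M A S \<and> i \<cdot> mA = mS \<cdot> (i \<boxtimes> i) \<and> i \<cdot> uA = uS"

definition coalgebra :: "'o \<Rightarrow> 'a \<Rightarrow> 'a \<Rightarrow> bool" where
  "coalgebra K \<delta> \<epsilon> \<longleftrightarrow>
     K \<in> objs M \<and> \<delta> \<in> hom M K (K \<otimes> K) \<and> \<epsilon> \<in> hom M K \<one> \<and>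
     associator M K K K \<cdot> (\<delta> \<triangleright> K) \<cdot> \<delta> = (K \<triangleleft> \<delta>) \<cdot> \<delta> \<and>
     left_unitor M K \<cdot> (\<epsilon> \<triangleright> K) \<cdot> \<delta> = ident M K \<and>
     right_unitor M K \<cdot> (K \<triangleleft> \<epsilon>) \<cdot> \<delta> = ident M K"

text \<open>Bimodules are triples: object, left action, right action; likewise bicomodules.\<close>

definition bilinear :: "'o \<Rightarrow> 'o \<times> 'a \<times> 'a \<Rightarrow> 'o \<times> 'a \<times> 'a \<Rightarrow> 'a \<Rightarrow> bool" where
  "bilinear S P Q f \<longleftrightarrow>
     (case (P, Q) of ((U, \<nu>, \<mu>), (V, \<nu>', \<mu>')) \<Rightarrow>
        f \<in> hom M U V \<and> f \<cdot> \<nu> = \<nu>' \<cdot> (S \<triangleleft> f) \<and> f \<cdot> \<mu> = \<mu>' \<cdot> (f \<triangleright> S))"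

definition bicolinear :: "'o \<Rightarrow> 'o \<times> 'a \<times> 'a \<Rightarrow> 'o \<times> 'a \<times> 'a \<Rightarrow> 'a \<Rightarrow> bool" where
  "bicolinear K P Q f \<longleftrightarrow>
     (case (P, Q) of ((U, \<kappa>, \<rho>), (V, \<kappa>', \<rho>')) \<Rightarrow>
        f \<in> hom M U V \<and> \<kappa>' \<cdot> f = (K \<triangleleft> f) \<cdot> \<kappa> \<and> \<rho>' \<cdot> f = (f \<triangleright> K) \<cdot> \<rho>)"

definition separable_algebra :: "'o \<Rightarrow> 'a \<Rightarrow> 'a \<Rightarrow> bool" where
  "separable_algebra S m u \<longleftrightarrow> algebra S m u \<and>
     (\<exists>\<sigma>. m \<cdot> \<sigma> = ident M S \<and>
        bilinear S (S, m, m)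
          (S \<otimes> S, (m \<triangleright> S) \<cdot> inverse_arr M (associator M S S S),
                  (S \<triangleleft> m) \<cdot> associator M S S S) \<sigma>)"

definition coseparable_coalgebra :: "'o \<Rightarrow> 'a \<Rightarrow> 'a \<Rightarrow> bool" where
  "coseparable_coalgebra K \<delta> \<epsilon> \<longleftrightarrow> coalgebra K \<delta> \<epsilon> \<and>
     (\<exists>\<pi>. \<pi> \<cdot> \<delta> = ident M K \<and>
        bicolinear K
          (K \<otimes> K, associator M K K K \<cdot> (\<delta> \<triangleright> K),
                  inverse_arr M (associator M K K K) \<cdot> (K \<triangleleft> \<delta>)) (K, \<delta>, \<delta>) \<pi>)"

end


section \<open>Notions in a strict monoidal category\<close>

text \<open>From here on \<open>C\<close> is meant to be strict, so that brackets in tensor products do not matter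
  and no associator or unitor of \<open>C\<close> has to be written. In every category constructed below, an
  arrow is a triple consisting of its source, the underlying arrow of \<open>C\<close>, and its target.\<close>

context
  fixes C :: "('o, 'a) moncat" (structure)
begin

definition dual_pair :: "'o \<Rightarrow> 'o \<Rightarrow> 'a \<Rightarrow> 'a \<Rightarrow> bool" where
  "dual_pair X Y b d \<longleftrightarrow>
     X \<in> objs C \<and> Y \<in> objs C \<and> b \<in> hom C \<one> (Y \<otimes> X) \<and> d \<in> hom C (X \<otimes> Y) \<one> \<and>
     (Y \<triangleleft> d) \<cdot> (b \<triangleright> Y) = ident C Y \<and> (d \<triangleright> X) \<cdot> (X \<triangleleft> b) = ident C X"

definition left_coflat :: "'o \<Rightarrow> bool" where
  "left_coflat X \<longleftrightarrow>
     (\<forall>f g q. is_coequalizer C f g q \<longrightarrow> is_coequalizer C (f \<triangleright> X) (g \<triangleright> X) (q \<triangleright> X))"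

definition left_tensor_generator :: "'o \<Rightarrow> bool" where
  "left_tensor_generator P \<longleftrightarrow> P \<in> objs C \<and>
     (\<forall>Y \<in> objs C. \<forall>Z \<in> objs C. \<forall>W \<in> objs C.
        \<forall>f \<in> hom C (Y \<otimes> Z) W. \<forall>g \<in> hom C (Y \<otimes> Z) W.
          (\<forall>h \<in> hom C P Y. f \<cdot> (h \<triangleright> Z) = g \<cdot> (h \<triangleright> Z)) \<longrightarrow> f = g)"


subsection \<open>Modules\<close>

definition right_module :: "'o \<Rightarrow> 'a \<Rightarrow> 'a \<Rightarrow> 'o \<Rightarrow> 'a \<Rightarrow> bool" where
  "right_module A m \<eta> N \<mu> \<longleftrightarrow>
     N \<in> objs C \<and> \<mu> \<in> hom C (N \<otimes> A) N \<and>
     \<mu> \<cdot> (\<mu> \<triangleright> A) = \<mu> \<cdot> (N \<triangleleft> m) \<and> \<mu> \<cdot> (N \<triangleleft> \<eta>) = ident C N"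

definition left_module :: "'o \<Rightarrow> 'a \<Rightarrow> 'a \<Rightarrow> 'o \<Rightarrow> 'a \<Rightarrow> bool" where
  "left_module A m \<eta> N \<nu> \<longleftrightarrow>
     N \<in> objs C \<and> \<nu> \<in> hom C (A \<otimes> N) N \<and>
     \<nu> \<cdot> (A \<triangleleft> \<nu>) = \<nu> \<cdot> (m \<triangleright> N) \<and> \<nu> \<cdot> (\<eta> \<triangleright> N) = ident C N"

definition right_modules :: "'o \<Rightarrow> 'a \<Rightarrow> 'a \<Rightarrow>
    ('o \<times> 'a, ('o \<times> 'a) \<times> 'a \<times> ('o \<times> 'a)) category" where
  "right_modules A m \<eta> = \<lparr>
     objs = {(N, \<mu>). right_module A m \<eta> N \<mu>},
     arrs = {((N, \<mu>), f, (N', \<mu>')) | N \<mu> f N' \<mu>'.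
        right_module A m \<eta> N \<mu> \<and> right_module A m \<eta> N' \<mu>' \<and>
        f \<in> hom C N N' \<and> f \<cdot> \<mu> = \<mu>' \<cdot> (f \<triangleright> A)},
     source = (\<lambda>(P, f, Q). P),
     target = (\<lambda>(P, f, Q). Q),
     ident = (\<lambda>(N, \<mu>). ((N, \<mu>), ident C N, (N, \<mu>))),
     cmp = (\<lambda>(_, g, R) (P, f, _). (P, g \<cdot> f, R)) \<rparr>"

definition restrict_ob :: "'a \<Rightarrow> 'o \<times> 'a \<Rightarrow> 'o \<times> 'a" where
  "restrict_ob i = (\<lambda>(N, \<mu>). (N, \<mu> \<cdot> (N \<triangleleft> i)))"

definition restrict_arr :: "'a \<Rightarrow> ('o \<times> 'a) \<times> 'a \<times> ('o \<times> 'a) \<Rightarrow>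
    ('o \<times> 'a) \<times> 'a \<times> ('o \<times> 'a)" where
  "restrict_arr i = (\<lambda>(P, f, Q). (restrict_ob i P, f, restrict_ob i Q))"

text \<open>The canonical arrow from \<open>X \<otimes> Y\<close> to the tensor product over \<open>A\<close> of the right module
  \<open>(X, \<mu>)\<close> and the left module \<open>(Y, \<nu>)\<close>; its target is the tensor product over \<open>A\<close>.\<close>

definition balanced :: "'o \<Rightarrow> 'a \<Rightarrow> 'o \<Rightarrow> 'a \<Rightarrow> 'a" where
  "balanced X \<mu> Y \<nu> = coequalizer C (\<mu> \<triangleright> Y) (X \<triangleleft> \<nu>)"

definition robust :: "'o \<Rightarrow> 'a \<Rightarrow> 'a \<Rightarrow> 'o \<Rightarrow> 'a \<Rightarrow> bool" where
  "robust A m \<eta> Y \<nu> \<longleftrightarrow>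
     (\<forall>N \<in> objs C. \<forall>X \<mu>. right_module A m \<eta> X \<mu> \<longrightarrow>
        is_coequalizer C (N \<triangleleft> \<mu> \<triangleright> Y) (N \<otimes> X \<triangleleft> \<nu>) (N \<triangleleft> balanced X \<mu> Y \<nu>))"


subsection \<open>The monoidal category of bimodules\<close>

definition bimodule :: "'o \<Rightarrow> 'a \<Rightarrow> 'a \<Rightarrow> 'o \<times> 'a \<times> 'a \<Rightarrow> bool" where
  "bimodule A m \<eta> = (\<lambda>(N, \<nu>, \<mu>).
     left_module A m \<eta> N \<nu> \<and> right_module A m \<eta> N \<mu> \<and> \<nu> \<cdot> (A \<triangleleft> \<mu>) = \<mu> \<cdot> (\<nu> \<triangleright> A))"

definition bimod_q :: "'o \<times> 'a \<times> 'a \<Rightarrow> 'o \<times> 'a \<times> 'a \<Rightarrow> 'a" where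
  "bimod_q = (\<lambda>(X, \<nu>, \<mu>) (Y, \<nu>', \<mu>'). balanced X \<mu> Y \<nu>')"

definition bimod_tensor :: "'o \<Rightarrow> 'o \<times> 'a \<times> 'a \<Rightarrow> 'o \<times> 'a \<times> 'a \<Rightarrow> 'o \<times> 'a \<times> 'a" where
  "bimod_tensor A = (\<lambda>(X, \<nu>, \<mu>) (Y, \<nu>', \<mu>'). let q = balanced X \<mu> Y \<nu>' in
     (target C q, induced C (A \<triangleleft> q) (q \<cdot> (\<nu> \<triangleright> Y)), induced C (q \<triangleright> A) (q \<cdot> (X \<triangleleft> \<mu>'))))"

definition bimodules :: "'o \<Rightarrow> 'a \<Rightarrow> 'a \<Rightarrow>
    ('o \<times> 'a \<times> 'a, ('o \<times> 'a \<times> 'a) \<times> 'a \<times> ('o \<times> 'a \<times> 'a)) moncat" where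
  "bimodules A m \<eta> = \<lparr>
     objs = {P. bimodule A m \<eta> P},
     arrs = {(P, f, Q). bimodule A m \<eta> P \<and> bimodule A m \<eta> Q \<and> bilinear C A P Q f},
     source = (\<lambda>(P, f, Q). P),
     target = (\<lambda>(P, f, Q). Q),
     ident = (\<lambda>P. (P, ident C (fst P), P)),
     cmp = (\<lambda>(_, g, R) (P, f, _). (P, g \<cdot> f, R)),
     unit_ob = (A, m, m),
     tensor_ob = bimod_tensor A,
     tensor_arr = (\<lambda>(P, f, P') (Q, g, Q').
        (bimod_tensor A P Q, induced C (bimod_q P Q) (bimod_q P' Q' \<cdot> (f \<boxtimes> g)),
         bimod_tensor A P' Q')),
     associator = (\<lambda>P Q R.
        (bimod_tensor A (bimod_tensor A P Q) R,
         induced C (bimod_q (bimod_tensor A P Q) R \<cdot> (bimod_q P Q \<triangleright> fst R))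
                   (bimod_q P (bimod_tensor A Q R) \<cdot> (fst P \<triangleleft> bimod_q Q R)),
         bimod_tensor A P (bimod_tensor A Q R))),
     left_unitor = (\<lambda>P.
        (bimod_tensor A (A, m, m) P, induced C (bimod_q (A, m, m) P) (fst (snd P)), P)),
     right_unitor = (\<lambda>P.
        (bimod_tensor A P (A, m, m), induced C (bimod_q P (A, m, m)) (snd (snd P)), P)) \<rparr>"


subsection \<open>Algebra extensions\<close>

text \<open>\<open>S\<close> as an \<open>A\<close>-bimodule along \<open>i : A \<rightarrow> S\<close>.\<close>

definition ext_left :: "'o \<Rightarrow> 'a \<Rightarrow> 'a \<Rightarrow> 'a" where
  "ext_left S mS i = mS \<cdot> (i \<triangleright> S)"

definition ext_right :: "'o \<Rightarrow> 'a \<Rightarrow> 'a \<Rightarrow> 'a" where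
  "ext_right S mS i = mS \<cdot> (S \<triangleleft> i)"

definition ext_q :: "'o \<Rightarrow> 'a \<Rightarrow> 'a \<Rightarrow> 'a" where
  "ext_q S mS i = balanced S (ext_right S mS i) S (ext_left S mS i)"

definition separable_extension ::
    "'o \<Rightarrow> 'a \<Rightarrow> 'a \<Rightarrow> 'o \<Rightarrow> 'a \<Rightarrow> 'a \<Rightarrow> 'a \<Rightarrow> bool" where
  "separable_extension A m \<eta> S mS uS i \<longleftrightarrow>
     algebra C A m \<eta> \<and> algebra C S mS uS \<and> algebra_morphism C A m \<eta> S mS uS i \<and>
     (let q = ext_q S mS i in
       \<exists>\<sigma>. induced C q mS \<cdot> \<sigma> = ident C S \<and>
          bilinear C S (S, mS, mS)
            (target C q, induced C (S \<triangleleft> q) (q \<cdot> (mS \<triangleright> S)),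
                         induced C (q \<triangleright> S) (q \<cdot> (S \<triangleleft> mS))) \<sigma>)"

definition ring_bimod :: "'o \<Rightarrow> 'a \<Rightarrow> 'a \<Rightarrow> 'o \<times> 'a \<times> 'a" where
  "ring_bimod S mS i = (S, ext_left S mS i, ext_right S mS i)"

text \<open>The \<open>A\<close>-ring corresponding to the algebra morphism \<open>i : A \<rightarrow> S\<close> has the multiplication
  induced by \<open>mS\<close> and the unit \<open>i\<close>.\<close>

definition separable_ring :: "'o \<Rightarrow> 'a \<Rightarrow> 'a \<Rightarrow> 'o \<Rightarrow> 'a \<Rightarrow> 'a \<Rightarrow> bool" where
  "separable_ring A m \<eta> S mS i \<longleftrightarrow>
     (let R = ring_bimod S mS i in
       separable_algebra (bimodules A m \<eta>) R
         (bimod_tensor A R R, induced C (ext_q S mS i) mS, R)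
         ((A, m, m), i, R))"


subsection \<open>The two categories of transfer morphisms\<close>

definition T_sharp_ob :: "'o \<Rightarrow> 'a \<Rightarrow> 'a \<Rightarrow> 'o \<times> 'a \<Rightarrow> bool" where
  "T_sharp_ob A m \<eta> = (\<lambda>(X, \<psi>).
     X \<in> objs C \<and> \<psi> \<in> hom C (X \<otimes> A) (A \<otimes> X) \<and>
     \<psi> \<cdot> (X \<triangleleft> m) = (m \<triangleright> X) \<cdot> (A \<triangleleft> \<psi>) \<cdot> (\<psi> \<triangleright> A) \<and>
     \<psi> \<cdot> (X \<triangleleft> \<eta>) = \<eta> \<triangleright> X)"

definition T_sharp_tensor :: "'o \<times> 'a \<Rightarrow> 'o \<times> 'a \<Rightarrow> 'o \<times> 'a" where
  "T_sharp_tensor = (\<lambda>(X, \<psi>) (Y, \<chi>). (X \<otimes> Y, (\<psi> \<triangleright> Y) \<cdot> (X \<triangleleft> \<chi>)))"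

definition T_sharp_id :: "'a \<Rightarrow> 'o \<times> 'a \<Rightarrow> ('o \<times> 'a) \<times> 'a \<times> ('o \<times> 'a)" where
  "T_sharp_id \<eta> P = (P, \<eta> \<triangleright> fst P, P)"

definition T_sharp :: "'o \<Rightarrow> 'a \<Rightarrow> 'a \<Rightarrow>
    ('o \<times> 'a, ('o \<times> 'a) \<times> 'a \<times> ('o \<times> 'a)) moncat" where
  "T_sharp A m \<eta> = \<lparr>
     objs = {P. T_sharp_ob A m \<eta> P},
     arrs = {((X, \<psi>), f, (Y, \<chi>)) | X \<psi> f Y \<chi>.
        T_sharp_ob A m \<eta> (X, \<psi>) \<and> T_sharp_ob A m \<eta> (Y, \<chi>) \<and> f \<in> hom C X (A \<otimes> Y) \<and>
        (m \<triangleright> Y) \<cdot> (A \<triangleleft> f) \<cdot> \<psi> = (m \<triangleright> Y) \<cdot> (A \<triangleleft> \<chi>) \<cdot> (f \<triangleright> A)},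
     source = (\<lambda>(P, f, Q). P),
     target = (\<lambda>(P, f, Q). Q),
     ident = T_sharp_id \<eta>,
     cmp = (\<lambda>(_, g, (Z, \<omega>)) (P, f, _). (P, (m \<triangleright> Z) \<cdot> (A \<triangleleft> g) \<cdot> f, (Z, \<omega>))),
     unit_ob = (\<one>, ident C A),
     tensor_ob = T_sharp_tensor,
     tensor_arr = (\<lambda>(P, f, (X', \<psi>')) (Q, g, (Y', \<chi>')).
        (T_sharp_tensor P Q,
         (m \<triangleright> X' \<otimes> Y') \<cdot> (A \<triangleleft> \<psi>' \<triangleright> Y') \<cdot> (f \<boxtimes> g),
         T_sharp_tensor (X', \<psi>') (Y', \<chi>'))),
     associator = (\<lambda>P Q R. T_sharp_id \<eta> (T_sharp_tensor P (T_sharp_tensor Q R))),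
     left_unitor = T_sharp_id \<eta>,
     right_unitor = T_sharp_id \<eta> \<rparr>"

definition sharp_T_ob :: "'o \<Rightarrow> 'a \<Rightarrow> 'a \<Rightarrow> 'o \<times> 'a \<Rightarrow> bool" where
  "sharp_T_ob A m \<eta> = (\<lambda>(Y, \<phi>).
     Y \<in> objs C \<and> \<phi> \<in> hom C (A \<otimes> Y) (Y \<otimes> A) \<and>
     \<phi> \<cdot> (m \<triangleright> Y) = (Y \<triangleleft> m) \<cdot> (\<phi> \<triangleright> A) \<cdot> (A \<triangleleft> \<phi>) \<and>
     \<phi> \<cdot> (\<eta> \<triangleright> Y) = Y \<triangleleft> \<eta>)"

definition sharp_T_tensor :: "'o \<times> 'a \<Rightarrow> 'o \<times> 'a \<Rightarrow> 'o \<times> 'a" where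
  "sharp_T_tensor = (\<lambda>(X, \<phi>) (Y, \<chi>). (X \<otimes> Y, (X \<triangleleft> \<chi>) \<cdot> (\<phi> \<triangleright> Y)))"

definition sharp_T_id :: "'a \<Rightarrow> 'o \<times> 'a \<Rightarrow> ('o \<times> 'a) \<times> 'a \<times> ('o \<times> 'a)" where
  "sharp_T_id \<eta> P = (P, fst P \<triangleleft> \<eta>, P)"

definition sharp_T :: "'o \<Rightarrow> 'a \<Rightarrow> 'a \<Rightarrow>
    ('o \<times> 'a, ('o \<times> 'a) \<times> 'a \<times> ('o \<times> 'a)) moncat" where
  "sharp_T A m \<eta> = \<lparr>
     objs = {P. sharp_T_ob A m \<eta> P},
     arrs = {((X, \<phi>), f, (Y, \<chi>)) | X \<phi> f Y \<chi>.
        sharp_T_ob A m \<eta> (X, \<phi>) \<and> sharp_T_ob A m \<eta> (Y, \<chi>) \<and> f \<in> hom C X (Y \<otimes> A) \<and>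
        (Y \<triangleleft> m) \<cdot> (f \<triangleright> A) \<cdot> \<phi> = (Y \<triangleleft> m) \<cdot> (\<chi> \<triangleright> A) \<cdot> (A \<triangleleft> f)},
     source = (\<lambda>(P, f, Q). P),
     target = (\<lambda>(P, f, Q). Q),
     ident = sharp_T_id \<eta>,
     cmp = (\<lambda>(_, g, (Z, \<omega>)) (P, f, _). (P, (Z \<triangleleft> m) \<cdot> (g \<triangleright> A) \<cdot> f, (Z, \<omega>))),
     unit_ob = (\<one>, ident C A),
     tensor_ob = sharp_T_tensor,
     tensor_arr = (\<lambda>(P, f, (X', \<phi>')) (Q, g, (Y', \<chi>')).
        (sharp_T_tensor P Q,
         (X' \<otimes> Y' \<triangleleft> m) \<cdot> (X' \<triangleleft> \<chi>' \<triangleright> A) \<cdot> (f \<boxtimes> g),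
         sharp_T_tensor (X', \<phi>') (Y', \<chi>'))),
     associator = (\<lambda>P Q R. sharp_T_id \<eta> (sharp_T_tensor P (sharp_T_tensor Q R))),
     left_unitor = sharp_T_id \<eta>,
     right_unitor = sharp_T_id \<eta> \<rparr>"


subsection \<open>Cowreaths and the dual side\<close>

definition cow_comult :: "'o \<Rightarrow> 'a \<Rightarrow> 'a \<Rightarrow> ('o \<times> 'a) \<times> 'a \<times> ('o \<times> 'a)" where
  "cow_comult X \<psi> \<delta> = ((X, \<psi>), \<delta>, T_sharp_tensor (X, \<psi>) (X, \<psi>))"

definition cow_counit :: "'o \<Rightarrow> 'o \<Rightarrow> 'a \<Rightarrow> 'a \<Rightarrow> ('o \<times> 'a) \<times> 'a \<times> ('o \<times> 'a)" where
  "cow_counit A X \<psi> \<epsilon> = ((X, \<psi>), \<epsilon>, (\<one>, ident C A))"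

definition cowreath :: "'o \<Rightarrow> 'a \<Rightarrow> 'a \<Rightarrow> 'o \<Rightarrow> 'a \<Rightarrow> 'a \<Rightarrow> 'a \<Rightarrow> bool" where
  "cowreath A m \<eta> X \<psi> \<delta> \<epsilon> \<longleftrightarrow> algebra C A m \<eta> \<and>
     coalgebra (T_sharp A m \<eta>) (X, \<psi>) (cow_comult X \<psi> \<delta>) (cow_counit A X \<psi> \<epsilon>)"

definition dual_phi :: "'o \<Rightarrow> 'o \<Rightarrow> 'a \<Rightarrow> 'a \<Rightarrow> 'a \<Rightarrow> 'a" where
  "dual_phi A Y \<psi> b d = (Y \<otimes> A \<triangleleft> d) \<cdot> (Y \<triangleleft> \<psi> \<triangleright> Y) \<cdot> (b \<triangleright> A \<otimes> Y)"

definition dual_mult :: "'o \<Rightarrow> 'o \<Rightarrow> 'o \<Rightarrow> 'a \<Rightarrow> 'a \<Rightarrow> 'a \<Rightarrow> 'a" where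
  "dual_mult A X Y \<delta> b d =
     (Y \<otimes> A \<triangleleft> (d \<cdot> (X \<triangleleft> d \<triangleright> Y))) \<cdot> (Y \<triangleleft> \<delta> \<triangleright> Y \<otimes> Y) \<cdot> (b \<triangleright> Y \<otimes> Y)"

definition dual_unit :: "'o \<Rightarrow> 'a \<Rightarrow> 'a \<Rightarrow> 'a" where
  "dual_unit Y \<epsilon> b = (Y \<triangleleft> \<epsilon>) \<cdot> b"

definition wreath_mult :: "'o \<Rightarrow> 'a \<Rightarrow> 'o \<Rightarrow> 'o \<Rightarrow> 'a \<Rightarrow> 'a \<Rightarrow> 'a \<Rightarrow> 'a \<Rightarrow> 'a" where
  "wreath_mult A m X Y \<psi> \<delta> b d =
     (Y \<triangleleft> m) \<cdot> (Y \<triangleleft> m \<triangleright> A) \<cdot> (Y \<otimes> A \<otimes> A \<triangleleft> d \<triangleright> A) \<cdot> (Y \<otimes> A \<triangleleft> \<psi> \<triangleright> Y \<otimes> A) \<cdot>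
     (Y \<otimes> A \<otimes> X \<triangleleft> d \<triangleright> A \<otimes> Y \<otimes> A) \<cdot> (Y \<triangleleft> \<delta> \<triangleright> Y \<otimes> A \<otimes> Y \<otimes> A) \<cdot>
     (b \<triangleright> Y \<otimes> A \<otimes> Y \<otimes> A)"

definition wreath_unit :: "'o \<Rightarrow> 'a \<Rightarrow> 'a \<Rightarrow> 'a" where
  "wreath_unit Y \<epsilon> b = (Y \<triangleleft> \<epsilon>) \<cdot> b"

definition wreath_incl :: "'o \<Rightarrow> 'a \<Rightarrow> 'o \<Rightarrow> 'a \<Rightarrow> 'a \<Rightarrow> 'a" where
  "wreath_incl A m Y \<epsilon> b = (Y \<triangleleft> m) \<cdot> (wreath_unit Y \<epsilon> b \<triangleright> A)"

end

end

theory Submission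
  imports Defs
begin

text \<open>Everything is translated into statements about elements. A bicolinear retraction of the
  comultiplication of \<open>(X, \<psi>)\<close> is determined by its composite with the counit, a Casimir form
  \<open>\<beta> : XX \<rightarrow> A\<close>. The dual pair turns \<open>\<beta>\<close> into an element \<open>\<one> \<rightarrow> YYA\<close>, and the conditions on \<open>\<beta>\<close> say that this
  element is central and is mapped to the unit by the multiplication of the wreath product \<open>S = YA\<close>.
  Since \<open>S\<close> is free as a right \<open>A\<close>-module, \<open>S \<otimes>\<^sub>A S\<close> is \<open>YS = YYA\<close>, so these elements are the Casimir
  elements of the extension \<open>A \<rightarrow> S\<close>, which are the values at the unit of bilinear sections of
  \<open>S \<otimes>\<^sub>A S \<rightarrow> S\<close>. The same sections describe separability in \<open>A\<close>-bimodules. Taking mates under the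
  dual pair exchanges retractions of \<open>\<delta>\<close> with sections of the multiplication of \<open>(Y, \<phi>)\<close>.
  For restriction of scalars, a Casimir element \<open>\<Sigma> x \<otimes> y\<close> gives the natural retraction
  \<open>f \<mapsto> (n \<mapsto> \<Sigma> f (n x) y)\<close>. Conversely, a natural retraction applied to \<open>s \<mapsto> s \<otimes> 1\<close> yields a section that is
  right linear, and commutes with left multiplication by elements \<open>\<one> \<rightarrow> S\<close> by naturality; the
  generator hypothesis makes it left linear.\<close>

section \<open>String diagrams in a strict monoidal category\<close>

text \<open>The laws to be compared have many strands and differ mainly by the interchange of boxes
  on disjoint strands, so nearly every equation is proved by rewriting two diagrams to a common
  normal form: \<open>lift_eq\<close> turns an equation of arrows into a rewriting rule at every
  position, and \<open>diagram_eq\<close> returns to arrows. In an equation whose target starts with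
  \<open>Y\<close>, the cups inside \<open>\<phi>\<close> and inside the product of
  \<open>YA\<close> hide the cowreath. Closing the outer \<open>Y\<close> by \<open>d\<close> is
  injective and replaces each dual structure by the cowreath structure it comes from. Coseparability
  is unfolded twice: as a Casimir form \<open>XX \<rightarrow> A\<close>, which fits the extension,
  and as a retraction \<open>XX \<rightarrow> AX\<close>, whose mate
  \<open>Y \<rightarrow> YYA\<close> has the type of a section of the dual multiplication. Nested
  duals reverse the order of factors, so left and right are exchanged on the way. Left coflatness
  and robustness enter at one point: the quotient map to a tensor product over \<open>A\<close>
  stays a coequalizer, in particular epi, when whiskered on the right and on the left. Maps out of
  iterated tensor products can then be defined and compared on representatives.\<close>

locale diagrams = strict_monoidal_category C for C :: "('o, 'a) moncat" (structure)
begin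

section \<open>Typing and normalization of arrows in a strict monoidal category\<close>

lemma homD:
  assumes "f \<in> hom C X Y"
  shows "f \<in> arrs C" "source C f = X" "target C f = Y" "X \<in> objs C" "Y \<in> objs C"
  using assms source_obj target_obj unfolding hom_def by auto

lemma homI: "f \<in> arrs C \<Longrightarrow> source C f = X \<Longrightarrow> target C f = Y \<Longrightarrow> f \<in> hom C X Y"
  unfolding hom_def by simp

lemma obj_simps [simp]:
  "\<one> \<in> objs C"
  "X \<in> objs C \<Longrightarrow> Y \<in> objs C \<Longrightarrow> X \<otimes> Y \<in> objs C"
  "f \<in> arrs C \<Longrightarrow> source C f \<in> objs C"
  "f \<in> arrs C \<Longrightarrow> target C f \<in> objs C"
  using unit_obj tensor_obj source_obj target_obj by auto

lemma ob_simps [simp]: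
  "X \<in> objs C \<Longrightarrow> Y \<in> objs C \<Longrightarrow> Z \<in> objs C \<Longrightarrow> (X \<otimes> Y) \<otimes> Z = X \<otimes> (Y \<otimes> Z)"
  "X \<in> objs C \<Longrightarrow> \<one> \<otimes> X = X"
  "X \<in> objs C \<Longrightarrow> X \<otimes> \<one> = X"
  using strict_assoc strict_unit_left strict_unit_right by auto

lemma ident_simps [simp]:
  assumes "X \<in> objs C"
  shows "ident C X \<in> arrs C" "source C (ident C X) = X" "target C (ident C X) = X"
  using homD[OF ident_hom[OF assms]] by auto

lemma cmp_simps [simp]:
  assumes "f \<in> arrs C" "g \<in> arrs C" "source C g = target C f"
  shows "g \<cdot> f \<in> arrs C" "source C (g \<cdot> f) = source C f" "target C (g \<cdot> f) = target C g"
  using homD[OF cmp_hom[of f "source C f" "target C f" g "target C g"]] assms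
  by (auto simp: hom_def)

lemma tensor_simps [simp]:
  assumes "f \<in> arrs C" "g \<in> arrs C"
  shows "f \<boxtimes> g \<in> arrs C" "source C (f \<boxtimes> g) = source C f \<otimes> source C g"
    "target C (f \<boxtimes> g) = target C f \<otimes> target C g"
  using homD[OF tensor_hom[of f "source C f" "target C f" g "source C g" "target C g"]] assms
  by (auto simp: hom_def)

lemma cmp_assoc_simp [simp]:
  "f \<in> arrs C \<Longrightarrow> g \<in> arrs C \<Longrightarrow> h \<in> arrs C \<Longrightarrow> source C g = target C f \<Longrightarrow>
    source C h = target C g \<Longrightarrow> (h \<cdot> g) \<cdot> f = h \<cdot> (g \<cdot> f)"
  using cmp_assoc[of f "source C f" "target C f" g "target C g" h "target C h"]
  by (auto simp: hom_def)

lemma ident_cmp [simp]: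
  "f \<in> arrs C \<Longrightarrow> target C f = Y \<Longrightarrow> ident C Y \<cdot> f = f"
  "f \<in> arrs C \<Longrightarrow> source C f = X \<Longrightarrow> f \<cdot> ident C X = f"
  using ident_left ident_right by (auto simp: hom_def)

lemma tensor_ident_simp [simp]:
  "X \<in> objs C \<Longrightarrow> Y \<in> objs C \<Longrightarrow> ident C X \<boxtimes> ident C Y = ident C (X \<otimes> Y)"
  by (rule tensor_ident)

lemma tensor_assoc_arr [simp]:
  assumes "f \<in> arrs C" "g \<in> arrs C" "h \<in> arrs C"
  shows "(f \<boxtimes> g) \<boxtimes> h = f \<boxtimes> (g \<boxtimes> h)"
  using associator_natural[of f "source C f" "target C f" g "source C g" "target C g"
      h "source C h" "target C h"] assms
  by (simp add: hom_def strict_associator)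

lemma tensor_unit_arr [simp]:
  assumes "f \<in> arrs C"
  shows "ident C \<one> \<boxtimes> f = f" "f \<boxtimes> ident C \<one> = f"
  using left_unitor_natural[of f "source C f" "target C f"]
    right_unitor_natural[of f "source C f" "target C f"] assms
  by (simp_all add: hom_def strict_left_unitor strict_right_unitor)

lemma tensor_ident_ident [simp]:
  "f \<in> arrs C \<Longrightarrow> X \<in> objs C \<Longrightarrow> Y \<in> objs C \<Longrightarrow>
    ident C X \<boxtimes> (ident C Y \<boxtimes> f) = ident C (X \<otimes> Y) \<boxtimes> f"
  by (simp flip: tensor_assoc_arr)

lemma tensor_cmp_arr:
  "f \<in> arrs C \<Longrightarrow> f' \<in> arrs C \<Longrightarrow> g \<in> arrs C \<Longrightarrow> g' \<in> arrs C \<Longrightarrow>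
    source C f' = target C f \<Longrightarrow> source C g' = target C g \<Longrightarrow>
    (f' \<boxtimes> g') \<cdot> (f \<boxtimes> g) = (f' \<cdot> f) \<boxtimes> (g' \<cdot> g)"
  using tensor_cmp[of f "source C f" "target C f" f' "target C f'" g "source C g" "target C g" g'
      "target C g'"]
  by (auto simp: hom_def)

text \<open>Pushing whiskerings inside composites makes every normalized arrow a right-nested
  composite of single whiskered boxes. This is the shape that \<open>darr\<close> produces, so the
  simplifier can match ordinary equations with diagrams.\<close>

lemma whisker_cmp [simp]:
  assumes "f \<in> arrs C" "g \<in> arrs C" "source C g = target C f" "X \<in> objs C"
  shows "ident C X \<boxtimes> (g \<cdot> f) = (ident C X \<boxtimes> g) \<cdot> (ident C X \<boxtimes> f)"
    "(g \<cdot> f) \<boxtimes> ident C X = (g \<boxtimes> ident C X) \<cdot> (f \<boxtimes> ident C X)"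
  using assms by (simp_all add: tensor_cmp_arr)

lemma tensor_split:
  assumes "f \<in> hom C X X'" "g \<in> hom C Y Y'"
  shows "f \<boxtimes> g = (f \<boxtimes> ident C Y') \<cdot> (ident C X \<boxtimes> g)"
  using homD[OF assms(1)] homD[OF assms(2)] by (simp add: tensor_cmp_arr)

section \<open>Words of objects, slices and the interchange law\<close>

definition ten :: "'o list \<Rightarrow> 'o" where
  "ten w = foldr (tensor_ob C) w \<one>"

lemma ten_simps [simp]: "ten [] = \<one>" "ten (X # w) = X \<otimes> ten w"
  by (simp_all add: ten_def)

lemma ten_obj [simp]: "set w \<subseteq> objs C \<Longrightarrow> ten w \<in> objs C"
  by (induction w) auto

lemma ten_append [simp]:
  "set u \<subseteq> objs C \<Longrightarrow> set v \<subseteq> objs C \<Longrightarrow> ten (u @ v) = ten u \<otimes> ten v"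
  by (induction u) auto

end

text \<open>The source and target of an arrow are single objects and do not determine a
  factorization into letters. A box therefore records words, so that positions in a diagram can
  count strands.\<close>

datatype ('o, 'a) box = Box (barr: 'a) (bdom: "'o list") (bcod: "'o list")

context diagrams
begin

definition wfb :: "('o, 'a) box \<Rightarrow> bool" where
  "wfb \<beta> \<longleftrightarrow> set (bdom \<beta>) \<subseteq> objs C \<and> set (bcod \<beta>) \<subseteq> objs C \<and>
     barr \<beta> \<in> hom C (ten (bdom \<beta>)) (ten (bcod \<beta>))"

definition sok :: "'o list \<Rightarrow> 'a \<Rightarrow> bool" where
  "sok w h \<longleftrightarrow> set w \<subseteq> objs C \<and> h \<in> arrs C \<and> target C h = ten w"

text \<open>A state of a diagram is a word of objects with an arrow into its tensor product. A slice \<open>sl n \<beta>\<close>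
  composes it with the box \<open>\<beta>\<close> acting on the letters from position \<open>n\<close> on, and is \<open>None\<close> if \<open>\<beta>\<close> does not
  fit there. Failure makes the rewriting rules for slices unconditional in the state, so that the
  simplifier can normalize diagrams; the guards \<open>gd\<close> record the typing that a contracted slice checked.\<close>

definition sl :: "nat \<Rightarrow> ('o, 'a) box \<Rightarrow> ('o list \<times> 'a) option \<Rightarrow> ('o list \<times> 'a) option" where
  "sl n \<beta> st = (case st of None \<Rightarrow> None | Some (w, h) \<Rightarrow>
     if wfb \<beta> \<and> sok w h \<and> n \<le> length w \<and> take (length (bdom \<beta>)) (drop n w) = bdom \<beta>
     then Some (take n w @ bcod \<beta> @ drop (n + length (bdom \<beta>)) w,
       (ident C (ten (take n w)) \<boxtimes> barr \<beta> \<boxtimes> ident C (ten (drop (n + length (bdom \<beta>)) w))) \<cdot> h)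
     else None)"

definition gd :: "nat \<Rightarrow> 'o \<Rightarrow> ('o list \<times> 'a) option \<Rightarrow> ('o list \<times> 'a) option" where
  "gd j X st = (case st of None \<Rightarrow> None | Some (w, h) \<Rightarrow>
     if sok w h \<and> j < length w \<and> w ! j = X then Some (w, h) else None)"

definition vd :: "('o list \<times> 'a) option \<Rightarrow> ('o list \<times> 'a) option" where
  "vd st = (case st of None \<Rightarrow> None | Some (w, h) \<Rightarrow> if sok w h then Some (w, h) else None)"

lemma sl_app:
  assumes "wfb \<beta>" "sok (u @ bdom \<beta> @ v) h"
  shows "sl (length u) \<beta> (Some (u @ bdom \<beta> @ v, h)) =
      Some (u @ bcod \<beta> @ v, (ident C (ten u) \<boxtimes> barr \<beta> \<boxtimes> ident C (ten v)) \<cdot> h)"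
    and "sok (u @ bcod \<beta> @ v) ((ident C (ten u) \<boxtimes> barr \<beta> \<boxtimes> ident C (ten v)) \<cdot> h)"
proof -
  show "sl (length u) \<beta> (Some (u @ bdom \<beta> @ v, h)) =
      Some (u @ bcod \<beta> @ v, (ident C (ten u) \<boxtimes> barr \<beta> \<boxtimes> ident C (ten v)) \<cdot> h)"
    using assms by (simp add: sl_def)
  show "sok (u @ bcod \<beta> @ v) ((ident C (ten u) \<boxtimes> barr \<beta> \<boxtimes> ident C (ten v)) \<cdot> h)"
    using assms by (auto simp: sok_def wfb_def hom_def)
qed

lemma sl_cases:
  assumes "sl n \<beta> st \<noteq> None"
  obtains u v h where "st = Some (u @ bdom \<beta> @ v, h)" "length u = n" "wfb \<beta>" "sok (u @ bdom \<beta> @ v) h"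
proof -
  obtain w h where st: "st = Some (w, h)" and *: "wfb \<beta>" "sok w h" "n \<le> length w"
      "take (length (bdom \<beta>)) (drop n w) = bdom \<beta>"
    using assms unfolding sl_def by (auto split: option.splits prod.splits if_splits)
  have w: "w = take n w @ bdom \<beta> @ drop (length (bdom \<beta>)) (drop n w)"
    using append_take_drop_id[of n w] append_take_drop_id[of "length (bdom \<beta>)" "drop n w"] *(4) by simp
  show thesis
    using that[of "take n w" "drop (length (bdom \<beta>)) (drop n w)" h] st * w by auto
qed

lemma slice_exchange:
  assumes "f \<in> hom C F F'" "g \<in> hom C G G'" "U \<in> objs C" "V \<in> objs C" "W \<in> objs C"
  shows "(ident C U \<boxtimes> g \<boxtimes> ident C (V \<otimes> F' \<otimes> W)) \<cdot> (ident C (U \<otimes> G \<otimes> V) \<boxtimes> f \<boxtimes> ident C W) =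
    (ident C (U \<otimes> G' \<otimes> V) \<boxtimes> f \<boxtimes> ident C W) \<cdot> (ident C U \<boxtimes> g \<boxtimes> ident C (V \<otimes> F \<otimes> W))"
proof -
  note [simp] = homD[OF assms(1)] homD[OF assms(2)] assms(3-5)
  have "(ident C U \<boxtimes> g \<boxtimes> ident C (V \<otimes> F' \<otimes> W)) \<cdot> (ident C (U \<otimes> G \<otimes> V) \<boxtimes> f \<boxtimes> ident C W) =
    (ident C U \<boxtimes> (g \<boxtimes> ident C (V \<otimes> F' \<otimes> W))) \<cdot> (ident C U \<boxtimes> (ident C G \<boxtimes> (ident C V \<boxtimes> f \<boxtimes> ident C W)))"
    by simp
  also have "\<dots> = ident C U \<boxtimes> (g \<boxtimes> (ident C V \<boxtimes> f \<boxtimes> ident C W))"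
    by (subst tensor_cmp_arr; simp add: tensor_cmp_arr del: tensor_ident_ident)
  also have "\<dots> = (ident C U \<boxtimes> (ident C G' \<boxtimes> (ident C V \<boxtimes> f \<boxtimes> ident C W))) \<cdot> (ident C U \<boxtimes> (g \<boxtimes> ident C (V \<otimes> F \<otimes> W)))"
    by (subst tensor_cmp_arr; simp add: tensor_cmp_arr del: tensor_ident_ident)
  also have "\<dots> = (ident C (U \<otimes> G' \<otimes> V) \<boxtimes> f \<boxtimes> ident C W) \<cdot> (ident C U \<boxtimes> g \<boxtimes> ident C (V \<otimes> F \<otimes> W))"
    by simp
  finally show ?thesis .
qed

lemma sl_None [simp]: "sl n \<beta> None = None" by (simp add: sl_def)

text \<open>If all boxes fit, this is bifunctoriality of the tensor product. Otherwise the point is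
  that both orders fail together: a successful run in either order yields a decomposition of the
  word in which the two boxes act on disjoint blocks.\<close>

lemma exchange:
  assumes "k + length (bdom \<gamma>) \<le> n"
  shows "sl k \<gamma> (sl n \<beta> st) =
    sl (n - length (bdom \<gamma>) + length (bcod \<gamma>)) \<beta> (sl k \<gamma> st)"
proof (cases "\<exists>u v z h. st = Some (u @ bdom \<gamma> @ v @ bdom \<beta> @ z, h) \<and> length u = k \<and>
    n = k + length (bdom \<gamma>) + length v \<and> wfb \<beta> \<and> wfb \<gamma> \<and> sok (u @ bdom \<gamma> @ v @ bdom \<beta> @ z) h")
  case True
  then obtain u v z h where st: "st = Some (u @ bdom \<gamma> @ v @ bdom \<beta> @ z, h)"
    and k: "length u = k" and n: "n = k + length (bdom \<gamma>) + length v"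
    and wf: "wfb \<beta>" "wfb \<gamma>" and ok: "sok (u @ bdom \<gamma> @ v @ bdom \<beta> @ z) h" by blast
  let ?G = "ten (bdom \<gamma>)" and ?G' = "ten (bcod \<gamma>)" and ?F = "ten (bdom \<beta>)" and ?F' = "ten (bcod \<beta>)"
  have sets: "set u \<subseteq> objs C" "set v \<subseteq> objs C" "set z \<subseteq> objs C"
    "set (bdom \<gamma>) \<subseteq> objs C" "set (bcod \<gamma>) \<subseteq> objs C" "set (bdom \<beta>) \<subseteq> objs C" "set (bcod \<beta>) \<subseteq> objs C"
    and g: "barr \<gamma> \<in> hom C ?G ?G'" and f: "barr \<beta> \<in> hom C ?F ?F'"
    and h: "h \<in> arrs C" "target C h = ten (u @ bdom \<gamma> @ v @ bdom \<beta> @ z)"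
    using ok wf unfolding sok_def wfb_def by auto
  let ?h1 = "(ident C (ten (u @ bdom \<gamma> @ v)) \<boxtimes> barr \<beta> \<boxtimes> ident C (ten z)) \<cdot> h"
  let ?h2 = "(ident C (ten u) \<boxtimes> barr \<gamma> \<boxtimes> ident C (ten (v @ bdom \<beta> @ z))) \<cdot> h"
  have 1: "sl n \<beta> st = Some (u @ bdom \<gamma> @ v @ bcod \<beta> @ z, ?h1)"
      "sok (u @ bdom \<gamma> @ v @ bcod \<beta> @ z) ?h1"
    using sl_app[of \<beta> "u @ bdom \<gamma> @ v" z h] wf ok by (simp_all add: st k n add.assoc)
  have 2: "sl k \<gamma> (sl n \<beta> st) = Some (u @ bcod \<gamma> @ v @ bcod \<beta> @ z,
      (ident C (ten u) \<boxtimes> barr \<gamma> \<boxtimes> ident C (ten (v @ bcod \<beta> @ z))) \<cdot> ?h1)"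
    using sl_app(1)[of \<gamma> u "v @ bcod \<beta> @ z" ?h1] wf 1 by (simp add: k)
  have 3: "sl k \<gamma> st = Some (u @ bcod \<gamma> @ v @ bdom \<beta> @ z, ?h2)"
      "sok (u @ bcod \<gamma> @ v @ bdom \<beta> @ z) ?h2"
    using sl_app[of \<gamma> u "v @ bdom \<beta> @ z" h] wf ok by (simp_all add: st k)
  have 4: "sl (n - length (bdom \<gamma>) + length (bcod \<gamma>)) \<beta> (sl k \<gamma> st) =
      Some (u @ bcod \<gamma> @ v @ bcod \<beta> @ z,
        (ident C (ten (u @ bcod \<gamma> @ v)) \<boxtimes> barr \<beta> \<boxtimes> ident C (ten z)) \<cdot> ?h2)"
  proof -
    have "n - length (bdom \<gamma>) + length (bcod \<gamma>) = length (u @ bcod \<gamma> @ v)"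
      using k n by simp
    then show ?thesis
      unfolding 3(1) using sl_app(1)[of \<beta> "u @ bcod \<gamma> @ v" z ?h2] wf 3(2) by (simp add: ac_simps)
  qed
  have "(ident C (ten u) \<boxtimes> barr \<gamma> \<boxtimes> ident C (ten (v @ bcod \<beta> @ z))) \<cdot> ?h1 =
      ((ident C (ten u) \<boxtimes> barr \<gamma> \<boxtimes> ident C (ten v \<otimes> ?F' \<otimes> ten z)) \<cdot>
       (ident C (ten u \<otimes> ?G \<otimes> ten v) \<boxtimes> barr \<beta> \<boxtimes> ident C (ten z))) \<cdot> h"
    using sets homD[OF g] homD[OF f] h by simp
  also have "\<dots> = (ident C (ten (u @ bcod \<gamma> @ v)) \<boxtimes> barr \<beta> \<boxtimes> ident C (ten z)) \<cdot> ?h2"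
    using sets homD[OF g] homD[OF f] h by (subst slice_exchange[OF f g]) simp_all
  finally show ?thesis unfolding 2 4 by simp
next
  case False
  have "sl k \<gamma> (sl n \<beta> st) = None"
  proof (rule ccontr)
    assume a: "sl k \<gamma> (sl n \<beta> st) \<noteq> None"
    then have "sl n \<beta> st \<noteq> None" by (metis sl_None)
    then obtain u v h where st: "st = Some (u @ bdom \<beta> @ v, h)" "length u = n" "wfb \<beta>"
        "sok (u @ bdom \<beta> @ v) h" by (rule sl_cases)
    from a obtain u' v' h' where st': "sl n \<beta> st = Some (u' @ bdom \<gamma> @ v', h')" "length u' = k" "wfb \<gamma>"
      by (rule sl_cases)
    have eq: "u @ bcod \<beta> @ v = u' @ bdom \<gamma> @ v'"
      using st st' sl_app(1)[of \<beta> u v h] by auto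
    \<comment> \<open>The box \<open>\<beta>\<close> leaves the first \<open>n\<close> letters
      alone, so the block consumed by \<open>\<gamma>\<close> was already present before it. The
      word \<open>y\<close> consists of the letters between the two blocks.\<close>
    define y where "y = drop (length (u' @ bdom \<gamma>)) u"
    have "u = take (length (u' @ bdom \<gamma>)) u @ y" by (simp add: y_def)
    moreover have "take (length (u' @ bdom \<gamma>)) u = u' @ bdom \<gamma>"
    proof -
      have "take (length (u' @ bdom \<gamma>)) u = take (length (u' @ bdom \<gamma>)) (u @ bcod \<beta> @ v)"
        using assms st st' by simp
      also have "\<dots> = u' @ bdom \<gamma>" unfolding eq by simp
      finally show ?thesis .
    qed
    ultimately have "u = u' @ bdom \<gamma> @ y" by simp
    then show False using False st st' by auto
  qed
  moreover have "sl (n - length (bdom \<gamma>) + length (bcod \<gamma>)) \<beta> (sl k \<gamma> st) = None"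
  proof (rule ccontr)
    let ?n = "n - length (bdom \<gamma>) + length (bcod \<gamma>)"
    assume a: "sl ?n \<beta> (sl k \<gamma> st) \<noteq> None"
    then have "sl k \<gamma> st \<noteq> None" by (metis sl_None)
    then obtain u v h where st: "st = Some (u @ bdom \<gamma> @ v, h)" "length u = k" "wfb \<gamma>"
        "sok (u @ bdom \<gamma> @ v) h" by (rule sl_cases)
    from a obtain u' v' h' where st': "sl k \<gamma> st = Some (u' @ bdom \<beta> @ v', h')" "length u' = ?n" "wfb \<beta>"
      by (rule sl_cases)
    have eq: "u @ bcod \<gamma> @ v = u' @ bdom \<beta> @ v'"
      using st st' sl_app(1)[of \<gamma> u v h] by auto
    let ?j = "length (u @ bcod \<gamma>)"
    have j: "?j \<le> length u'" using assms st st' by simp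
    have "drop ?j (u @ bcod \<gamma> @ v) = drop ?j u' @ bdom \<beta> @ v'" unfolding eq using j by simp
    then have v: "v = drop ?j u' @ bdom \<beta> @ v'" by simp
    have "n = k + length (bdom \<gamma>) + length (drop ?j u')"
      using st' st(2) assms by simp
    then show False using False st(1-4) st'(3) v by metis
  qed
  ultimately show ?thesis by simp
qed

lemma gd_None [simp]: "gd n X None = None" by (simp add: gd_def)

section \<open>Diagrams as lists of slices, and the lifting of equations\<close>

definition start :: "'o list \<Rightarrow> ('o list \<times> 'a) option" where
  "start w = Some (w, ident C (ten w))"

text \<open>The head of the list is applied last, so that a list reads in the same order as a
  composite of arrows.\<close>

fun run :: "(nat \<times> ('o, 'a) box) list \<Rightarrow> ('o list \<times> 'a) option \<Rightarrow> ('o list \<times> 'a) option" where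
  "run [] st = st"
| "run ((k, \<beta>) # L) st = sl k \<beta> (run L st)"

fun run_from :: "nat \<Rightarrow> (nat \<times> ('o, 'a) box) list \<Rightarrow> ('o list \<times> 'a) option \<Rightarrow> ('o list \<times> 'a) option" where
  "run_from n [] st = st"
| "run_from n ((k, \<beta>) # L) st = sl (n + k) \<beta> (run_from n L st)"

fun wout :: "(nat \<times> ('o, 'a) box) list \<Rightarrow> 'o list \<Rightarrow> 'o list" where
  "wout [] w = w"
| "wout ((k, \<beta>) # L) w = take k (wout L w) @ bcod \<beta> @ drop (k + length (bdom \<beta>)) (wout L w)"

fun darr :: "(nat \<times> ('o, 'a) box) list \<Rightarrow> 'o list \<Rightarrow> 'a" where
  "darr [] w = ident C (ten w)"
| "darr ((k, \<beta>) # L) w =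
     (ident C (ten (take k (wout L w))) \<boxtimes> barr \<beta> \<boxtimes>
      ident C (ten (drop (k + length (bdom \<beta>)) (wout L w)))) \<cdot> darr L w"

fun dok :: "(nat \<times> ('o, 'a) box) list \<Rightarrow> 'o list \<Rightarrow> bool" where
  "dok [] w \<longleftrightarrow> set w \<subseteq> objs C"
| "dok ((k, \<beta>) # L) w \<longleftrightarrow> dok L w \<and> wfb \<beta> \<and> k \<le> length (wout L w) \<and>
     take (length (bdom \<beta>)) (drop k (wout L w)) = bdom \<beta>"

text \<open>Typing of a diagram is local: once it fits its own input word, it acts inside any larger
  word as one whiskered arrow. The surrounding words \<open>u\<close> and \<open>v\<close> are what
  later allows an equation to be used at an arbitrary position.\<close>

lemma dok_run_from:
  assumes "dok L w" "sok (u @ w @ v) h"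
  shows "run_from (length u) L (Some (u @ w @ v, h)) =
      Some (u @ wout L w @ v, (ident C (ten u) \<boxtimes> darr L w \<boxtimes> ident C (ten v)) \<cdot> h)
    \<and> sok (u @ wout L w @ v) ((ident C (ten u) \<boxtimes> darr L w \<boxtimes> ident C (ten v)) \<cdot> h)
    \<and> set (wout L w) \<subseteq> objs C \<and> darr L w \<in> hom C (ten w) (ten (wout L w))"
  using assms
proof (induction L w rule: dok.induct)
  case (1 w)
  have *: "set u \<subseteq> objs C" "set v \<subseteq> objs C" "set w \<subseteq> objs C" "h \<in> arrs C" "target C h = ten (u @ w @ v)"
    using 1(2) by (auto simp: sok_def)
  then have "target C h = ten u \<otimes> ten w \<otimes> ten v" by simp
  with * show ?case by (simp add: sok_def hom_def)
next
  case (2 k \<beta> L w)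
  let ?w = "wout L w"
  let ?u = "take k ?w" and ?v = "drop (k + length (bdom \<beta>)) ?w"
  let ?h = "(ident C (ten u) \<boxtimes> darr L w \<boxtimes> ident C (ten v)) \<cdot> h"
  from 2 have IH: "run_from (length u) L (Some (u @ w @ v, h)) = Some (u @ ?w @ v, ?h)"
      "sok (u @ ?w @ v) ?h" "set ?w \<subseteq> objs C" "darr L w \<in> hom C (ten w) (ten ?w)" by auto
  from 2 have \<beta>: "wfb \<beta>" "k \<le> length ?w" "take (length (bdom \<beta>)) (drop k ?w) = bdom \<beta>" by auto
  have w: "?w = ?u @ bdom \<beta> @ ?v"
    using append_take_drop_id[of k ?w] append_take_drop_id[of "length (bdom \<beta>)" "drop k ?w"] \<beta>(3)
    by (simp add: add.commute)
  have sets: "set ?u \<subseteq> objs C" "set ?v \<subseteq> objs C" "set u \<subseteq> objs C" "set v \<subseteq> objs C"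
      "set (bdom \<beta>) \<subseteq> objs C" "set (bcod \<beta>) \<subseteq> objs C"
    using IH(2,3) \<beta>(1) set_take_subset[of k ?w] set_drop_subset[of "k + length (bdom \<beta>)" ?w]
    by (auto simp: sok_def wfb_def)
  have \<beta>h: "barr \<beta> \<in> hom C (ten (bdom \<beta>)) (ten (bcod \<beta>))" using \<beta>(1) by (simp add: wfb_def)
  have t: "ten ?w = ten ?u \<otimes> ten (bdom \<beta>) \<otimes> ten ?v"
    by (subst w) (use sets in simp)
  have h: "h \<in> arrs C" "target C h = ten u \<otimes> ten w \<otimes> ten v" "set w \<subseteq> objs C"
    using 2(3) by (auto simp: sok_def)
  have eqw: "u @ ?w @ v = (u @ ?u) @ bdom \<beta> @ (?v @ v)" by (subst w) simp
  have lu: "length (u @ ?u) = length u + k" using \<beta>(2) by simp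
  have s: "sok ((u @ ?u) @ bdom \<beta> @ (?v @ v)) ?h" using IH(2) unfolding eqw .
  note app = sl_app[OF \<beta>(1) s, unfolded lu]
  note facts = sets homD(1-3)[OF \<beta>h] homD(1-3)[OF IH(4)] h t
  have arr: "(ident C (ten (u @ ?u)) \<boxtimes> barr \<beta> \<boxtimes> ident C (ten (?v @ v))) \<cdot> ?h
      = (ident C (ten u) \<boxtimes> darr ((k, \<beta>) # L) w \<boxtimes> ident C (ten v)) \<cdot> h"
    using facts by simp
  have "run_from (length u) ((k, \<beta>) # L) (Some (u @ w @ v, h)) =
      Some (u @ wout ((k, \<beta>) # L) w @ v, (ident C (ten u) \<boxtimes> darr ((k, \<beta>) # L) w \<boxtimes> ident C (ten v)) \<cdot> h)"
    using app(1) unfolding arr run_from.simps IH(1) eqw by simp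
  moreover have "sok (u @ wout ((k, \<beta>) # L) w @ v)
      ((ident C (ten u) \<boxtimes> darr ((k, \<beta>) # L) w \<boxtimes> ident C (ten v)) \<cdot> h)"
    using app(2) unfolding arr by simp
  moreover have "darr ((k, \<beta>) # L) w \<in> hom C (ten w) (ten (wout ((k, \<beta>) # L) w))"
    using facts by (auto intro!: homI)
  ultimately show ?case using sets by simp
qed

lemma run_from_0: "run_from 0 L st = run L st"
  by (induction L) auto

lemma run_start:
  assumes "dok L w"
  shows "run L (start w) = Some (wout L w, darr L w)" "darr L w \<in> hom C (ten w) (ten (wout L w))"
    "set (wout L w) \<subseteq> objs C"
proof -
  have w: "set w \<subseteq> objs C" using assms by (induction L w rule: dok.induct) auto
  then have "sok ([] @ w @ []) (ident C (ten w))" by (simp add: sok_def)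
  note * = dok_run_from[OF assms this]
  show 2: "darr L w \<in> hom C (ten w) (ten (wout L w))" "set (wout L w) \<subseteq> objs C" using * by auto
  show "run L (start w) = Some (wout L w, darr L w)"
    using * homD[OF 2(1)] w by (simp add: run_from_0 start_def)
qed

lemma diagram_eq:
  assumes "run L (start w) = run L' (start w)" "dok L w" "dok L' w"
  shows "darr L w = darr L' w"
  using assms run_start by simp

text \<open>The guard for an empty input word. A box without inputs can be placed as soon as its
  position lies within the word, and this is all that is recorded.\<close>

definition gl :: "nat \<Rightarrow> ('o list \<times> 'a) option \<Rightarrow> ('o list \<times> 'a) option" where
  "gl n st = (case st of None \<Rightarrow> None | Some (w, h) \<Rightarrow> if sok w h \<and> n \<le> length w then st else None)"

fun gds :: "nat \<Rightarrow> 'o list \<Rightarrow> ('o list \<times> 'a) option \<Rightarrow> ('o list \<times> 'a) option" where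
  "gds n [] st = gl n st"
| "gds n (X # w) st = gd n X (gds (Suc n) w st)"

lemma gl_simps [simp]:
  "gd n X (gl (Suc n) st) = gd n X st" "sl n \<beta> (gl n st) = sl n \<beta> st"
  "gl 0 (start []) = start []"
  by (auto simp: gd_def gl_def sl_def sok_def start_def split: option.splits)

lemma gds_cases:
  assumes "gds n w st \<noteq> None"
  shows "\<exists>u v h. st = Some (u @ w @ v, h) \<and> length u = n \<and> sok (u @ w @ v) h \<and> gds n w st = st"
  using assms
proof (induction w arbitrary: n)
  case Nil
  then obtain w h where "st = Some (w, h)" "sok w h" "n \<le> length w"
    by (auto simp: gl_def split: option.splits if_splits)
  then show ?case
    by (intro exI[of _ "take n w"] exI[of _ "drop n w"] exI[of _ h]) (simp add: gl_def)
next
  case (Cons X w)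
  have "gds (Suc n) w st \<noteq> None" using Cons.prems by (metis gd_None gds.simps(2))
  from Cons.IH[OF this] obtain u v h where *: "st = Some (u @ w @ v, h)" "length u = Suc n"
    "sok (u @ w @ v) h" "gds (Suc n) w st = st" by blast
  have "(u @ w @ v) ! n = X" "n < length (u @ w @ v)" using Cons.prems * by (auto simp: gd_def split: if_splits)
  then have X: "u ! n = X" using * by (simp add: nth_append)
  have "u = take n u @ [X]" using *(2) X by (metis append_take_drop_id Cons_nth_drop_Suc drop_all lessI order_refl)
  then have "u @ w @ v = take n u @ (X # w) @ v" by (metis append.assoc append_Cons append_Nil)
  moreover have "length (take n u) = n" using * by simp
  moreover have "gds n (X # w) st = st" using Cons.prems * by (auto simp: gd_def split: if_splits)
  ultimately show ?case using * by metis
qed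

text \<open>Under the guard that \<open>w\<close> stands at position \<open>n\<close>, both sides
  pass the same typing test, so a whole diagram may be contracted to a single box carrying its
  composite.\<close>

lemma fold_box:
  assumes "dok L w"
  shows "run_from n L (gds n w st) = sl n (Box (darr L w) w (wout L w)) (gds n w st)"
proof (cases "gds n w st = None")
  case True
  have "run_from n L None = None" by (induction L) auto
  then show ?thesis using True by simp
next
  case False
  from gds_cases[OF False] obtain u v h where *: "st = Some (u @ w @ v, h)" "length u = n"
    "sok (u @ w @ v) h" "gds n w st = st" by blast
  note r = dok_run_from[OF assms *(3)]
  have "set w \<subseteq> objs C" using * by (simp add: sok_def)
  then have "wfb (Box (darr L w) w (wout L w))" using r by (simp add: wfb_def)
  from sl_app(1)[of "Box (darr L w) w (wout L w)" u v h] this *(3)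
  have "sl (length u) (Box (darr L w) w (wout L w)) (Some (u @ w @ v, h)) = run_from (length u) L (Some (u @ w @ v, h))"
    using r by simp
  moreover have "gds n w st = Some (u @ w @ v, h)" using *(1,4) by simp
  ultimately show ?thesis using *(2) by metis
qed

text \<open>Both sides contract to the same box by \<open>fold_box\<close>. Nearly all rewriting
  rules below are instances; afterwards \<open>gout\<close> lets the boxes absorb the guards, and a
  guard survives exactly on a strand where one side has lost the box that would have checked its
  type.\<close>

lemma lift_eq:
  assumes "dok L w" "dok L' w" "wout L w = wout L' w" "darr L w = darr L' w"
  shows "run_from n L (gds n w st) = run_from n L' (gds n w st)"
  using fold_box assms by simp

text \<open>A guard is moved towards the input until it meets the box that created the guarded
  letter, or the initial word; there it holds automatically and disappears.\<close>

lemma gin: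
  "j < n \<Longrightarrow> gd j X (sl n \<beta> st) = sl n \<beta> (gd j X st)"
  "n + length (bcod \<beta>) \<le> j \<Longrightarrow>
    gd j X (sl n \<beta> st) = sl n \<beta> (gd (j - length (bcod \<beta>) + length (bdom \<beta>)) X st)"
  "n \<le> j \<Longrightarrow> j < n + length (bcod \<beta>) \<Longrightarrow> bcod \<beta> ! (j - n) = X \<Longrightarrow> gd j X (sl n \<beta> st) = sl n \<beta> st"
  "set w \<subseteq> objs C \<Longrightarrow> j < length w \<Longrightarrow> w ! j = X \<Longrightarrow> gd j X (start w) = start w"
proof -
  have eq: "sl n \<beta> st = Some (u @ bcod \<beta> @ v, (ident C (ten u) \<boxtimes> barr \<beta> \<boxtimes> ident C (ten v)) \<cdot> h) \<and>
    sok (u @ bcod \<beta> @ v) ((ident C (ten u) \<boxtimes> barr \<beta> \<boxtimes> ident C (ten v)) \<cdot> h)"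
    if "st = Some (u @ bdom \<beta> @ v, h)" "length u = n" "wfb \<beta>" "sok (u @ bdom \<beta> @ v) h" for u v h
    using sl_app[OF that(3,4)] that by simp
  have gd2: "gd j X st = None \<or> gd j X st = st" for j X and st :: "('o list \<times> 'a) option"
    by (auto simp: gd_def split: option.splits)
  have None: "gd j X (sl n \<beta> st) = sl n \<beta> (gd j' X st)" if "sl n \<beta> st = None" for j j' :: nat and X
    using that gd2[of j' X st] by auto
  show "gd j X (sl n \<beta> st) = sl n \<beta> (gd j X st)" if "j < n"
  proof (cases "sl n \<beta> st = None")
    case False
    from sl_cases[OF this] obtain u v h where *: "st = Some (u @ bdom \<beta> @ v, h)" "length u = n" "wfb \<beta>"
      "sok (u @ bdom \<beta> @ v) h" by metis
    show ?thesis using eq[OF *] * that by (auto simp: gd_def nth_append)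
  qed (rule None)
  show "gd j X (sl n \<beta> st) = sl n \<beta> (gd (j - length (bcod \<beta>) + length (bdom \<beta>)) X st)"
    if nj: "n + length (bcod \<beta>) \<le> j"
  proof (cases "sl n \<beta> st = None")
    case False
    from sl_cases[OF this] obtain u v h where *: "st = Some (u @ bdom \<beta> @ v, h)" "length u = n" "wfb \<beta>"
      "sok (u @ bdom \<beta> @ v) h" by metis
    let ?j = "j - length (bcod \<beta>) + length (bdom \<beta>)"
    obtain i where "j = n + length (bcod \<beta>) + i" using le_Suc_ex[OF nj] by blast
    then have j: "j = length (u @ bcod \<beta>) + i" "?j = length (u @ bdom \<beta>) + i" using *(2) by simp_all
    have "(u @ bdom \<beta> @ v) ! ?j = v ! i" "(u @ bcod \<beta> @ v) ! j = v ! i"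
      using nth_append_length_plus[of "u @ bdom \<beta>" v i] nth_append_length_plus[of "u @ bcod \<beta>" v i]
      unfolding append_assoc j(2) unfolding append_assoc j(1) by simp_all
    moreover have "?j < length (u @ bdom \<beta> @ v) \<longleftrightarrow> i < length v" "j < length (u @ bcod \<beta> @ v) \<longleftrightarrow> i < length v"
      unfolding j(2) unfolding j(1) by simp_all
    ultimately have "gd ?j X st = (if i < length v \<and> v ! i = X then st else None)"
      "gd j X (sl n \<beta> st) = (if i < length v \<and> v ! i = X then sl n \<beta> st else None)"
      using eq[OF *] *(1,4) by (simp_all only: gd_def option.case prod.case) auto
    then show ?thesis by simp
  qed (rule None)
  show "gd j X (sl n \<beta> st) = sl n \<beta> st" if "n \<le> j" "j < n + length (bcod \<beta>)" "bcod \<beta> ! (j - n) = X"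
  proof (cases "sl n \<beta> st = None")
    case False
    from sl_cases[OF this] obtain u v h where *: "st = Some (u @ bdom \<beta> @ v, h)" "length u = n" "wfb \<beta>"
      "sok (u @ bdom \<beta> @ v) h" by metis
    show ?thesis using eq[OF *] * that by (auto simp: gd_def nth_append)
  qed simp
  show "gd j X (start w) = start w" if "set w \<subseteq> objs C" "j < length w" "w ! j = X"
    using that by (auto simp: gd_def start_def sok_def)
qed

text \<open>The opposite direction, used when rules are derived: a guard travels towards the output
  and vanishes at the box that consumes the letter, because that box performs the same test. It must
  not be combined with \<open>gin\<close>, whose first two rules it inverts.\<close>

lemma gout:
  "j < n \<Longrightarrow> sl n \<beta> (gd j X st) = gd j X (sl n \<beta> st)"
  "n + length (bdom \<beta>) \<le> j \<Longrightarrow>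
    sl n \<beta> (gd j X st) = gd (j - length (bdom \<beta>) + length (bcod \<beta>)) X (sl n \<beta> st)"
  "n \<le> j \<Longrightarrow> j < n + length (bdom \<beta>) \<Longrightarrow> bdom \<beta> ! (j - n) = X \<Longrightarrow> sl n \<beta> (gd j X st) = sl n \<beta> st"
proof -
  show "j < n \<Longrightarrow> sl n \<beta> (gd j X st) = gd j X (sl n \<beta> st)" by (simp add: gin)
  show "n + length (bdom \<beta>) \<le> j \<Longrightarrow>
    sl n \<beta> (gd j X st) = gd (j - length (bdom \<beta>) + length (bcod \<beta>)) X (sl n \<beta> st)"
    using gin(2)[of n \<beta> "j - length (bdom \<beta>) + length (bcod \<beta>)" X st] by simp
  show "sl n \<beta> (gd j X st) = sl n \<beta> st" if "n \<le> j" "j < n + length (bdom \<beta>)" "bdom \<beta> ! (j - n) = X"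
  proof (cases "sl n \<beta> st = None")
    case False
    from sl_cases[OF this] obtain u v h where *: "st = Some (u @ bdom \<beta> @ v, h)" "length u = n" "wfb \<beta>"
      "sok (u @ bdom \<beta> @ v) h" by metis
    have "gd j X st = st" using * that by (auto simp: gd_def nth_append)
    then show ?thesis by simp
  next
    case True
    have "gd j X st = None \<or> gd j X st = st" by (auto simp: gd_def split: option.splits)
    then show ?thesis using True by auto
  qed
qed

end

section \<open>Algebras and the monoidal category \<open>\<T>\<^sub>A\<^sup>#\<close>\<close>

context diagrams
begin

lemma wfb_simp [simp]:
  "wfb (Box f s t) \<longleftrightarrow> set s \<subseteq> objs C \<and> set t \<subseteq> objs C \<and>
     f \<in> arrs C \<and> source C f = ten s \<and> target C f = ten t"
  by (simp add: wfb_def hom_def)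

text \<open>Together with \<open>exchange_early\<close> this orders independent boxes: those with
  inputs are applied before those without, and otherwise the leftmost goes first. Postponing units
  and cups brings them next to the multiplications and caps that cancel them. The conditions on the
  input words keep the two rules from undoing each other.\<close>

lemma exchange_late:
  assumes "bdom \<beta> = []" "bdom \<gamma> \<noteq> []" "n + length (bcod \<beta>) \<le> k"
  shows "sl k \<gamma> (sl n \<beta> st) = sl n \<beta> (sl (k - length (bcod \<beta>)) \<gamma> st)"
  using exchange[of n \<beta> "k - length (bcod \<beta>)" \<gamma> st] assms by simp

lemma exchange_early:
  assumes "bdom \<gamma> \<noteq> [] \<or> bdom \<beta> = []" "k + length (bdom \<gamma>) \<le> n"
  shows "sl k \<gamma> (sl n \<beta> st) = sl (n - length (bdom \<gamma>) + length (bcod \<gamma>)) \<beta> (sl k \<gamma> st)"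
  using assms(2) by (rule exchange)

lemmas nf = exchange_early exchange_late gin

text \<open>The rules are stated for positions \<open>n\<close>, \<open>Suc n\<close> and so on;
  numerals have to be unfolded for them to match.\<close>

lemmas [simp] = eval_nat_numeral

end

section \<open>Diagrams with an algebra \<open>A\<close>\<close>

locale strict_algebra = diagrams C for C :: "('o, 'a) moncat" (structure) +
  fixes A :: 'o and m \<eta> :: 'a
  assumes alg: "algebra C A m \<eta>"
begin

abbreviation "M \<equiv> Box m [A, A] [A]"
abbreviation "E \<equiv> Box \<eta> [] [A]"

lemma alg_facts [simp]:
  "A \<in> objs C" "m \<in> arrs C" "source C m = A \<otimes> A" "target C m = A"
  "\<eta> \<in> arrs C" "source C \<eta> = \<one>" "target C \<eta> = A"
  using alg homD[of m] homD[of \<eta>] unfolding algebra_def by auto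

lemma alg_eqs:
  "m \<cdot> (m \<triangleright> A) = m \<cdot> (A \<triangleleft> m)" "m \<cdot> (\<eta> \<triangleright> A) = ident C A" "m \<cdot> (A \<triangleleft> \<eta>) = ident C A"
  using alg unfolding algebra_def
  by (simp_all add: strict_associator strict_left_unitor strict_right_unitor)

lemma M_assoc: "sl n M (sl (Suc n) M st) = sl n M (sl n M st)"
  using lift_eq[of "[(0, M), (1, M)]" "[A, A, A]" "[(0, M), (0, M)]" n st]
  by (simp add: alg_eqs gout)

lemma M_E: "sl n M (sl n E st) = gd n A st" "sl n M (sl (Suc n) E st) = gd n A st"
  using lift_eq[of "[(0, M), (0, E)]" "[A]" "[]" n st] lift_eq[of "[(0, M), (1, E)]" "[A]" "[]" n st]
  by (simp_all add: alg_eqs gout)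

lemmas anf = nf M_assoc M_E

text \<open>With products nested to the left, the two multiplications of a law that has been multiplied by
  \<open>A\<close> on the left need not be adjacent any more, so such laws need a second form.\<close>

lemma M_under:
  assumes "sl (Suc n) M (sl (Suc (Suc n)) \<beta> st) = st'"
  shows "sl n M (sl (Suc n) \<beta> (sl n M st)) = sl n M st'"
  using assms M_assoc[of n] exchange[of n M "Suc (Suc n)" \<beta> st] by force

lemma M_under2:
  assumes "sl (Suc n) M (sl (Suc (Suc n)) \<beta> (sl (Suc (Suc (Suc n))) \<gamma> st)) = st'"
  shows "sl n M (sl (Suc n) \<beta> (sl (Suc (Suc n)) \<gamma> (sl n M st))) = sl n M st'"
  using M_under[OF assms] exchange[of n M "Suc (Suc (Suc n))" \<gamma> st] by simp

section \<open>Objects and arrows of \<open>T_sharp\<close> as rewriting rules\<close>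

abbreviation "Tob X \<psi> \<equiv> T_sharp_ob C A m \<eta> (X, \<psi>)"

lemma TobD:
  assumes "Tob X \<psi>"
  shows "X \<in> objs C" "\<psi> \<in> arrs C" "source C \<psi> = X \<otimes> A" "target C \<psi> = A \<otimes> X"
    "sl n (Box \<psi> [X, A] [A, X]) (sl (Suc n) M st) =
      sl n M (sl (Suc n) (Box \<psi> [X, A] [A, X]) (sl n (Box \<psi> [X, A] [A, X]) st))"
    "sl n (Box \<psi> [X, A] [A, X]) (sl (Suc n) E st) = gd (Suc n) X (sl n E st)"
proof -
  have X: "X \<in> objs C" and h: "\<psi> \<in> hom C (X \<otimes> A) (A \<otimes> X)"
    and eqs: "\<psi> \<cdot> (X \<triangleleft> m) = (m \<triangleright> X) \<cdot> (A \<triangleleft> \<psi>) \<cdot> (\<psi> \<triangleright> A)" "\<psi> \<cdot> (X \<triangleleft> \<eta>) = \<eta> \<triangleright> X"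
    using assms unfolding T_sharp_ob_def by auto
  note [simp] = X homD[OF h]
  show "X \<in> objs C" "\<psi> \<in> arrs C" "source C \<psi> = X \<otimes> A" "target C \<psi> = A \<otimes> X" by simp_all
  let ?P = "Box \<psi> [X, A] [A, X]"
  show "sl n ?P (sl (Suc n) M st) = sl n M (sl (Suc n) ?P (sl n ?P st))"
    using lift_eq[of "[(0, ?P), (1, M)]" "[X, A, A]" "[(0, M), (1, ?P), (0, ?P)]" n st]
    by (simp add: eqs gout)
  show "sl n ?P (sl (Suc n) E st) = gd (Suc n) X (sl n E st)"
    using lift_eq[of "[(0, ?P), (1, E)]" "[X]" "[(0, E)]" n st]
    by (simp add: eqs gout)
qed

definition Tarr :: "'o \<times> 'a \<Rightarrow> 'o \<times> 'a \<Rightarrow> 'a \<Rightarrow> bool" where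
  "Tarr P Q f \<longleftrightarrow> T_sharp_ob C A m \<eta> P \<and> T_sharp_ob C A m \<eta> Q \<and> f \<in> hom C (fst P) (A \<otimes> fst Q) \<and>
    (m \<triangleright> fst Q) \<cdot> (A \<triangleleft> f) \<cdot> snd P = (m \<triangleright> fst Q) \<cdot> (A \<triangleleft> snd Q) \<cdot> (f \<triangleright> A)"

lemma TarrD:
  assumes "Tarr (X, \<psi>) (Y, \<chi>) f"
  shows "Tob X \<psi>" "Tob Y \<chi>" "f \<in> arrs C" "source C f = X" "target C f = A \<otimes> Y"
    "sl n M (sl (Suc n) (Box f [X] [A, Y]) (sl n (Box \<psi> [X, A] [A, X]) st)) =
      sl n M (sl (Suc n) (Box \<chi> [Y, A] [A, Y]) (sl n (Box f [X] [A, Y]) st))"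
    "sl n M (sl (Suc n) (Box f [X] [A, Y]) (sl n M (sl (Suc n) (Box \<psi> [X, A] [A, X]) st))) =
      sl n M (sl (Suc n) (Box \<chi> [Y, A] [A, Y]) (sl n M (sl (Suc n) (Box f [X] [A, Y]) st)))" (is ?M)
proof -
  show 1: "Tob X \<psi>" "Tob Y \<chi>" and h: "f \<in> arrs C" "source C f = X" "target C f = A \<otimes> Y"
    using assms homD[of f X] unfolding Tarr_def by auto
  have eq: "(m \<triangleright> Y) \<cdot> (A \<triangleleft> f) \<cdot> \<psi> = (m \<triangleright> Y) \<cdot> (A \<triangleleft> \<chi>) \<cdot> (f \<triangleright> A)"
    using assms unfolding Tarr_def by simp
  note [simp] = TobD[OF 1(1)] TobD[OF 1(2)] h
  let ?F = "Box f [X] [A, Y]" and ?P = "Box \<psi> [X, A] [A, X]" and ?Q = "Box \<chi> [Y, A] [A, Y]"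
  show *: "sl n M (sl (Suc n) ?F (sl n ?P st)) = sl n M (sl (Suc n) ?Q (sl n ?F st))" for n st
    using lift_eq[of "[(0, M), (1, ?F), (0, ?P)]" "[X, A]" "[(0, M), (1, ?Q), (0, ?F)]" n st] eq
    by (simp add: gout)
  show ?M using *[THEN M_under] by (simp add: anf)
qed

text \<open>Pushing a multiplication through \<open>\<psi>\<close> duplicates \<open>\<psi>\<close>
  and separates the boxes in the law of the arrow \<open>g\<close>. This is that law in the form
  which then appears in normalized diagrams.\<close>

lemma Tarr_under:
  assumes "Tob X \<psi>" "Tarr (Y, \<chi>) (Y', \<chi>') g"
  defines "P \<equiv> Box \<psi> [X, A] [A, X]" and "G \<equiv> Box g [Y] [A, Y']"
  shows "sl n M (sl (Suc n) P (sl (Suc (Suc n)) G (sl n M (sl (Suc n) P (sl (Suc (Suc n)) (Box \<chi> [Y, A] [A, Y]) st))))) =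
      sl n M (sl (Suc n) P (sl (Suc (Suc n)) (Box \<chi>' [Y', A] [A, Y']) (sl n M (sl (Suc n) P (sl (Suc (Suc n)) G st)))))"
proof -
  have "sl (Suc n) P (sl (Suc (Suc n)) M (sl (Suc (Suc (Suc n))) G (sl (Suc (Suc n)) (Box \<chi> [Y, A] [A, Y]) st))) =
      sl (Suc n) P (sl (Suc (Suc n)) M (sl (Suc (Suc (Suc n))) (Box \<chi>' [Y', A] [A, Y']) (sl (Suc (Suc n)) G st)))"
    unfolding G_def by (simp only: TarrD(6)[OF assms(2)])
  from arg_cong[OF this, of "sl n M"] show ?thesis
    using TobD[OF assms(1), folded P_def] by (simp add: anf P_def G_def)
qed

lemma TarrI:
  assumes "Tob X \<psi>" "Tob Y \<chi>" "f \<in> hom C X (A \<otimes> Y)"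
    "(m \<triangleright> Y) \<cdot> (A \<triangleleft> f) \<cdot> \<psi> = (m \<triangleright> Y) \<cdot> (A \<triangleleft> \<chi>) \<cdot> (f \<triangleright> A)"
  shows "Tarr (X, \<psi>) (Y, \<chi>) f"
  using assms by (simp add: Tarr_def)

lemma T_simps:
  "objs (T_sharp C A m \<eta>) = {P. T_sharp_ob C A m \<eta> P}"
  "source (T_sharp C A m \<eta>) (P, f, Q) = P"
  "target (T_sharp C A m \<eta>) (P, f, Q) = Q"
  "ident (T_sharp C A m \<eta>) P = (P, \<eta> \<triangleright> fst P, P)"
  "(Q', g, (Z, \<omega>)) \<cdot>\<^bsub>T_sharp C A m \<eta>\<^esub> (P, f, Q) = (P, (m \<triangleright> Z) \<cdot> (A \<triangleleft> g) \<cdot> f, (Z, \<omega>))"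
  "\<one>\<^bsub>T_sharp C A m \<eta>\<^esub> = (\<one>, ident C A)"
  "(X, \<psi>) \<otimes>\<^bsub>T_sharp C A m \<eta>\<^esub> (Y, \<chi>) = (X \<otimes> Y, (\<psi> \<triangleright> Y) \<cdot> (X \<triangleleft> \<chi>))"
  "(P, f, (X', \<psi>')) \<boxtimes>\<^bsub>T_sharp C A m \<eta>\<^esub> (Q, g, (Y', \<chi>')) =
     (T_sharp_tensor C P Q, (m \<triangleright> X' \<otimes> Y') \<cdot> (A \<triangleleft> \<psi>' \<triangleright> Y') \<cdot> (f \<boxtimes> g),
      T_sharp_tensor C (X', \<psi>') (Y', \<chi>'))"
  by (simp_all add: T_sharp_def T_sharp_id_def T_sharp_tensor_def)

lemma T_arrs: "(P, f, Q) \<in> arrs (T_sharp C A m \<eta>) \<longleftrightarrow> Tarr P Q f"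
  by (cases P; cases Q) (auto simp: T_sharp_def Tarr_def)

lemma T_hom: "F \<in> hom (T_sharp C A m \<eta>) P Q \<longleftrightarrow> (\<exists>f. F = (P, f, Q) \<and> Tarr P Q f)"
  by (cases F) (auto simp: hom_def T_simps T_arrs)

lemma Tarr_cmp:
  assumes "Tarr (X, \<psi>) (Y, \<chi>) f" "Tarr (Y, \<chi>) (Z, \<omega>) g"
  shows "Tarr (X, \<psi>) (Z, \<omega>) ((m \<triangleright> Z) \<cdot> (A \<triangleleft> g) \<cdot> f)"
proof -
  note T = TarrD[OF assms(1)] TarrD[OF assms(2)]
  note [simp] = T(3-5,10-12) TobD[OF T(1)] TobD[OF T(2)] TobD[OF T(9)]
  let ?F = "Box f [X] [A, Y]" and ?G = "Box g [Y] [A, Z]" and ?P = "Box \<psi> [X, A] [A, X]" and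
    ?R = "Box \<omega> [Z, A] [A, Z]"
  have "run [(0, M), (1, M), (2, ?G), (1, ?F), (0, ?P)] (start [X, A]) =
     run [(0, M), (1, ?R), (0, M), (1, ?G), (0, ?F)] (start [X, A])"
    by (simp add: anf T)
  from diagram_eq[OF this] show ?thesis
    by (intro TarrI homI T) (simp_all)
qed

lemma Tarr_ident:
  assumes "Tob X \<psi>" shows "Tarr (X, \<psi>) (X, \<psi>) (\<eta> \<triangleright> X)"
proof -
  note [simp] = TobD[OF assms]
  let ?P = "Box \<psi> [X, A] [A, X]"
  have "run [(0, M), (1, E), (0, ?P)] (start [X, A]) = run [(0, M), (1, ?P), (0, E)] (start [X, A])"
    by (simp add: anf)
  from diagram_eq[OF this] show ?thesis
    by (intro TarrI homI assms) (simp_all)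
qed

lemma Tob_unit: "Tob \<one> (ident C A)"
  by (simp add: T_sharp_ob_def hom_def)

lemma Tob_tensor:
  assumes "Tob X \<psi>" "Tob Y \<chi>"
  shows "Tob (X \<otimes> Y) ((\<psi> \<triangleright> Y) \<cdot> (X \<triangleleft> \<chi>))"
proof -
  note [simp] = TobD[OF assms(1)] TobD[OF assms(2)]
  let ?P = "Box \<psi> [X, A] [A, X]" and ?Q = "Box \<chi> [Y, A] [A, Y]"
  have 1: "run [(0, ?P), (1, ?Q), (2, M)] (start [X, Y, A, A]) =
      run [(0, M), (1, ?P), (2, ?Q), (0, ?P), (1, ?Q)] (start [X, Y, A, A])"
    by (simp add: anf)
  have 2: "run [(0, ?P), (1, ?Q), (2, E)] (start [X, Y]) = run [(0, E)] (start [X, Y])"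
    by (simp add: anf)
  from diagram_eq[OF 1] diagram_eq[OF 2] show ?thesis
    by (auto simp: T_sharp_ob_def intro!: homI)
qed

lemma Tarr_tensor:
  assumes "Tarr (X, \<psi>) (X', \<psi>') f" "Tarr (Y, \<chi>) (Y', \<chi>') g"
  shows "Tarr (X \<otimes> Y, (\<psi> \<triangleright> Y) \<cdot> (X \<triangleleft> \<chi>)) (X' \<otimes> Y', (\<psi>' \<triangleright> Y') \<cdot> (X' \<triangleleft> \<chi>'))
    ((m \<triangleright> X' \<otimes> Y') \<cdot> (A \<triangleleft> \<psi>' \<triangleright> Y') \<cdot> (f \<boxtimes> g))"
proof -
  note T = TarrD[OF assms(1)] TarrD[OF assms(2)]
  note [simp] = T(3-5,10-12) TobD[OF T(1)] TobD[OF T(2)] TobD[OF T(8)] TobD[OF T(9)]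
  have fg: "f \<boxtimes> g = (f \<triangleright> A \<otimes> Y') \<cdot> (X \<triangleleft> g)"
    by (rule tensor_split) (simp_all add: hom_def)
  let ?F = "Box f [X] [A, X']" and ?G = "Box g [Y] [A, Y']" and ?P = "Box \<psi> [X, A] [A, X]" and
    ?P' = "Box \<psi>' [X', A] [A, X']" and ?Q = "Box \<chi> [Y, A] [A, Y]" and ?Q' = "Box \<chi>' [Y', A] [A, Y']"
  have "run [(0, M), (1, M), (2, ?P'), (1, ?F), (2, ?G), (0, ?P), (1, ?Q)] (start [X, Y, A]) =
     run [(0, M), (1, ?P'), (2, ?Q'), (0, M), (1, ?P'), (0, ?F), (1, ?G)] (start [X, Y, A])"
    by (simp add: anf T Tarr_under[OF T(2) assms(2)])
  from diagram_eq[OF this] show ?thesis unfolding fg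
    by (intro TarrI homI T Tob_tensor) (simp_all)
qed

lemma Tarr_hom:
  assumes "Tarr (X, \<psi>) (Y, \<chi>) f" shows "f \<in> hom C X (A \<otimes> Y)"
  using TarrD[OF assms] by (simp add: hom_def)

lemma Tarr_obj:
  assumes "Tarr (X, \<psi>) (Y, \<chi>) f" shows "X \<in> objs C \<and> Y \<in> objs C"
  using TarrD(1,2)[OF assms] TobD(1) by blast

lemma tensor_cmp_T:
  assumes "Tarr (X, \<psi>) (X', \<psi>') f" "Tarr (X', \<psi>') (X'', \<psi>'') f'"
    "Tarr (Y, \<chi>) (Y', \<chi>') g" "Tarr (Y', \<chi>') (Y'', \<chi>'') g'"
  shows "(m \<triangleright> X'' \<otimes> Y'') \<cdot> (A \<triangleleft> \<psi>'' \<triangleright> Y'') \<cdot>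
      (((m \<triangleright> X'') \<cdot> (A \<triangleleft> f') \<cdot> f) \<boxtimes> ((m \<triangleright> Y'') \<cdot> (A \<triangleleft> g') \<cdot> g)) =
    (m \<triangleright> X'' \<otimes> Y'') \<cdot> (A \<triangleleft> ((m \<triangleright> X'' \<otimes> Y'') \<cdot> (A \<triangleleft> \<psi>'' \<triangleright> Y'') \<cdot> (f' \<boxtimes> g'))) \<cdot>
      ((m \<triangleright> X' \<otimes> Y') \<cdot> (A \<triangleleft> \<psi>' \<triangleright> Y') \<cdot> (f \<boxtimes> g))"
proof -
  note T = TarrD[OF assms(1)] TarrD[OF assms(2)] TarrD[OF assms(3)] TarrD[OF assms(4)]
  note O = TobD[OF T(1)] TobD[OF T(2)] TobD[OF T(9)] TobD[OF T(15)] TobD[OF T(16)] TobD[OF T(23)]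
  note [simp] = T(3-5,10-12,17-19,24-26) O
  let ?F = "Box f [X] [A, X']" and ?G = "Box g [Y] [A, Y']" and ?F' = "Box f' [X'] [A, X'']" and
    ?G' = "Box g' [Y'] [A, Y'']" and
    ?P' = "Box \<psi>' [X', A] [A, X']" and ?P'' = "Box \<psi>'' [X'', A] [A, X'']"
  note s1 = tensor_split[OF Tarr_hom[OF Tarr_cmp[OF assms(1,2)]] Tarr_hom[OF Tarr_cmp[OF assms(3,4)]]]
  note s2 = tensor_split[OF Tarr_hom[OF assms(1)] Tarr_hom[OF assms(3)]]
  note s3 = tensor_split[OF Tarr_hom[OF assms(2)] Tarr_hom[OF assms(4)]]
  have "run [(0, M), (1, ?P''), (0, M), (1, ?F'), (0, ?F), (1, M), (2, ?G'), (1, ?G)] (start [X, Y]) =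
    run [(0, M), (1, M), (2, ?P''), (1, ?F'), (2, ?G'), (0, M), (1, ?P'), (0, ?F), (1, ?G)] (start [X, Y])"
    by (simp add: anf T)
  from diagram_eq[OF this] show ?thesis unfolding s1 s2 s3
    by simp
qed

lemma tensor_assoc_T:
  assumes "Tarr (X, \<psi>) (X', \<psi>') f" "Tarr (Y, \<chi>) (Y', \<chi>') g" "Tarr (Z, \<omega>) (Z', \<omega>') h"
  shows "(m \<triangleright> (X' \<otimes> Y') \<otimes> Z') \<cdot> (A \<triangleleft> ((\<psi>' \<triangleright> Y') \<cdot> (X' \<triangleleft> \<chi>')) \<triangleright> Z') \<cdot>
      (((m \<triangleright> X' \<otimes> Y') \<cdot> (A \<triangleleft> \<psi>' \<triangleright> Y') \<cdot> (f \<boxtimes> g)) \<boxtimes> h) =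
    (m \<triangleright> X' \<otimes> Y' \<otimes> Z') \<cdot> (A \<triangleleft> \<psi>' \<triangleright> Y' \<otimes> Z') \<cdot>
      (f \<boxtimes> ((m \<triangleright> Y' \<otimes> Z') \<cdot> (A \<triangleleft> \<chi>' \<triangleright> Z') \<cdot> (g \<boxtimes> h)))"
proof -
  note T = TarrD[OF assms(1)] TarrD[OF assms(2)] TarrD[OF assms(3)]
  note O = TobD[OF T(1)] TobD[OF T(2)] TobD[OF T(8)] TobD[OF T(9)] TobD[OF T(15)] TobD[OF T(16)]
  note [simp] = T(3-5,10-12,17-19) O
  let ?F = "Box f [X] [A, X']" and ?G = "Box g [Y] [A, Y']" and ?H = "Box h [Z] [A, Z']" and
    ?P' = "Box \<psi>' [X', A] [A, X']" and ?Q' = "Box \<chi>' [Y', A] [A, Y']"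
  note s1 = tensor_split[OF Tarr_hom[OF Tarr_tensor[OF assms(1,2)]] Tarr_hom[OF assms(3)]]
  note s2 = tensor_split[OF Tarr_hom[OF assms(1)] Tarr_hom[OF Tarr_tensor[OF assms(2,3)]]]
  note s3 = tensor_split[OF Tarr_hom[OF assms(1)] Tarr_hom[OF assms(2)]]
  note s4 = tensor_split[OF Tarr_hom[OF assms(2)] Tarr_hom[OF assms(3)]]
  have "run [(0, M), (1, ?P'), (2, ?Q'), (0, M), (1, ?P'), (0, ?F), (1, ?G), (2, ?H)] (start [X, Y, Z]) =
    run [(0, M), (1, ?P'), (0, ?F), (1, M), (2, ?Q'), (1, ?G), (2, ?H)] (start [X, Y, Z])"
    by (simp add: anf T)
  from diagram_eq[OF this] show ?thesis unfolding s1 s2 unfolding s3 s4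
    by simp
qed

lemma T_cmp_ident:
  assumes "Tarr (X, \<psi>) (Y, \<chi>) f"
  shows "(m \<triangleright> Y) \<cdot> (A \<triangleleft> (\<eta> \<triangleright> Y)) \<cdot> f = f" "(m \<triangleright> Y) \<cdot> (A \<triangleleft> f) \<cdot> (\<eta> \<triangleright> X) = f"
proof -
  note T = TarrD[OF assms]
  note [simp] = T(3-5) TobD[OF T(1)] TobD[OF T(2)]
  let ?F = "Box f [X] [A, Y]"
  have 1: "run [(0, M), (1, E), (0, ?F)] (start [X]) = run [(0, ?F)] (start [X])" by (simp add: anf)
  have 2: "run [(0, M), (1, ?F), (0, E)] (start [X]) = run [(0, ?F)] (start [X])" by (simp add: anf)
  from diagram_eq[OF 1] diagram_eq[OF 2]
  show "(m \<triangleright> Y) \<cdot> (A \<triangleleft> (\<eta> \<triangleright> Y)) \<cdot> f = f" "(m \<triangleright> Y) \<cdot> (A \<triangleleft> f) \<cdot> (\<eta> \<triangleright> X) = f"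
    by simp_all
qed

lemma T_cmp_assoc:
  assumes "f \<in> hom C X (A \<otimes> Y)" "g \<in> hom C Y (A \<otimes> Z)" "h \<in> hom C Z (A \<otimes> W)"
    "X \<in> objs C" "Y \<in> objs C" "Z \<in> objs C" "W \<in> objs C"
  shows "(m \<triangleright> W) \<cdot> (A \<triangleleft> ((m \<triangleright> W) \<cdot> (A \<triangleleft> h) \<cdot> g)) \<cdot> f =
    (m \<triangleright> W) \<cdot> (A \<triangleleft> h) \<cdot> ((m \<triangleright> Z) \<cdot> (A \<triangleleft> g) \<cdot> f)"
proof -
  note [simp] = assms(4-7) homD(1-3)[OF assms(1)] homD(1-3)[OF assms(2)] homD(1-3)[OF assms(3)]
  let ?F = "Box f [X] [A, Y]" and ?G = "Box g [Y] [A, Z]" and ?H = "Box h [Z] [A, W]"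
  have "run [(0, M), (1, M), (2, ?H), (1, ?G), (0, ?F)] (start [X]) =
    run [(0, M), (1, ?H), (0, M), (1, ?G), (0, ?F)] (start [X])" by (simp add: anf)
  from diagram_eq[OF this] show ?thesis by simp
qed

lemma T_tensor_unit:
  assumes "Tarr (X, \<psi>) (Y, \<chi>) f"
  shows "(m \<triangleright> Y) \<cdot> (A \<triangleleft> \<chi>) \<cdot> (f \<boxtimes> (\<eta> \<triangleright> \<one>)) = f" "(m \<triangleright> Y) \<cdot> ((\<eta> \<triangleright> \<one>) \<boxtimes> f) = f"
proof -
  note T = TarrD[OF assms]
  note [simp] = T(3-5) TobD[OF T(1)] TobD[OF T(2)]
  let ?F = "Box f [X] [A, Y]" and ?Q = "Box \<chi> [Y, A] [A, Y]"
  have s: "f \<boxtimes> \<eta> = (f \<triangleright> A) \<cdot> (X \<triangleleft> \<eta>)" "\<eta> \<boxtimes> f = (\<eta> \<triangleright> A \<otimes> Y) \<cdot> f"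
    using tensor_split[of f X "A \<otimes> Y" \<eta> \<one> A] tensor_split[of \<eta> \<one> A f X "A \<otimes> Y"] by (simp_all add: hom_def)
  have 1: "run [(0, M), (1, ?Q), (0, ?F), (1, E)] (start [X]) = run [(0, ?F)] (start [X])" by (simp add: anf)
  have 2: "run [(0, M), (0, E), (0, ?F)] (start [X]) = run [(0, ?F)] (start [X])" by (simp add: anf)
  from diagram_eq[OF 1] diagram_eq[OF 2]
  show "(m \<triangleright> Y) \<cdot> (A \<triangleleft> \<chi>) \<cdot> (f \<boxtimes> (\<eta> \<triangleright> \<one>)) = f" "(m \<triangleright> Y) \<cdot> ((\<eta> \<triangleright> \<one>) \<boxtimes> f) = f"
    by (simp_all add: s)
qed

lemma T_tensor_ident:
  assumes "Tob X \<psi>" "Tob Y \<chi>"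
  shows "(m \<triangleright> X \<otimes> Y) \<cdot> (A \<triangleleft> \<psi> \<triangleright> Y) \<cdot> ((\<eta> \<triangleright> X) \<boxtimes> (\<eta> \<triangleright> Y)) = \<eta> \<triangleright> X \<otimes> Y"
proof -
  note [simp] = TobD[OF assms(1)] TobD[OF assms(2)]
  let ?P = "Box \<psi> [X, A] [A, X]"
  have s: "(\<eta> \<triangleright> X) \<boxtimes> (\<eta> \<triangleright> Y) = (\<eta> \<triangleright> X \<otimes> A \<otimes> Y) \<cdot> (X \<triangleleft> \<eta> \<triangleright> Y)"
    using tensor_split[of "\<eta> \<triangleright> X" X "A \<otimes> X" "\<eta> \<triangleright> Y" Y "A \<otimes> Y"] by (simp add: hom_def)
  have 1: "run [(0, M), (1, ?P), (0, E), (1, E)] (start [X, Y]) = run [(0, E)] (start [X, Y])" by (simp add: anf)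
  from diagram_eq[OF 1] show ?thesis unfolding s by simp
qed

lemma T_sharp_ident_inverse:
  assumes "Tob X \<psi>"
  shows "is_inverse (T_sharp C A m \<eta>) ((X, \<psi>), \<eta> \<triangleright> X, (X, \<psi>)) ((X, \<psi>), \<eta> \<triangleright> X, (X, \<psi>))"
  using T_cmp_ident[OF Tarr_ident[OF assms]] Tarr_ident[OF assms]
  by (auto simp: is_inverse_def T_simps T_arrs T_hom)

text \<open>It makes the locale \<open>diagrams\<close> available inside \<open>T_sharp\<close>
  itself. Facts about coalgebras can then be proved once in an arbitrary strict monoidal category
  and be applied to the cowreath, which is a coalgebra there.\<close>

lemma T_sharp_strict_monoidal: "strict_monoidal_category (T_sharp C A m \<eta>)"
proof -
  let ?T = "T_sharp C A m \<eta>"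
  have T_more: "associator ?T = (\<lambda>P Q R. T_sharp_id C \<eta> (T_sharp_tensor C P (T_sharp_tensor C Q R)))"
    "left_unitor ?T = T_sharp_id C \<eta>" "right_unitor ?T = T_sharp_id C \<eta>" "ident ?T = T_sharp_id C \<eta>"
    "tensor_ob ?T = T_sharp_tensor C"
    by (simp_all add: T_sharp_def)
  note S = T_simps T_more T_sharp_id_def T_sharp_tensor_def split_paired_all T_hom T_arrs
  have tassoc: "T_sharp_tensor C (T_sharp_tensor C P Q) R = T_sharp_tensor C P (T_sharp_tensor C Q R)"
    if "P \<in> objs ?T" "Q \<in> objs ?T" "R \<in> objs ?T" for P Q R
  proof -
    obtain X \<psi> Y \<chi> Z \<omega> where [simp]: "P = (X, \<psi>)" "Q = (Y, \<chi>)" "R = (Z, \<omega>)" by (cases P; cases Q; cases R)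
    have "Tob X \<psi>" "Tob Y \<chi>" "Tob Z \<omega>" using that by (simp_all add: T_simps)
    note [simp] = TobD(1-4)[OF this(1)] TobD(1-4)[OF this(2)] TobD(1-4)[OF this(3)]
    show ?thesis by (simp add: T_sharp_tensor_def)
  qed
  interpret T: category ?T
  proof (unfold_locales, goal_cases)
    case (1 f) then show ?case by (cases f) (auto simp: S dest: TarrD(1,2))
  next
    case (2 f) then show ?case by (cases f) (auto simp: S dest: TarrD(1,2))
  next
    case (3 X) then show ?case by (cases X) (auto simp: S intro: Tarr_ident)
  next
    case (4 f X Y g Z) then show ?case by (cases X; cases Y; cases Z) (auto simp: S intro: Tarr_cmp)
  next
    case (5 f X Y g Z h W) then show ?case
      by (cases X; cases Y; cases Z; cases W) (auto simp: S intro!: T_cmp_assoc Tarr_hom dest: Tarr_obj)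
  next
    case (6 f X Y) then show ?case by (cases X; cases Y) (auto simp: S T_cmp_ident)
  next
    case (7 f X Y) then show ?case by (cases X; cases Y) (auto simp: S T_cmp_ident)
  qed
  have tob: "P \<otimes>\<^bsub>?T\<^esub> Q \<in> objs ?T" if "P \<in> objs ?T" "Q \<in> objs ?T" for P Q
    using that by (cases P; cases Q) (auto simp: S Tob_tensor)
  have assoc: "(P \<otimes>\<^bsub>?T\<^esub> Q) \<otimes>\<^bsub>?T\<^esub> R = P \<otimes>\<^bsub>?T\<^esub> (Q \<otimes>\<^bsub>?T\<^esub> R)"
    if "P \<in> objs ?T" "Q \<in> objs ?T" "R \<in> objs ?T" for P Q R
    using tassoc[OF that] by (simp add: T_more)
  have unit: "\<one>\<^bsub>?T\<^esub> \<in> objs ?T" by (simp add: S Tob_unit)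
  have units: "\<one>\<^bsub>?T\<^esub> \<otimes>\<^bsub>?T\<^esub> P = P" "P \<otimes>\<^bsub>?T\<^esub> \<one>\<^bsub>?T\<^esub> = P" if "P \<in> objs ?T" for P
  proof -
    obtain X \<psi> where [simp]: "P = (X, \<psi>)" by (cases P)
    have "Tob X \<psi>" using that by (simp add: T_simps)
    note [simp] = TobD(1-4)[OF this]
    show "\<one>\<^bsub>?T\<^esub> \<otimes>\<^bsub>?T\<^esub> P = P" "P \<otimes>\<^bsub>?T\<^esub> \<one>\<^bsub>?T\<^esub> = P" by (simp_all add: T_simps)
  qed
  have th: "f \<boxtimes>\<^bsub>?T\<^esub> g \<in> hom ?T (X \<otimes>\<^bsub>?T\<^esub> Y) (X' \<otimes>\<^bsub>?T\<^esub> Y')"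
    if "f \<in> hom ?T X X'" "g \<in> hom ?T Y Y'" for f g X X' Y Y'
    using that by (cases X; cases Y; cases X'; cases Y') (auto simp: S Tarr_tensor)
  have ti: "ident ?T X \<boxtimes>\<^bsub>?T\<^esub> ident ?T Y = ident ?T (X \<otimes>\<^bsub>?T\<^esub> Y)"
    if "X \<in> objs ?T" "Y \<in> objs ?T" for X Y
    using that by (cases X; cases Y) (auto simp: S T_tensor_ident)
  have hom_obj: "X \<in> objs ?T" "Y \<in> objs ?T" if "f \<in> hom ?T X Y" for f X Y
    using that T.source_obj[of f] T.target_obj[of f] by (simp_all add: hom_def)
  have as: "associator ?T P Q R = ident ?T (P \<otimes>\<^bsub>?T\<^esub> (Q \<otimes>\<^bsub>?T\<^esub> R))" for P Q R by (simp add: T_more)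
  have lu: "left_unitor ?T P = ident ?T P" "right_unitor ?T P = ident ?T P" for P by (simp_all add: T_more)
  have inv: "\<exists>g. is_inverse ?T (ident ?T P) g" if "P \<in> objs ?T" for P
    using that T_sharp_ident_inverse[of "fst P" "snd P"] by (cases P) (auto simp: T_simps simp del: split_paired_Ex)
  have uh: "ident ?T \<one>\<^bsub>?T\<^esub> \<in> hom ?T \<one>\<^bsub>?T\<^esub> \<one>\<^bsub>?T\<^esub>" using T.ident_hom[OF unit] .
  have tensor_units: "ident ?T \<one>\<^bsub>?T\<^esub> \<boxtimes>\<^bsub>?T\<^esub> f = f" "f \<boxtimes>\<^bsub>?T\<^esub> ident ?T \<one>\<^bsub>?T\<^esub> = f"
    if "f \<in> hom ?T X Y" for f X Y
  proof -
    obtain x \<psi> y \<chi> where [simp]: "X = (x, \<psi>)" "Y = (y, \<chi>)" by (meson surj_pair)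
    from that obtain f' where [simp]: "f = (X, f', Y)" and "Tarr X Y f'" unfolding T_hom by blast
    then have T: "Tarr (x, \<psi>) (y, \<chi>) f'" by simp
    note [simp] = TobD(1-4)[OF TarrD(1)[OF T]] TobD(1-4)[OF TarrD(2)[OF T]] TarrD(3-5)[OF T]
    show "ident ?T \<one>\<^bsub>?T\<^esub> \<boxtimes>\<^bsub>?T\<^esub> f = f" "f \<boxtimes>\<^bsub>?T\<^esub> ident ?T \<one>\<^bsub>?T\<^esub> = f"
      using T_tensor_unit[OF T] by (simp_all add: T_simps T_sharp_tensor_def)
  qed
  have asn: "(f \<boxtimes>\<^bsub>?T\<^esub> g) \<boxtimes>\<^bsub>?T\<^esub> h = f \<boxtimes>\<^bsub>?T\<^esub> (g \<boxtimes>\<^bsub>?T\<^esub> h)"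
    if "f \<in> hom ?T X X'" "g \<in> hom ?T Y Y'" "h \<in> hom ?T Z Z'" for f g h X X' Y Y' Z Z'
  proof -
    obtain x \<psi> x' \<psi>' y \<chi> y' \<chi>' z \<omega> z' \<omega>' where [simp]: "X = (x, \<psi>)" "X' = (x', \<psi>')" "Y = (y, \<chi>)" "Y' = (y', \<chi>')"
      "Z = (z, \<omega>)" "Z' = (z', \<omega>')" by (meson surj_pair)
    from that obtain f' g' h' where *: "f = (X, f', X')" "g = (Y, g', Y')" "h = (Z, h', Z')"
      and T: "Tarr (x, \<psi>) (x', \<psi>') f'" "Tarr (y, \<chi>) (y', \<chi>') g'" "Tarr (z, \<omega>) (z', \<omega>') h'"
      by (auto simp: T_hom)
    show ?thesis
      using tensor_assoc_T[OF T] assoc[OF hom_obj(1)[OF that(1)] hom_obj(1)[OF that(2)] hom_obj(1)[OF that(3)]]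
        assoc[OF hom_obj(2)[OF that(1)] hom_obj(2)[OF that(2)] hom_obj(2)[OF that(3)]]
      by (simp add: * T_simps T_sharp_tensor_def)
  qed
  \<comment> \<open>Separate treatment goes to compatibility of tensor and composition, and to the
    naturality and coherence laws. Associators and unitors are identities, so the latter follow from
    strictness of the tensor product and neutrality of identities.\<close>
  show ?thesis
  proof (unfold_locales, goal_cases)
    case (5 f X X' f' X'' g Y Y' g' Y'') then show ?case
      by (cases X; cases Y; cases X'; cases Y'; cases X''; cases Y'') (auto simp: S tensor_cmp_T)
  next
    case (8 f X X' g Y Y' h Z Z')
    note h = hom_obj[OF 8(1)] hom_obj[OF 8(2)] hom_obj[OF 8(3)]
    show ?case using 8 h
      by (simp add: as asn[OF 8] T.ident_left[OF th[OF 8(1) th[OF 8(2,3)]]] T.ident_right[OF th[OF 8(1) th[OF 8(2,3)]]])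
  next
    case (11 f X Y) then show ?case
      by (simp add: lu tensor_units T.ident_left[OF 11] T.ident_right[OF 11])
  next
    case (14 f X Y) then show ?case
      by (simp add: lu tensor_units T.ident_left[OF 14] T.ident_right[OF 14])
  next
    case (15 W X Y Z)
    note i = T.ident_hom[OF tob[OF 15(1) tob[OF 15(2) tob[OF 15(3,4)]]]]
    show ?case using 15 by (simp add: as assoc ti tob T.ident_left[OF i])
  next
    case (16 X Y)
    note i = T.ident_hom[OF tob[OF 16]]
    show ?case using 16 by (simp add: as lu ti tob units unit T.ident_left[OF i])
  qed (use unit units tob th ti assoc inv as lu T.ident_hom in simp_all)
qed

end

section \<open>Coseparable coalgebras and Casimir forms\<close>

lemma is_inverse_unique:
  assumes "category C" "is_inverse C f g" "is_inverse C f g'"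
  shows "g = g'"
proof -
  interpret category C by fact
  have f: "f \<in> hom C (source C f) (target C f)" using assms(2) by (simp add: is_inverse_def hom_def)
  have g: "g \<in> hom C (target C f) (source C f)" "g' \<in> hom C (target C f) (source C f)"
    and eq: "g \<cdot>\<^bsub>C\<^esub> f = ident C (source C f)" "f \<cdot>\<^bsub>C\<^esub> g' = ident C (target C f)"
    using assms(2,3) by (simp_all add: is_inverse_def)
  have "g = g \<cdot>\<^bsub>C\<^esub> (f \<cdot>\<^bsub>C\<^esub> g')" using ident_right[OF g(1)] eq by simp
  also have "\<dots> = g'" using cmp_assoc[OF g(2) f g(1)] ident_left[OF g(2)] eq by simp
  finally show ?thesis .
qed

lemma inverse_arr_eq:
  assumes "category C" "is_inverse C f g"
  shows "inverse_arr C f = g"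
  unfolding inverse_arr_def using assms is_inverse_unique by (metis (mono_tags, lifting) theI)

section \<open>Coseparability in an arbitrary strict monoidal category\<close>

context diagrams
begin

lemma inverse_ident [simp]:
  assumes "X \<in> objs C" shows "inverse_arr C (ident C X) = ident C X"
  by (rule inverse_arr_eq[OF category_axioms]) (use assms in \<open>simp add: is_inverse_def hom_def\<close>)

lemma coalgebra_iff:
  "coalgebra C K \<delta> \<epsilon> \<longleftrightarrow> K \<in> objs C \<and> \<delta> \<in> hom C K (K \<otimes> K) \<and> \<epsilon> \<in> hom C K \<one> \<and>
    (\<delta> \<triangleright> K) \<cdot> \<delta> = (K \<triangleleft> \<delta>) \<cdot> \<delta> \<and> (\<epsilon> \<triangleright> K) \<cdot> \<delta> = ident C K \<and> (K \<triangleleft> \<epsilon>) \<cdot> \<delta> = ident C K"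
proof -
  have "associator C K K K \<cdot> (\<delta> \<triangleright> K) \<cdot> \<delta> = (\<delta> \<triangleright> K) \<cdot> \<delta> \<and>
      left_unitor C K \<cdot> (\<epsilon> \<triangleright> K) \<cdot> \<delta> = (\<epsilon> \<triangleright> K) \<cdot> \<delta> \<and> right_unitor C K \<cdot> (K \<triangleleft> \<epsilon>) \<cdot> \<delta> = (K \<triangleleft> \<epsilon>) \<cdot> \<delta>"
    if "K \<in> objs C" "\<delta> \<in> hom C K (K \<otimes> K)" "\<epsilon> \<in> hom C K \<one>"
    using that homD[OF that(2)] homD[OF that(3)]
    by (simp add: strict_associator strict_left_unitor strict_right_unitor)
  then show ?thesis unfolding coalgebra_def by auto
qed

lemma coseparable_iff:
  "coseparable_coalgebra C K \<delta> \<epsilon> \<longleftrightarrow> coalgebra C K \<delta> \<epsilon> \<and>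
    (\<exists>\<pi> \<in> hom C (K \<otimes> K) K. \<pi> \<cdot> \<delta> = ident C K \<and>
      \<delta> \<cdot> \<pi> = (K \<triangleleft> \<pi>) \<cdot> (\<delta> \<triangleright> K) \<and> \<delta> \<cdot> \<pi> = (\<pi> \<triangleright> K) \<cdot> (K \<triangleleft> \<delta>))"
proof -
  have "associator C K K K \<cdot> (\<delta> \<triangleright> K) = \<delta> \<triangleright> K \<and> inverse_arr C (associator C K K K) \<cdot> (K \<triangleleft> \<delta>) = K \<triangleleft> \<delta>"
    if "coalgebra C K \<delta> \<epsilon>"
  proof -
    have *: "K \<in> objs C" "\<delta> \<in> hom C K (K \<otimes> K)" using that by (simp_all add: coalgebra_iff)
    then show ?thesis using homD[OF *(2)] by (simp add: strict_associator)
  qed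
  then show ?thesis unfolding coseparable_coalgebra_def bicolinear_def by auto
qed

text \<open>A form gives back the retraction as \<open>(\<beta> \<triangleright> K) \<cdot> (K
  \<triangleleft> \<delta>)\<close>. The Casimir identity supplies the second expression \<open>(K
  \<triangleleft> \<beta>) \<cdot> (\<delta> \<triangleright> K)\<close>, and coassociativity makes
  one expression right colinear and the other left colinear. Conversely, applying the counit to the
  two colinearity laws of \<open>\<pi>\<close> gives the Casimir identity for
  \<open>\<epsilon> \<cdot> \<pi>\<close>.\<close>

lemma coseparable_iff_casimir:
  "coseparable_coalgebra C K \<delta> \<epsilon> \<longleftrightarrow> coalgebra C K \<delta> \<epsilon> \<and>
    (\<exists>\<beta> \<in> hom C (K \<otimes> K) \<one>. (K \<triangleleft> \<beta>) \<cdot> (\<delta> \<triangleright> K) = (\<beta> \<triangleright> K) \<cdot> (K \<triangleleft> \<delta>) \<and> \<beta> \<cdot> \<delta> = \<epsilon>)"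
proof (cases "coalgebra C K \<delta> \<epsilon>")
  case True
  then have K [simp]: "K \<in> objs C" and d: "\<delta> \<in> hom C K (K \<otimes> K)" and e: "\<epsilon> \<in> hom C K \<one>"
    and eqs: "(\<delta> \<triangleright> K) \<cdot> \<delta> = (K \<triangleleft> \<delta>) \<cdot> \<delta>" "(\<epsilon> \<triangleright> K) \<cdot> \<delta> = ident C K" "(K \<triangleleft> \<epsilon>) \<cdot> \<delta> = ident C K"
    unfolding coalgebra_iff by auto
  note [simp] = homD(1-3)[OF d] homD(1-3)[OF e]
  let ?D = "Box \<delta> [K] [K, K]" and ?E = "Box \<epsilon> [K] []"
  have coassoc: "sl (Suc n) ?D (sl n ?D st) = sl n ?D (sl n ?D st)" for n st
    using lift_eq[of "[(1, ?D), (0, ?D)]" "[K]" "[(0, ?D), (0, ?D)]" n st] eqs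
    by (simp add: gout)
  have counit: "sl n ?E (sl n ?D st) = gd n K st" "sl (Suc n) ?E (sl n ?D st) = gd n K st" for n st
    using lift_eq[of "[(0, ?E), (0, ?D)]" "[K]" "[]" n st] lift_eq[of "[(1, ?E), (0, ?D)]" "[K]" "[]" n st] eqs
    by (simp_all add: gout)
  have "\<exists>\<beta> \<in> hom C (K \<otimes> K) \<one>. (K \<triangleleft> \<beta>) \<cdot> (\<delta> \<triangleright> K) = (\<beta> \<triangleright> K) \<cdot> (K \<triangleleft> \<delta>) \<and> \<beta> \<cdot> \<delta> = \<epsilon>"
    if p: "\<pi> \<in> hom C (K \<otimes> K) K" "\<pi> \<cdot> \<delta> = ident C K"
      and p': "\<delta> \<cdot> \<pi> = (K \<triangleleft> \<pi>) \<cdot> (\<delta> \<triangleright> K)" "\<delta> \<cdot> \<pi> = (\<pi> \<triangleright> K) \<cdot> (K \<triangleleft> \<delta>)" for \<pi>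
  proof -
    note [simp] = homD(1-3)[OF p(1)]
    let ?P = "Box \<pi> [K, K] [K]"
    have r: "sl (Suc n) ?P (sl n ?D st) = sl n ?D (sl n ?P st)"
      "sl n ?P (sl (Suc n) ?D st) = sl n ?D (sl n ?P st)" "sl n ?P (sl n ?D st) = gd n K st" for n st
      using lift_eq[of "[(1, ?P), (0, ?D)]" "[K, K]" "[(0, ?D), (0, ?P)]" n st]
        lift_eq[of "[(0, ?P), (1, ?D)]" "[K, K]" "[(0, ?D), (0, ?P)]" n st]
        lift_eq[of "[(0, ?P), (0, ?D)]" "[K]" "[]" n st] p(2) p'
      by (simp_all add: gout)
    have 1: "run [(1, ?E), (1, ?P), (0, ?D)] (start [K, K]) = run [(0, ?E), (0, ?P), (1, ?D)] (start [K, K])"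
      by (simp add: nf r counit)
    have 2: "run [(0, ?E), (0, ?P), (0, ?D)] (start [K]) = run [(0, ?E)] (start [K])"
      by (simp add: nf r)
    show ?thesis using diagram_eq[OF 1] diagram_eq[OF 2]
      by (intro bexI[of _ "\<epsilon> \<cdot> \<pi>"] homI) (simp_all)
  qed
  moreover have "\<exists>\<pi> \<in> hom C (K \<otimes> K) K. \<pi> \<cdot> \<delta> = ident C K \<and>
      \<delta> \<cdot> \<pi> = (K \<triangleleft> \<pi>) \<cdot> (\<delta> \<triangleright> K) \<and> \<delta> \<cdot> \<pi> = (\<pi> \<triangleright> K) \<cdot> (K \<triangleleft> \<delta>)"
    if b: "\<beta> \<in> hom C (K \<otimes> K) \<one>" "(K \<triangleleft> \<beta>) \<cdot> (\<delta> \<triangleright> K) = (\<beta> \<triangleright> K) \<cdot> (K \<triangleleft> \<delta>)" "\<beta> \<cdot> \<delta> = \<epsilon>" for \<beta>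
  proof -
    note [simp] = homD(1-3)[OF b(1)]
    let ?B = "Box \<beta> [K, K] []"
    have r: "sl n ?B (sl (Suc n) ?D st) = sl (Suc n) ?B (sl n ?D st)" "sl n ?B (sl n ?D st) = sl n ?E st" for n st
      using lift_eq[of "[(1, ?B), (0, ?D)]" "[K, K]" "[(0, ?B), (1, ?D)]" n st]
        lift_eq[of "[(0, ?B), (0, ?D)]" "[K]" "[(0, ?E)]" n st] b(2,3)
      by (simp_all add: gout)
    have 1: "run [(0, ?B), (1, ?D), (0, ?D)] (start [K]) = run [] (start [K])"
      by (simp add: nf coassoc r counit)
    have 2: "run [(0, ?D), (0, ?B), (1, ?D)] (start [K, K]) = run [(1, ?B), (2, ?D), (0, ?D)] (start [K, K])"
      by (simp add: nf coassoc r)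
    have 3: "run [(0, ?D), (0, ?B), (1, ?D)] (start [K, K]) = run [(0, ?B), (1, ?D), (1, ?D)] (start [K, K])"
      by (simp add: nf coassoc r)
    show ?thesis using diagram_eq[OF 1] diagram_eq[OF 2] diagram_eq[OF 3]
      by (intro bexI[of _ "(\<beta> \<triangleright> K) \<cdot> (K \<triangleleft> \<delta>)"] homI) (simp_all)
  qed
  ultimately show ?thesis unfolding coseparable_iff by blast
qed (simp add: coseparable_coalgebra_def)

end

context strict_algebra
begin

lemma T_tensor_ident_right:
  assumes "Tarr (X, \<psi>) (X', \<psi>') f" "Y \<in> objs C"
  shows "(m \<triangleright> X' \<otimes> Y) \<cdot> (A \<triangleleft> \<psi>' \<triangleright> Y) \<cdot> (f \<boxtimes> (\<eta> \<triangleright> Y)) = f \<triangleright> Y"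
proof -
  note T = TarrD[OF assms(1)]
  note [simp] = T(3-5) TobD[OF T(1)] TobD[OF T(2)] assms(2)
  let ?F = "Box f [X] [A, X']" and ?P' = "Box \<psi>' [X', A] [A, X']"
  have s: "f \<boxtimes> (\<eta> \<triangleright> Y) = (f \<triangleright> A \<otimes> Y) \<cdot> (X \<triangleleft> (\<eta> \<triangleright> Y))"
    by (rule tensor_split) (simp_all add: hom_def)
  have "run [(0, M), (1, ?P'), (0, ?F), (1, E)] (start [X, Y]) = run [(0, ?F)] (start [X, Y])"
    by (simp add: anf)
  from diagram_eq[OF this] show ?thesis unfolding s by simp
qed

lemma T_tensor_ident_left:
  assumes "Tob X \<psi>" "Tarr (Y, \<chi>) (Y', \<chi>') g"
  shows "(m \<triangleright> X \<otimes> Y') \<cdot> (A \<triangleleft> \<psi> \<triangleright> Y') \<cdot> ((\<eta> \<triangleright> X) \<boxtimes> g) = (\<psi> \<triangleright> Y') \<cdot> (X \<triangleleft> g)"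
proof -
  note T = TarrD[OF assms(2)]
  note [simp] = T(3-5) TobD[OF T(1)] TobD[OF T(2)] TobD[OF assms(1)]
  let ?G = "Box g [Y] [A, Y']" and ?P = "Box \<psi> [X, A] [A, X]"
  have s: "(\<eta> \<triangleright> X) \<boxtimes> g = ((\<eta> \<triangleright> X) \<triangleright> A \<otimes> Y') \<cdot> (X \<triangleleft> g)"
    by (rule tensor_split) (simp_all add: hom_def)
  have "run [(0, M), (1, ?P), (0, E), (1, ?G)] (start [X, Y]) = run [(0, ?P), (1, ?G)] (start [X, Y])"
    by (simp add: anf)
  from diagram_eq[OF this] show ?thesis unfolding s by simp
qed

text \<open>Whiskering on the right leaves the underlying arrow as in \<open>C\<close>, since its
  factor \<open>A\<close> is already outermost. Whiskering on the left, treated next, has to carry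
  that factor across by \<open>\<psi>\<close>. This asymmetry is the origin of the unbalanced look
  of the cowreath axioms.\<close>

lemma T_whisker_right:
  assumes "Tarr (X, \<psi>) (X', \<psi>') f" "Tob Y \<chi>"
  shows "((X, \<psi>), f, (X', \<psi>')) \<triangleright>\<^bsub>T_sharp C A m \<eta>\<^esub> (Y, \<chi>) =
    (T_sharp_tensor C (X, \<psi>) (Y, \<chi>), f \<triangleright> Y, T_sharp_tensor C (X', \<psi>') (Y, \<chi>))"
  using T_tensor_ident_right[OF assms(1) TobD(1)[OF assms(2)]] by (simp add: T_simps)

lemma T_whisker_left:
  assumes "Tob X \<psi>" "Tarr (Y, \<chi>) (Y', \<chi>') g"
  shows "(X, \<psi>) \<triangleleft>\<^bsub>T_sharp C A m \<eta>\<^esub> ((Y, \<chi>), g, (Y', \<chi>')) =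
    (T_sharp_tensor C (X, \<psi>) (Y, \<chi>), (\<psi> \<triangleright> Y') \<cdot> (X \<triangleleft> g), T_sharp_tensor C (X, \<psi>) (Y', \<chi>'))"
  using T_tensor_ident_left[OF assms] by (simp add: T_simps)

end

section \<open>Cowreaths and their Casimir forms\<close>

locale cow = strict_algebra C A m \<eta> for C :: "('o, 'a) moncat" (structure) and A m \<eta> +
  fixes X :: 'o and \<psi> \<delta> \<epsilon> :: 'a
  assumes cow: "cowreath C A m \<eta> X \<psi> \<delta> \<epsilon>"
begin

abbreviation "P \<equiv> Box \<psi> [X, A] [A, X]"
abbreviation "D \<equiv> Box \<delta> [X] [A, X, X]"
abbreviation "Ep \<equiv> Box \<epsilon> [X] [A]"
abbreviation "\<psi>2 \<equiv> (\<psi> \<triangleright> X) \<cdot> (X \<triangleleft> \<psi>)"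

lemma cow_arrs:
  "Tob X \<psi>" "Tarr (X, \<psi>) (X \<otimes> X, \<psi>2) \<delta>" "Tarr (X, \<psi>) (\<one>, ident C A) \<epsilon>"
  using cow unfolding cowreath_def coalgebra_def
  by (auto simp: T_hom T_simps cow_comult_def cow_counit_def)

lemma cow_facts [simp]:
  "X \<in> objs C" "\<psi> \<in> arrs C" "source C \<psi> = X \<otimes> A" "target C \<psi> = A \<otimes> X"
  "\<delta> \<in> arrs C" "source C \<delta> = X" "target C \<delta> = A \<otimes> X \<otimes> X"
  "\<epsilon> \<in> arrs C" "source C \<epsilon> = X" "target C \<epsilon> = A"
  using TobD(1-4)[OF cow_arrs(1)] TarrD(3-5)[OF cow_arrs(2)] TarrD(3-5)[OF cow_arrs(3)] by simp_all

lemmas P_rules = TobD(5-6)[OF cow_arrs(1)]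

lemma cow_eq:
  "cow_comult C X \<psi> \<delta> = ((X, \<psi>), \<delta>, (X \<otimes> X, \<psi>2))"
  "cow_counit C A X \<psi> \<epsilon> = ((X, \<psi>), \<epsilon>, (\<one>, ident C A))"
  by (simp_all add: cow_comult_def cow_counit_def T_sharp_tensor_def)

lemmas whiskers = T_whisker_right[OF cow_arrs(2) cow_arrs(1)] T_whisker_left[OF cow_arrs(1) cow_arrs(2)]
  T_whisker_right[OF cow_arrs(3) cow_arrs(1)] T_whisker_left[OF cow_arrs(1) cow_arrs(3)]

lemma cow_eqs:
  "(m \<triangleright> X \<otimes> X \<otimes> X) \<cdot> (A \<triangleleft> \<delta> \<triangleright> X) \<cdot> \<delta> = (m \<triangleright> X \<otimes> X \<otimes> X) \<cdot> (A \<triangleleft> \<psi> \<triangleright> X \<otimes> X) \<cdot> (A \<otimes> X \<triangleleft> \<delta>) \<cdot> \<delta>"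
  "(m \<triangleright> X) \<cdot> (A \<triangleleft> \<epsilon> \<triangleright> X) \<cdot> \<delta> = \<eta> \<triangleright> X"
  "(m \<triangleright> X) \<cdot> (A \<triangleleft> \<psi>) \<cdot> (A \<otimes> X \<triangleleft> \<epsilon>) \<cdot> \<delta> = \<eta> \<triangleright> X"
  "(m \<triangleright> X \<otimes> X) \<cdot> (A \<triangleleft> \<delta>) \<cdot> \<psi> = (m \<triangleright> X \<otimes> X) \<cdot> (A \<triangleleft> \<psi>2) \<cdot> (\<delta> \<triangleright> A)"
  "m \<cdot> (A \<triangleleft> \<epsilon>) \<cdot> \<psi> = m \<cdot> (\<epsilon> \<triangleright> A)"
proof -
  interpret T: strict_monoidal_category "T_sharp C A m \<eta>" by (rule T_sharp_strict_monoidal)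
  interpret T: diagrams "T_sharp C A m \<eta>" ..
  have "coalgebra (T_sharp C A m \<eta>) (X, \<psi>) (cow_comult C X \<psi> \<delta>) (cow_counit C A X \<psi> \<epsilon>)"
    using cow by (simp add: cowreath_def)
  note * = this[unfolded T.coalgebra_iff]
  show "(m \<triangleright> X \<otimes> X \<otimes> X) \<cdot> (A \<triangleleft> \<delta> \<triangleright> X) \<cdot> \<delta> = (m \<triangleright> X \<otimes> X \<otimes> X) \<cdot> (A \<triangleleft> \<psi> \<triangleright> X \<otimes> X) \<cdot> (A \<otimes> X \<triangleleft> \<delta>) \<cdot> \<delta>"
    "(m \<triangleright> X) \<cdot> (A \<triangleleft> \<epsilon> \<triangleright> X) \<cdot> \<delta> = \<eta> \<triangleright> X"
    "(m \<triangleright> X) \<cdot> (A \<triangleleft> \<psi>) \<cdot> (A \<otimes> X \<triangleleft> \<epsilon>) \<cdot> \<delta> = \<eta> \<triangleright> X"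
    using *[unfolded cow_eq whiskers] by (simp_all add: T_simps T_sharp_tensor_def)
  show "(m \<triangleright> X \<otimes> X) \<cdot> (A \<triangleleft> \<delta>) \<cdot> \<psi> = (m \<triangleright> X \<otimes> X) \<cdot> (A \<triangleleft> \<psi>2) \<cdot> (\<delta> \<triangleright> A)"
    "m \<cdot> (A \<triangleleft> \<epsilon>) \<cdot> \<psi> = m \<cdot> (\<epsilon> \<triangleright> A)"
    using cow_arrs(2,3) by (simp_all add: Tarr_def)
qed

lemma lift_coassoc:
  "sl n M (sl (Suc n) D (sl n D st)) = sl n M (sl (Suc n) P (sl (Suc (Suc n)) D (sl n D st)))"
  using lift_eq[of "[(0, M), (1, D), (0, D)]" "[X]" "[(0, M), (1, P), (2, D), (0, D)]" n st] cow_eqs(1)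
  by (simp add: gout)

lemma lift_counit:
  "sl n M (sl (Suc n) Ep (sl n D st)) = sl n E (gd n X st)"
  "sl n M (sl (Suc n) P (sl (Suc (Suc n)) Ep (sl n D st))) = sl n E (gd n X st)"
  using lift_eq[of "[(0, M), (1, Ep), (0, D)]" "[X]" "[(0, E)]" n st]
    lift_eq[of "[(0, M), (1, P), (2, Ep), (0, D)]" "[X]" "[(0, E)]" n st] cow_eqs(2,3)
  by (simp_all add: gout)

lemma lift_D_natural:
  "sl n M (sl (Suc n) D (sl n P st)) = sl n M (sl (Suc n) P (sl (Suc (Suc n)) P (sl n D st)))"
  using lift_eq[of "[(0, M), (1, D), (0, P)]" "[X, A]" "[(0, M), (1, P), (2, P), (0, D)]" n st] cow_eqs(4)
  by (simp add: gout)

lemma lift_Ep_natural: "sl n M (sl (Suc n) Ep (sl n P st)) = sl n M (sl n Ep st)"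
  using lift_eq[of "[(0, M), (1, Ep), (0, P)]" "[X, A]" "[(0, M), (0, Ep)]" n st] cow_eqs(5)
  by (simp add: gout)

text \<open>Laws that begin with a multiplication are listed together with the variants that
  \<open>M_under\<close> and \<open>M_under2\<close> provide, so that they still apply after
  products have been nested to the left.\<close>

lemmas cow_rules = P_rules lift_coassoc lift_counit lift_D_natural lift_Ep_natural
  lift_coassoc[THEN M_under] lift_counit(1)[THEN M_under] lift_counit(2)[THEN M_under2]
  lift_D_natural[THEN M_under] lift_Ep_natural[THEN M_under]

text \<open>The condition involving only \<open>\<psi>\<close> says that \<open>\<beta>\<close> is
  an arrow of \<open>T_sharp\<close> from the square of \<open>(X, \<psi>)\<close> to the unit. The
  remaining two equations are those of \<open>coseparable_iff_casimir\<close>, with composition and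
  whiskering of \<open>T_sharp\<close> written out in \<open>C\<close>.\<close>

definition casimir :: "'a \<Rightarrow> bool" where
  "casimir \<beta> \<longleftrightarrow> \<beta> \<in> hom C (X \<otimes> X) A \<and> m \<cdot> (A \<triangleleft> \<beta>) \<cdot> (\<psi> \<triangleright> X) \<cdot> (X \<triangleleft> \<psi>) = m \<cdot> (\<beta> \<triangleright> A) \<and>
    (m \<triangleright> X) \<cdot> (A \<triangleleft> \<psi>) \<cdot> (A \<otimes> X \<triangleleft> \<beta>) \<cdot> (\<delta> \<triangleright> X) =
    (m \<triangleright> X) \<cdot> (A \<triangleleft> \<beta> \<triangleright> X) \<cdot> (\<psi> \<triangleright> X \<otimes> X) \<cdot> (X \<triangleleft> \<delta>) \<and>
    m \<cdot> (A \<triangleleft> \<beta>) \<cdot> \<delta> = \<epsilon>"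

lemma coseparable_iff_ex_casimir:
  "coseparable_coalgebra (T_sharp C A m \<eta>) (X, \<psi>) (cow_comult C X \<psi> \<delta>) (cow_counit C A X \<psi> \<epsilon>) \<longleftrightarrow>
    (\<exists>\<beta>. casimir \<beta>)"
proof -
  interpret T: strict_monoidal_category "T_sharp C A m \<eta>" by (rule T_sharp_strict_monoidal)
  interpret T: diagrams "T_sharp C A m \<eta>" ..
  have co: "coalgebra (T_sharp C A m \<eta>) (X, \<psi>) (cow_comult C X \<psi> \<delta>) (cow_counit C A X \<psi> \<epsilon>)"
    using cow by (simp add: cowreath_def)
  have arr: "Tarr (X \<otimes> X, \<psi>2) (\<one>, ident C A) \<beta> \<longleftrightarrow>
      \<beta> \<in> hom C (X \<otimes> X) A \<and> m \<cdot> (A \<triangleleft> \<beta>) \<cdot> (\<psi> \<triangleright> X) \<cdot> (X \<triangleleft> \<psi>) = m \<cdot> (\<beta> \<triangleright> A)" for \<beta>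
  proof -
    have "m \<cdot> (A \<triangleleft> \<beta>) \<cdot> \<psi>2 = m \<cdot> (A \<triangleleft> \<beta>) \<cdot> (\<psi> \<triangleright> X) \<cdot> (X \<triangleleft> \<psi>)" if "\<beta> \<in> hom C (X \<otimes> X) A"
      using homD[OF that] by simp
    then show ?thesis using Tob_tensor[OF cow_arrs(1,1)] Tob_unit by (auto simp: Tarr_def)
  qed
  have *: "(X, \<psi>) \<otimes>\<^bsub>T_sharp C A m \<eta>\<^esub> (X, \<psi>) = (X \<otimes> X, \<psi>2)" by (simp add: T_simps)
  have hom: "\<beta>' \<in> hom (T_sharp C A m \<eta>) (X \<otimes> X, \<psi>2) \<one>\<^bsub>T_sharp C A m \<eta>\<^esub> \<longleftrightarrow>
      (\<exists>\<beta>. \<beta>' = ((X \<otimes> X, \<psi>2), \<beta>, (\<one>, ident C A)) \<and> Tarr (X \<otimes> X, \<psi>2) (\<one>, ident C A) \<beta>)" for \<beta>'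
    by (simp add: T_hom T_simps)
  have eqs: "(X, \<psi>) \<triangleleft>\<^bsub>T_sharp C A m \<eta>\<^esub> ((X \<otimes> X, \<psi>2), \<beta>, (\<one>, ident C A)) \<cdot>\<^bsub>T_sharp C A m \<eta>\<^esub>
        (cow_comult C X \<psi> \<delta> \<triangleright>\<^bsub>T_sharp C A m \<eta>\<^esub> (X, \<psi>)) =
      ((X \<otimes> X, \<psi>2), \<beta>, (\<one>, ident C A)) \<triangleright>\<^bsub>T_sharp C A m \<eta>\<^esub> (X, \<psi>) \<cdot>\<^bsub>T_sharp C A m \<eta>\<^esub>
        ((X, \<psi>) \<triangleleft>\<^bsub>T_sharp C A m \<eta>\<^esub> cow_comult C X \<psi> \<delta>) \<and>
      ((X \<otimes> X, \<psi>2), \<beta>, (\<one>, ident C A)) \<cdot>\<^bsub>T_sharp C A m \<eta>\<^esub> cow_comult C X \<psi> \<delta> = cow_counit C A X \<psi> \<epsilon>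
      \<longleftrightarrow> casimir \<beta>" if \<beta>: "Tarr (X \<otimes> X, \<psi>2) (\<one>, ident C A) \<beta>" for \<beta>
  proof -
    have h: "\<beta> \<in> hom C (X \<otimes> X) A" using \<beta> arr by blast
    show ?thesis
      using arr[of \<beta>] \<beta> homD[OF h]
      unfolding cow_eq whiskers T_whisker_right[OF \<beta> cow_arrs(1)] T_whisker_left[OF cow_arrs(1) \<beta>] casimir_def
      by (simp add: T_simps T_sharp_tensor_def)
  qed
  show ?thesis
    unfolding T.coseparable_iff_casimir * using co hom eqs arr unfolding casimir_def by (metis (no_types, lifting))
qed

end

section \<open>The wreath product of a cowreath with a dual\<close>

locale cowd = cow C A m \<eta> X \<psi> \<delta> \<epsilon> for C :: "('o, 'a) moncat" (structure) and A m \<eta> X \<psi> \<delta> \<epsilon> +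
  fixes Y :: 'o and b d :: 'a
  assumes dual: "dual_pair C X Y b d"
begin

lemma dual_facts [simp]:
  "Y \<in> objs C" "b \<in> arrs C" "source C b = \<one>" "target C b = Y \<otimes> X"
  "d \<in> arrs C" "source C d = X \<otimes> Y" "target C d = \<one>"
  using dual homD[of b] homD[of d] unfolding dual_pair_def by auto

abbreviation "Bx \<equiv> Box b [] [Y, X]"
abbreviation "Dx \<equiv> Box d [X, Y] []"

lemma zigzag:
  "sl (Suc n) Dx (sl n Bx st) = gd n Y st" "sl n Dx (sl (Suc n) Bx st) = gd n X st"
proof -
  have eqs: "(Y \<triangleleft> d) \<cdot> (b \<triangleright> Y) = ident C Y" "(d \<triangleright> X) \<cdot> (X \<triangleleft> b) = ident C X"
    using dual unfolding dual_pair_def by auto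
  show "sl (Suc n) Dx (sl n Bx st) = gd n Y st"
    using lift_eq[of "[(1, Dx), (0, Bx)]" "[Y]" "[]" n st] eqs by (simp add: gout)
  show "sl n Dx (sl (Suc n) Bx st) = gd n X st"
    using lift_eq[of "[(0, Dx), (1, Bx)]" "[X]" "[]" n st] eqs by (simp add: gout)
qed

text \<open>The zigzag identity recovers an arrow from its transpose by bending the strand
  \<open>X\<close> back with \<open>b\<close>.\<close>

lemma transpose_inj:
  assumes "f \<in> hom C W (Y \<otimes> V)" "g \<in> hom C W (Y \<otimes> V)" "V \<in> objs C"
    "(d \<triangleright> V) \<cdot> (X \<triangleleft> f) = (d \<triangleright> V) \<cdot> (X \<triangleleft> g)"
  shows "f = g"
proof -
  note [simp] = homD(1-4)[OF assms(1)] homD(1-3)[OF assms(2)] assms(3)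
  have *: "f = (Y \<triangleleft> ((d \<triangleright> V) \<cdot> (X \<triangleleft> f))) \<cdot> (b \<triangleright> W)" if f: "f \<in> hom C W (Y \<otimes> V)" for f
  proof -
    note [simp] = homD(1-3)[OF f]
    let ?F = "Box f [W] [Y, V]"
    have "run [(1, Dx), (2, ?F), (0, Bx)] (start [W]) = run [(0, ?F)] (start [W])"
      by (simp add: nf zigzag)
    from diagram_eq[OF this] show ?thesis by simp
  qed
  show ?thesis using *[OF assms(1)] *[OF assms(2)] assms(4) by simp
qed

section \<open>The dual structures and the wreath product\<close>

abbreviation "\<phi> \<equiv> dual_phi C A Y \<psi> b d"
abbreviation "mS \<equiv> wreath_mult C A m X Y \<psi> \<delta> b d"
abbreviation "uS \<equiv> wreath_unit C Y \<epsilon> b"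
abbreviation "iS \<equiv> wreath_incl C A m Y \<epsilon> b"
abbreviation "mY \<equiv> dual_mult C A X Y \<delta> b d"

abbreviation "Ph \<equiv> Box \<phi> [A, Y] [Y, A]"
abbreviation "MS \<equiv> Box mS [Y, A, Y, A] [Y, A]"
abbreviation "US \<equiv> Box uS [] [Y, A]"
abbreviation "IS \<equiv> Box iS [A] [Y, A]"
abbreviation "MY \<equiv> Box mY [Y, Y] [Y, A]"

lemma wreath_facts [simp]:
  "\<phi> \<in> arrs C" "source C \<phi> = A \<otimes> Y" "target C \<phi> = Y \<otimes> A"
  "mS \<in> arrs C" "source C mS = Y \<otimes> A \<otimes> Y \<otimes> A" "target C mS = Y \<otimes> A"
  "uS \<in> arrs C" "source C uS = \<one>" "target C uS = Y \<otimes> A"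
  "iS \<in> arrs C" "source C iS = A" "target C iS = Y \<otimes> A"
  "mY \<in> arrs C" "source C mY = Y \<otimes> Y" "target C mY = Y \<otimes> A"
  by (simp_all add: dual_phi_def wreath_mult_def wreath_unit_def wreath_incl_def dual_mult_def)

text \<open>Each dual structure is a cowreath structure bent around by the cup \<open>b\<close>, so
  a cap \<open>d\<close> on its output \<open>Y\<close> straightens it. Used from left to right, the
  rules eliminate all dual structures from a transposed diagram and leave a computation with the
  cowreath axioms.\<close>

lemma d_rules:
  "sl n Dx (sl (Suc n) Ph st) = sl (Suc n) Dx (sl n P st)"
  "sl n Dx (sl (Suc n) MS st) = sl n M (sl n M (sl (Suc (Suc n)) Dx (sl (Suc n) P (sl (Suc (Suc n)) Dx (sl n D st)))))"
  "sl n Dx (sl (Suc n) US st) = sl n Ep st"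
  "sl n Dx (sl (Suc n) IS st) = sl n M (sl n Ep st)"
  "sl n Dx (sl (Suc n) MY st) = sl (Suc n) Dx (sl (Suc (Suc n)) Dx (sl n D st))"
proof -
  have 1: "run [(0, Dx), (3, Dx), (2, P), (1, Bx)] (start [X, A, Y]) = run [(1, Dx), (0, P)] (start [X, A, Y])"
    by (simp add: nf zigzag)
  show "sl n Dx (sl (Suc n) Ph st) = sl (Suc n) Dx (sl n P st)"
    using lift_eq[of "[(0, Dx), (1, Ph)]" "[X, A, Y]" "[(1, Dx), (0, P)]" n st] diagram_eq[OF 1]
    by (simp add: gout dual_phi_def)
  have 2: "run [(0, Dx), (1 + 1, M), (1 + 1, M), (4, Dx), (3, P), (4, Dx), (2, D), (1, Bx)] (start [X, Y, A, Y, A]) =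
      run [(0, M), (0, M), (2, Dx), (1, P), (2, Dx), (0, D)] (start [X, Y, A, Y, A])"
    by (simp add: nf zigzag)
  show "sl n Dx (sl (Suc n) MS st) = sl n M (sl n M (sl (Suc (Suc n)) Dx (sl (Suc n) P (sl (Suc (Suc n)) Dx (sl n D st)))))"
    using lift_eq[of "[(0, Dx), (1, MS)]" "[X, Y, A, Y, A]" "[(0, M), (0, M), (2, Dx), (1, P), (2, Dx), (0, D)]" n st] diagram_eq[OF 2]
    by (simp add: gout wreath_mult_def)
  have 3: "run [(0, Dx), (2, Ep), (1, Bx)] (start [X]) = run [(0, Ep)] (start [X])"
    by (simp add: nf zigzag)
  show 3: "sl n Dx (sl (Suc n) US st) = sl n Ep st" for n st
    using lift_eq[of "[(0, Dx), (1, US)]" "[X]" "[(0, Ep)]" n st] diagram_eq[OF 3]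
    by (simp add: gout wreath_unit_def)
  have 4: "run [(0, Dx), (2, M), (1, US)] (start [X, A]) = run [(0, M), (0, Ep)] (start [X, A])"
    by (simp add: nf 3)
  show "sl n Dx (sl (Suc n) IS st) = sl n M (sl n Ep st)"
    using lift_eq[of "[(0, Dx), (1, IS)]" "[X, A]" "[(0, M), (0, Ep)]" n st] diagram_eq[OF 4]
    by (simp add: gout wreath_incl_def)
  have 5: "run [(0, Dx), (3, Dx), (4, Dx), (2, D), (1, Bx)] (start [X, Y, Y]) =
      run [(1, Dx), (2, Dx), (0, D)] (start [X, Y, Y])"
    by (simp add: nf zigzag)
  show "sl n Dx (sl (Suc n) MY st) = sl (Suc n) Dx (sl (Suc (Suc n)) Dx (sl n D st))"
    using lift_eq[of "[(0, Dx), (1, MY)]" "[X, Y, Y]" "[(1, Dx), (2, Dx), (0, D)]" n st] diagram_eq[OF 5]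
    by (simp add: gout dual_mult_def)
qed

lemmas xnf = anf zigzag cow_rules d_rules

lemma wreath_assoc: "mS \<cdot> (mS \<triangleright> Y \<otimes> A) = mS \<cdot> (Y \<otimes> A \<triangleleft> mS)"
proof -
  have eq: "run [(0, Dx), (1, MS), (1, MS)] (start [X, Y, A, Y, A, Y, A]) =
    run [(0, Dx), (1, MS), (3, MS)] (start [X, Y, A, Y, A, Y, A])"
    by (simp add: xnf)
  show ?thesis
    by (rule transpose_inj[of _ "Y \<otimes> A \<otimes> Y \<otimes> A \<otimes> Y \<otimes> A" A]) (use diagram_eq[OF eq] in \<open>simp_all add: hom_def\<close>)
qed

lemma wreath_units: "mS \<cdot> (uS \<triangleright> Y \<otimes> A) = ident C (Y \<otimes> A)" "mS \<cdot> (Y \<otimes> A \<triangleleft> uS) = ident C (Y \<otimes> A)"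
proof -
  have 1: "run [(0, Dx), (1, MS), (1, US)] (start [X, Y, A]) = run [(0, Dx)] (start [X, Y, A])"
    by (simp add: xnf)
  have 2: "run [(0, Dx), (1, MS), (3, US)] (start [X, Y, A]) = run [(0, Dx)] (start [X, Y, A])"
    by (simp add: xnf)
  show "mS \<cdot> (uS \<triangleright> Y \<otimes> A) = ident C (Y \<otimes> A)"
    by (rule transpose_inj[of _ "Y \<otimes> A" A]) (use diagram_eq[OF 1] in \<open>simp_all add: hom_def\<close>)
  show "mS \<cdot> (Y \<otimes> A \<triangleleft> uS) = ident C (Y \<otimes> A)"
    by (rule transpose_inj[of _ "Y \<otimes> A" A]) (use diagram_eq[OF 2] in \<open>simp_all add: hom_def\<close>)
qed

lemma wreath_incl_mult: "iS \<cdot> m = mS \<cdot> (iS \<boxtimes> iS)"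
proof -
  have s: "iS \<boxtimes> iS = (iS \<triangleright> Y \<otimes> A) \<cdot> (A \<triangleleft> iS)" by (rule tensor_split) (simp_all add: hom_def)
  have eq: "run [(0, Dx), (1, IS), (1, M)] (start [X, A, A]) = run [(0, Dx), (1, MS), (1, IS), (2, IS)] (start [X, A, A])"
    by (simp add: xnf)
  show ?thesis unfolding s
    by (rule transpose_inj[of _ "A \<otimes> A" A]) (use diagram_eq[OF eq] in \<open>simp_all add: hom_def\<close>)
qed

lemma wreath_incl_unit: "iS \<cdot> \<eta> = uS"
proof -
  have eq: "run [(0, Dx), (1, IS), (1, E)] (start [X]) = run [(0, Dx), (1, US)] (start [X])"
    by (simp add: xnf)
  show ?thesis
    by (rule transpose_inj[of _ \<one> A]) (use diagram_eq[OF eq] in \<open>simp_all add: hom_def\<close>)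
qed

text \<open>With \<open>S = YA\<close>, the map \<open>tow : SS \<rightarrow> YS\<close> is the action of \<open>A\<close> on the second factor and
  \<open>fow : YS \<rightarrow> SS\<close> inserts the unit of \<open>A\<close>; they induce mutually inverse maps between \<open>S \<otimes>\<^sub>A S\<close> and \<open>YS\<close>.\<close>

abbreviation "tow \<equiv> Y \<triangleleft> (mS \<cdot> (iS \<triangleright> Y \<otimes> A))"
abbreviation "fow \<equiv> Y \<triangleleft> \<eta> \<triangleright> Y \<otimes> A"

text \<open>The equation belongs to the tensor square of \<open>YA\<close> over \<open>A\<close>,
  but comparing representatives after \<open>tow\<close> expresses it without a coequalizer. The
  last equation is the normalization required of a separability element.\<close>

definition central :: "'a \<Rightarrow> bool" where
  "central e \<longleftrightarrow> e \<in> hom C \<one> (Y \<otimes> Y \<otimes> A) \<and>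
    tow \<cdot> (mS \<triangleright> Y \<otimes> A) \<cdot> (Y \<otimes> A \<triangleleft> (fow \<cdot> e)) = tow \<cdot> (Y \<otimes> A \<triangleleft> mS) \<cdot> ((fow \<cdot> e) \<triangleright> Y \<otimes> A) \<and>
    mS \<cdot> fow \<cdot> e = uS"

lemma casimir_rules:
  assumes "casimir \<beta>"
  defines "B \<equiv> Box \<beta> [X, X] [A]"
  shows "sl n M (sl (Suc n) B (sl n P (sl (Suc n) P st))) = sl n M (sl n B st)"
    "sl n M (sl (Suc n) P (sl (Suc (Suc n)) B (sl n D st))) = sl n M (sl (Suc n) B (sl n P (sl (Suc n) D st)))"
    "sl n M (sl (Suc n) B (sl n D st)) = sl n Ep st"
proof -
  have h: "\<beta> \<in> hom C (X \<otimes> X) A" and eqs: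
    "m \<cdot> (A \<triangleleft> \<beta>) \<cdot> (\<psi> \<triangleright> X) \<cdot> (X \<triangleleft> \<psi>) = m \<cdot> (\<beta> \<triangleright> A)"
    "(m \<triangleright> X) \<cdot> (A \<triangleleft> \<psi>) \<cdot> (A \<otimes> X \<triangleleft> \<beta>) \<cdot> (\<delta> \<triangleright> X) =
      (m \<triangleright> X) \<cdot> (A \<triangleleft> \<beta> \<triangleright> X) \<cdot> (\<psi> \<triangleright> X \<otimes> X) \<cdot> (X \<triangleleft> \<delta>)"
    "m \<cdot> (A \<triangleleft> \<beta>) \<cdot> \<delta> = \<epsilon>"
    using assms(1) unfolding casimir_def by auto
  note [simp] = homD(1-3)[OF h]
  show "sl n M (sl (Suc n) B (sl n P (sl (Suc n) P st))) = sl n M (sl n B st)"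
    using lift_eq[of "[(0, M), (1, B), (0, P), (1, P)]" "[X, X, A]" "[(0, M), (0, B)]" n st] eqs(1)
    by (simp add: gout B_def)
  show "sl n M (sl (Suc n) P (sl (Suc (Suc n)) B (sl n D st))) = sl n M (sl (Suc n) B (sl n P (sl (Suc n) D st)))"
    using lift_eq[of "[(0, M), (1, P), (2, B), (0, D)]" "[X, X]" "[(0, M), (1, B), (0, P), (1, D)]" n st] eqs(2)
    by (simp add: gout B_def)
  show "sl n M (sl (Suc n) B (sl n D st)) = sl n Ep st"
    using lift_eq[of "[(0, M), (1, B), (0, D)]" "[X]" "[(0, Ep)]" n st] eqs(3)
    by (simp add: gout B_def)
qed

lemma double_transpose_inj:
  assumes "f \<in> hom C W (Y \<otimes> Y \<otimes> V)" "g \<in> hom C W (Y \<otimes> Y \<otimes> V)" "V \<in> objs C"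
    "(d \<triangleright> V) \<cdot> (X \<triangleleft> d \<triangleright> Y \<otimes> V) \<cdot> (X \<otimes> X \<triangleleft> f) = (d \<triangleright> V) \<cdot> (X \<triangleleft> d \<triangleright> Y \<otimes> V) \<cdot> (X \<otimes> X \<triangleleft> g)"
  shows "f = g"
proof (rule transpose_inj[of _ W "Y \<otimes> V"])
  note [simp] = homD(1-4)[OF assms(1)] homD(1-3)[OF assms(2)] assms(3)
  show "(d \<triangleright> Y \<otimes> V) \<cdot> (X \<triangleleft> f) = (d \<triangleright> Y \<otimes> V) \<cdot> (X \<triangleleft> g)"
    by (rule transpose_inj[of _ "X \<otimes> W" V]) (use assms(4) in \<open>simp_all add: hom_def\<close>)
qed (use assms in \<open>simp_all add: homD\<close>)

text \<open>Both inputs of the form are bent to outputs by nested cups; this is inverse to the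
  double transposition in \<open>double_transpose_inj\<close>.\<close>

definition coev2 :: "'a \<Rightarrow> 'a" where
  "coev2 \<beta> = (Y \<otimes> Y \<triangleleft> \<beta>) \<cdot> (Y \<triangleleft> b \<triangleright> X) \<cdot> b"

lemma coev2_unfold:
  assumes "\<beta> \<in> hom C (X \<otimes> X) A"
  shows "sl n (Box (coev2 \<beta>) [] [Y, Y, A]) st = sl (Suc (Suc n)) (Box \<beta> [X, X] [A]) (sl (Suc n) Bx (sl n Bx st))"
proof -
  note [simp] = homD(1-3)[OF assms]
  show ?thesis
    using lift_eq[of "[(0, Box (coev2 \<beta>) [] [Y, Y, A])]" "[]" "[(2, Box \<beta> [X, X] [A]), (1, Bx), (0, Bx)]" n st]
    by (simp add: coev2_def)
qed

lemma coev2_hom: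
  assumes "\<beta> \<in> hom C (X \<otimes> X) A" shows "coev2 \<beta> \<in> hom C \<one> (Y \<otimes> Y \<otimes> A)"
  using homD[OF assms] by (simp add: hom_def coev2_def)

lemma coev2_surj:
  assumes "e \<in> hom C \<one> (Y \<otimes> Y \<otimes> A)"
  obtains \<beta> where "\<beta> \<in> hom C (X \<otimes> X) A" "e = coev2 \<beta>"
proof
  note [simp] = homD(1-3)[OF assms]
  let ?\<beta> = "(d \<triangleright> A) \<cdot> (X \<triangleleft> d \<triangleright> Y \<otimes> A) \<cdot> (X \<otimes> X \<triangleleft> e)"
  show "?\<beta> \<in> hom C (X \<otimes> X) A" by (simp add: hom_def)
  let ?e = "Box e [] [Y, Y, A]"
  \<comment> \<open>The cups and \<open>e\<close> are all free of inputs, and \<open>nf\<close>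
    would apply the left ones first. This unguarded variant lets \<open>e\<close> and the caps be
    applied before cups on their left, until each cap stands next to the cup that it
    cancels.\<close>
  have late: "sl k \<gamma> (sl n \<beta> st) = sl n \<beta> (sl (k - length (bcod \<beta>)) \<gamma> st)"
    if "bdom \<beta> = []" "n + length (bcod \<beta>) \<le> k" for k \<gamma> n \<beta> st
    using exchange[of n \<beta> "k - length (bcod \<beta>)" \<gamma> st] that by simp
  have "run [(2, Dx), (3, Dx), (4, ?e), (1, Bx), (0, Bx)] (start []) = run [(0, ?e)] (start [])"
    by (simp add: late gin zigzag)
  from diagram_eq[OF this] show "e = coev2 ?\<beta>" by (simp add: coev2_def)
qed

lemma casimir_imp_central:
  assumes "casimir \<beta>" shows "central (coev2 \<beta>)"
proof -
  have h: "\<beta> \<in> hom C (X \<otimes> X) A" using assms by (simp add: casimir_def)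
  note [simp] = homD(1-3)[OF h] homD(1-3)[OF coev2_hom[OF h]]
  note c = casimir_rules[OF assms]
  note r = coev2_unfold[OF h] c c(1,3)[THEN M_under] c(2)[THEN M_under2]
  let ?e = "Box (coev2 \<beta>) [] [Y, Y, A]"
  \<comment> \<open>The two strands \<open>X\<close> come from the double transposition; the input
    \<open>Y, A\<close> is the arbitrary factor of \<open>YA\<close> with which the element has to
    commute.\<close>
  have 1: "run [(0, Dx), (1, Dx), (3, MS), (3, IS), (2, MS), (5, E), (4, ?e)] (start [X, X, Y, A]) =
    run [(0, Dx), (1, Dx), (3, MS), (3, IS), (4, MS), (3, E), (2, ?e)] (start [X, X, Y, A])"
    by (simp add: xnf r)
  have 2: "run [(0, Dx), (1, MS), (2, E), (1, ?e)] (start [X]) = run [(0, Dx), (1, US)] (start [X])"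
    by (simp add: xnf r)
  show ?thesis unfolding central_def
  proof (intro conjI)
    show "coev2 \<beta> \<in> hom C \<one> (Y \<otimes> Y \<otimes> A)" by (rule coev2_hom[OF h])
    show "tow \<cdot> (mS \<triangleright> Y \<otimes> A) \<cdot> (Y \<otimes> A \<triangleleft> (fow \<cdot> coev2 \<beta>)) = tow \<cdot> (Y \<otimes> A \<triangleleft> mS) \<cdot> ((fow \<cdot> coev2 \<beta>) \<triangleright> Y \<otimes> A)"
      by (rule double_transpose_inj[of _ "Y \<otimes> A" A])
        (use diagram_eq[OF 1] in \<open>simp_all add: hom_def\<close>)
    show "mS \<cdot> fow \<cdot> coev2 \<beta> = uS"
      by (rule transpose_inj[of _ \<one> A]) (use diagram_eq[OF 2] in \<open>simp_all add: hom_def\<close>)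
  qed
qed

text \<open>It is enough to test centrality on the two parts of \<open>YA\<close>. Inserting the
  image of \<open>A\<close> yields compatibility of the form with \<open>\<psi>\<close>; inserting a
  strand \<open>Y\<close> with the unit of \<open>A\<close> yields the Casimir identity.\<close>

lemma central_imp_casimir:
  assumes "central (coev2 \<beta>)" and h: "\<beta> \<in> hom C (X \<otimes> X) A"
  shows "casimir \<beta>"
proof -
  note [simp] = homD(1-3)[OF h] homD(1-3)[OF coev2_hom[OF h]]
  note r = coev2_unfold[OF h]
  let ?e = "Box (coev2 \<beta>) [] [Y, Y, A]" and ?B = "Box \<beta> [X, X] [A]"
  have eqs: "tow \<cdot> (mS \<triangleright> Y \<otimes> A) \<cdot> (Y \<otimes> A \<triangleleft> (fow \<cdot> coev2 \<beta>)) = tow \<cdot> (Y \<otimes> A \<triangleleft> mS) \<cdot> ((fow \<cdot> coev2 \<beta>) \<triangleright> Y \<otimes> A)"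
     "mS \<cdot> fow \<cdot> coev2 \<beta> = uS"
    using assms(1) unfolding central_def by auto
  have c: "sl 0 Dx (sl 1 Dx (run_from 2 [(1, MS), (1, IS), (0, MS), (3, E), (2, ?e)] (gds 2 [Y, A] st))) =
      sl 0 Dx (sl 1 Dx (run_from 2 [(1, MS), (1, IS), (2, MS), (1, E), (0, ?e)] (gds 2 [Y, A] st)))" for st
    using lift_eq[of "[(1, MS), (1, IS), (0, MS), (3, E), (2, ?e)]" "[Y, A]" "[(1, MS), (1, IS), (2, MS), (1, E), (0, ?e)]" 2 st] eqs(1)
    by simp
  have n: "sl 0 Dx (run_from 1 [(0, MS), (1, E), (0, ?e)] (gds 1 [] st)) = sl 0 Dx (run_from 1 [(0, US)] (gds 1 [] st))" for st
    using lift_eq[of "[(0, MS), (1, E), (0, ?e)]" "[]" "[(0, US)]" 1 st] eqs(2)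
    by simp
  have 1: "run [(0, M), (1, ?B), (0, P), (1, P)] (start [X, X, A]) = run [(0, M), (0, ?B)] (start [X, X, A])"
    using c[of "sl 2 IS (start [X, X, A])"] by (simp add: xnf r)
  \<comment> \<open>The \<open>Y\<close> end of the cup is the element being tested and its
    \<open>X\<close> end becomes the output strand; the box \<open>E\<close> completes the
    \<open>Y\<close> end to an input \<open>YA\<close>.\<close>
  have 2: "run [(0, M), (1, P), (2, ?B), (0, D)] (start [X, X]) = run [(0, M), (1, ?B), (0, P), (1, D)] (start [X, X])"
    using c[of "sl 3 E (sl 2 Bx (start [X, X]))"] by (simp add: xnf r)
  have 3: "run [(0, M), (1, ?B), (0, D)] (start [X]) = run [(0, Ep)] (start [X])"
    using n[of "start [X]"] by (simp add: xnf r)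
  show ?thesis unfolding casimir_def
    using diagram_eq[OF 1] diagram_eq[OF 2] diagram_eq[OF 3] h by simp
qed

lemma ex_casimir_iff_ex_central: "(\<exists>\<beta>. casimir \<beta>) \<longleftrightarrow> (\<exists>e. central e)"
proof
  show "\<exists>e. central e" if "\<exists>\<beta>. casimir \<beta>" using that casimir_imp_central by blast
  show "\<exists>\<beta>. casimir \<beta>" if "\<exists>e. central e"
  proof -
    from that obtain e where e: "central e" by blast
    then obtain \<beta> where "\<beta> \<in> hom C (X \<otimes> X) A" "e = coev2 \<beta>" by (auto simp: central_def elim: coev2_surj)
    then show ?thesis using e central_imp_casimir by blast
  qed
qed

end

section \<open>Coseparability and separability of the dual algebra\<close>

context strict_algebra
begin

abbreviation "Sob Y \<chi> \<equiv> sharp_T_ob C A m \<eta> (Y, \<chi>)"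

lemma SobD:
  assumes "Sob Y \<chi>"
  shows "Y \<in> objs C" "\<chi> \<in> arrs C" "source C \<chi> = A \<otimes> Y" "target C \<chi> = Y \<otimes> A"
    "sl n (Box \<chi> [A, Y] [Y, A]) (sl n M st) =
      sl (Suc n) M (sl n (Box \<chi> [A, Y] [Y, A]) (sl (Suc n) (Box \<chi> [A, Y] [Y, A]) st))"
    "sl n (Box \<chi> [A, Y] [Y, A]) (sl n E st) = gd n Y (sl (Suc n) E st)"
proof -
  have Y: "Y \<in> objs C" and h: "\<chi> \<in> hom C (A \<otimes> Y) (Y \<otimes> A)"
    and eqs: "\<chi> \<cdot> (m \<triangleright> Y) = (Y \<triangleleft> m) \<cdot> (\<chi> \<triangleright> A) \<cdot> (A \<triangleleft> \<chi>)" "\<chi> \<cdot> (\<eta> \<triangleright> Y) = Y \<triangleleft> \<eta>"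
    using assms unfolding sharp_T_ob_def by auto
  note [simp] = Y homD[OF h]
  show "Y \<in> objs C" "\<chi> \<in> arrs C" "source C \<chi> = A \<otimes> Y" "target C \<chi> = Y \<otimes> A" by simp_all
  let ?Q = "Box \<chi> [A, Y] [Y, A]"
  show "sl n ?Q (sl n M st) = sl (Suc n) M (sl n ?Q (sl (Suc n) ?Q st))"
    using lift_eq[of "[(0, ?Q), (0, M)]" "[A, A, Y]" "[(1, M), (0, ?Q), (1, ?Q)]" n st]
    by (simp add: eqs gout)
  show "sl n ?Q (sl n E st) = gd n Y (sl (Suc n) E st)"
    using lift_eq[of "[(0, ?Q), (0, E)]" "[Y]" "[(1, E)]" n st]
    by (simp add: eqs gout)
qed

definition Sarr :: "'o \<times> 'a \<Rightarrow> 'o \<times> 'a \<Rightarrow> 'a \<Rightarrow> bool" where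
  "Sarr P Q f \<longleftrightarrow> sharp_T_ob C A m \<eta> P \<and> sharp_T_ob C A m \<eta> Q \<and> f \<in> hom C (fst P) (fst Q \<otimes> A) \<and>
    (fst Q \<triangleleft> m) \<cdot> (f \<triangleright> A) \<cdot> snd P = (fst Q \<triangleleft> m) \<cdot> (snd Q \<triangleright> A) \<cdot> (A \<triangleleft> f)"

lemma SarrD:
  assumes "Sarr (X, \<phi>) (Y, \<chi>) f"
  shows "Sob X \<phi>" "Sob Y \<chi>" "f \<in> hom C X (Y \<otimes> A)" "f \<in> arrs C" "source C f = X" "target C f = Y \<otimes> A"
  using assms homD[of f X] unfolding Sarr_def by auto

lemma S_simps:
  "objs (sharp_T C A m \<eta>) = {P. sharp_T_ob C A m \<eta> P}"
  "source (sharp_T C A m \<eta>) (P, f, Q) = P"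
  "target (sharp_T C A m \<eta>) (P, f, Q) = Q"
  "ident (sharp_T C A m \<eta>) P = (P, fst P \<triangleleft> \<eta>, P)"
  "(Q', g, (Z, \<omega>)) \<cdot>\<^bsub>sharp_T C A m \<eta>\<^esub> (P, f, Q) = (P, (Z \<triangleleft> m) \<cdot> (g \<triangleright> A) \<cdot> f, (Z, \<omega>))"
  "\<one>\<^bsub>sharp_T C A m \<eta>\<^esub> = (\<one>, ident C A)"
  "P \<otimes>\<^bsub>sharp_T C A m \<eta>\<^esub> Q = sharp_T_tensor C P Q"
  "(P, f, (X', \<phi>')) \<boxtimes>\<^bsub>sharp_T C A m \<eta>\<^esub> (Q, g, (Y', \<chi>')) =
     (sharp_T_tensor C P Q, (X' \<otimes> Y' \<triangleleft> m) \<cdot> (X' \<triangleleft> \<chi>' \<triangleright> A) \<cdot> (f \<boxtimes> g),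
      sharp_T_tensor C (X', \<phi>') (Y', \<chi>'))"
  "associator (sharp_T C A m \<eta>) P Q R = ident (sharp_T C A m \<eta>) (sharp_T_tensor C P (sharp_T_tensor C Q R))"
  "left_unitor (sharp_T C A m \<eta>) P = ident (sharp_T C A m \<eta>) P"
  "right_unitor (sharp_T C A m \<eta>) P = ident (sharp_T C A m \<eta>) P"
  by (simp_all add: sharp_T_def sharp_T_id_def)

lemma S_arrs: "(P, f, Q) \<in> arrs (sharp_T C A m \<eta>) \<longleftrightarrow> Sarr P Q f"
  by (cases P; cases Q) (auto simp: sharp_T_def Sarr_def)

lemma S_hom: "F \<in> hom (sharp_T C A m \<eta>) P Q \<longleftrightarrow> (\<exists>f. F = (P, f, Q) \<and> Sarr P Q f)"
  by (cases F) (auto simp: hom_def S_simps S_arrs)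

lemma S_cmp_ident:
  assumes "f \<in> hom C X (Y \<otimes> A)" "Y \<in> objs C"
  shows "(Y \<triangleleft> m) \<cdot> (f \<triangleright> A) \<cdot> (X \<triangleleft> \<eta>) = f" "(Y \<triangleleft> m) \<cdot> ((Y \<triangleleft> \<eta>) \<triangleright> A) \<cdot> f = f"
proof -
  note [simp] = homD[OF assms(1)] assms(2)
  let ?F = "Box f [X] [Y, A]"
  have 1: "run [(1, M), (0, ?F), (1, E)] (start [X]) = run [(0, ?F)] (start [X])" by (simp add: anf)
  have 2: "run [(1, M), (1, E), (0, ?F)] (start [X]) = run [(0, ?F)] (start [X])" by (simp add: anf)
  from diagram_eq[OF 1] diagram_eq[OF 2]
  show "(Y \<triangleleft> m) \<cdot> (f \<triangleright> A) \<cdot> (X \<triangleleft> \<eta>) = f" "(Y \<triangleleft> m) \<cdot> ((Y \<triangleleft> \<eta>) \<triangleright> A) \<cdot> f = f"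
    by simp_all
qed

lemma Sarr_ident:
  assumes "Sob X \<chi>" shows "Sarr (X, \<chi>) (X, \<chi>) (X \<triangleleft> \<eta>)"
proof -
  note [simp] = SobD[OF assms]
  let ?Q = "Box \<chi> [A, X] [X, A]"
  have "run [(1, M), (1, E), (0, ?Q)] (start [A, X]) = run [(1, M), (0, ?Q), (2, E)] (start [A, X])"
    by (simp add: anf)
  from diagram_eq[OF this] assms show ?thesis
    by (auto simp: Sarr_def intro!: homI)
qed

text \<open>The definition of separability refers to the inverse of the associator, which here is an
  identity. Any inverse is forced to equal it by the neutrality laws
  \<open>S_cmp_ident\<close>.\<close>

lemma S_inverse_ident:
  assumes "Sob X \<chi>"
  shows "inverse_arr (sharp_T C A m \<eta>) (ident (sharp_T C A m \<eta>) (X, \<chi>)) = ident (sharp_T C A m \<eta>) (X, \<chi>)"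
  unfolding inverse_arr_def
proof (rule the_equality)
  note [simp] = SobD(1-4)[OF assms]
  show "is_inverse (sharp_T C A m \<eta>) (ident (sharp_T C A m \<eta>) (X, \<chi>)) (ident (sharp_T C A m \<eta>) (X, \<chi>))"
    using Sarr_ident[OF assms] S_cmp_ident[OF SarrD(3)[OF Sarr_ident[OF assms]]]
    by (simp add: is_inverse_def S_simps S_arrs S_hom)
  fix g assume g: "is_inverse (sharp_T C A m \<eta>) (ident (sharp_T C A m \<eta>) (X, \<chi>)) g"
  then obtain f where f: "g = ((X, \<chi>), f, (X, \<chi>))" "Sarr (X, \<chi>) (X, \<chi>) f"
    by (auto simp: is_inverse_def S_simps S_hom)
  show "g = ident (sharp_T C A m \<eta>) (X, \<chi>)"
    using g S_cmp_ident[OF SarrD(3)[OF f(2)]] by (simp add: f(1) is_inverse_def S_simps)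
qed

lemma S_whisker_right:
  assumes "f \<in> hom C X (X' \<otimes> A)" "X' \<in> objs C" "Sob Y \<chi>"
  shows "(P, f, (X', \<phi>')) \<triangleright>\<^bsub>sharp_T C A m \<eta>\<^esub> (Y, \<chi>) =
    (sharp_T_tensor C P (Y, \<chi>), (X' \<triangleleft> \<chi>) \<cdot> (f \<triangleright> Y), sharp_T_tensor C (X', \<phi>') (Y, \<chi>))"
proof -
  note [simp] = homD[OF assms(1)] assms(2) SobD[OF assms(3)]
  let ?F = "Box f [X] [X', A]" and ?Q = "Box \<chi> [A, Y] [Y, A]"
  have s: "f \<boxtimes> (Y \<triangleleft> \<eta>) = (f \<triangleright> Y \<otimes> A) \<cdot> (X \<triangleleft> (Y \<triangleleft> \<eta>))" by (rule tensor_split) (simp_all add: hom_def)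
  have "run [(2, M), (1, ?Q), (0, ?F), (2, E)] (start [X, Y]) = run [(1, ?Q), (0, ?F)] (start [X, Y])"
    by (simp add: anf)
  from diagram_eq[OF this] show ?thesis by (simp add: S_simps s)
qed

lemma S_whisker_left:
  assumes "g \<in> hom C Y (Y' \<otimes> A)" "X \<in> objs C" "Sob Y' \<chi>'"
  shows "(X, \<phi>) \<triangleleft>\<^bsub>sharp_T C A m \<eta>\<^esub> (Q, g, (Y', \<chi>')) =
    (sharp_T_tensor C (X, \<phi>) Q, X \<triangleleft> g, sharp_T_tensor C (X, \<phi>) (Y', \<chi>'))"
proof -
  note [simp] = homD[OF assms(1)] assms(2) SobD[OF assms(3)]
  let ?G = "Box g [Y] [Y', A]" and ?Q = "Box \<chi>' [A, Y'] [Y', A]"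
  have s: "(X \<triangleleft> \<eta>) \<boxtimes> g = ((X \<triangleleft> \<eta>) \<triangleright> Y' \<otimes> A) \<cdot> (X \<triangleleft> g)" by (rule tensor_split) (simp_all add: hom_def)
  have "run [(2, M), (1, ?Q), (1, E), (1, ?G)] (start [X, Y]) = run [(1, ?G)] (start [X, Y])"
    by (simp add: anf)
  from diagram_eq[OF this] show ?thesis by (simp add: S_simps s)
qed

lemma Sob_tensor:
  assumes "Sob X \<phi>" "Sob Y \<chi>"
  shows "Sob (X \<otimes> Y) ((X \<triangleleft> \<chi>) \<cdot> (\<phi> \<triangleright> Y))"
proof -
  note [simp] = SobD[OF assms(1)] SobD[OF assms(2)]
  let ?P = "Box \<phi> [A, X] [X, A]" and ?Q = "Box \<chi> [A, Y] [Y, A]"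
  have 1: "run [(1, ?Q), (0, ?P), (0, M)] (start [A, A, X, Y]) =
      run [(2, M), (1, ?Q), (0, ?P), (2, ?Q), (1, ?P)] (start [A, A, X, Y])"
    by (simp add: anf)
  have 2: "run [(1, ?Q), (0, ?P), (0, E)] (start [X, Y]) = run [(2, E)] (start [X, Y])"
    by (simp add: anf)
  from diagram_eq[OF 1] diagram_eq[OF 2] show ?thesis
    by (auto simp: sharp_T_ob_def intro!: homI)
qed

lemma Sob_unit: "Sob \<one> (ident C A)"
  by (simp add: sharp_T_ob_def hom_def)

text \<open>Writing out composition and whiskering reduces separability in \<open>sharp_T\<close> to
  equations in \<open>C\<close>. It is proved for arbitrary \<open>\<chi>\<close>,
  \<open>\<mu>\<close> and \<open>u\<close>, so that the formulas for the dual structures do not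
  enter this unfolding.\<close>

lemma S_separable_iff:
  fixes Y \<chi> \<mu> u
  defines "\<chi>2 \<equiv> (Y \<triangleleft> \<chi>) \<cdot> (\<chi> \<triangleright> Y)"
  assumes Y: "Sob Y \<chi>" and m: "Sarr (Y \<otimes> Y, \<chi>2) (Y, \<chi>) \<mu>" and u: "Sarr (\<one>, ident C A) (Y, \<chi>) u"
  shows "separable_algebra (sharp_T C A m \<eta>) (Y, \<chi>)
      (sharp_T_tensor C (Y, \<chi>) (Y, \<chi>), \<mu>, (Y, \<chi>)) ((\<one>, ident C A), u, (Y, \<chi>)) \<longleftrightarrow>
    (Y \<triangleleft> m) \<cdot> (\<mu> \<triangleright> A) \<cdot> (Y \<triangleleft> \<chi>) \<cdot> (\<mu> \<triangleright> Y) = (Y \<triangleleft> m) \<cdot> (\<mu> \<triangleright> A) \<cdot> (Y \<triangleleft> \<mu>) \<and>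
    (Y \<triangleleft> m) \<cdot> (\<mu> \<triangleright> A) \<cdot> (Y \<triangleleft> \<chi>) \<cdot> (u \<triangleright> Y) = Y \<triangleleft> \<eta> \<and>
    (Y \<triangleleft> m) \<cdot> (\<mu> \<triangleright> A) \<cdot> (Y \<triangleleft> u) = Y \<triangleleft> \<eta> \<and>
    (\<exists>\<sigma>. \<sigma> \<in> hom C Y (Y \<otimes> Y \<otimes> A) \<and>
      (Y \<otimes> Y \<triangleleft> m) \<cdot> (\<sigma> \<triangleright> A) \<cdot> \<chi> = (Y \<otimes> Y \<triangleleft> m) \<cdot> (\<chi>2 \<triangleright> A) \<cdot> (A \<triangleleft> \<sigma>) \<and>
      (Y \<triangleleft> m) \<cdot> (\<mu> \<triangleright> A) \<cdot> \<sigma> = Y \<triangleleft> \<eta> \<and>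
      (Y \<otimes> Y \<triangleleft> m) \<cdot> (\<sigma> \<triangleright> A) \<cdot> \<mu> = (Y \<otimes> Y \<triangleleft> m) \<cdot> (Y \<triangleleft> \<chi> \<triangleright> A) \<cdot> (\<mu> \<triangleright> Y \<otimes> A) \<cdot> (Y \<triangleleft> \<sigma>) \<and>
      (Y \<otimes> Y \<triangleleft> m) \<cdot> (\<sigma> \<triangleright> A) \<cdot> \<mu> = (Y \<otimes> Y \<triangleleft> m) \<cdot> (Y \<triangleleft> \<mu> \<triangleright> A) \<cdot> (Y \<otimes> Y \<triangleleft> \<chi>) \<cdot> (\<sigma> \<triangleright> Y))"
proof -
  let ?S = "sharp_T C A m \<eta>"
  note [simp] = SobD(1-4)[OF Y] SarrD(4-6)[OF m] SarrD(4-6)[OF u]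
  have tt: "sharp_T_tensor C (Y, \<chi>) (Y, \<chi>) = (Y \<otimes> Y, \<chi>2)" by (simp add: sharp_T_tensor_def \<chi>2_def)
  have ttt: "sharp_T_tensor C (Y, \<chi>) (Y \<otimes> Y, \<chi>2) = (Y \<otimes> Y \<otimes> Y, (Y \<triangleleft> \<chi>2) \<cdot> (\<chi> \<triangleright> Y \<otimes> Y))"
    "sharp_T_tensor C (Y \<otimes> Y, \<chi>2) (Y, \<chi>) = (Y \<otimes> Y \<otimes> Y, (Y \<triangleleft> \<chi>2) \<cdot> (\<chi> \<triangleright> Y \<otimes> Y))"
    "sharp_T_tensor C (\<one>, ident C A) (Y, \<chi>) = (Y, \<chi>)" "sharp_T_tensor C (Y, \<chi>) (\<one>, ident C A) = (Y, \<chi>)"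
    by (simp_all add: sharp_T_tensor_def \<chi>2_def)
  have Y2: "Sob (Y \<otimes> Y) \<chi>2" unfolding \<chi>2_def by (rule Sob_tensor[OF Y Y])
  have Y3: "Sob (Y \<otimes> Y \<otimes> Y) ((Y \<triangleleft> \<chi>2) \<cdot> (\<chi> \<triangleright> Y \<otimes> Y))" by (rule Sob_tensor[OF Y Y2])
  note w = S_whisker_right[OF SarrD(3)[OF m] SobD(1)[OF Y] Y] S_whisker_left[OF SarrD(3)[OF m] SobD(1)[OF Y] Y]
    S_whisker_right[OF SarrD(3)[OF u] SobD(1)[OF Y] Y] S_whisker_left[OF SarrD(3)[OF u] SobD(1)[OF Y] Y]
  let ?m = "((Y \<otimes> Y, \<chi>2), \<mu>, (Y, \<chi>))" and ?u = "((\<one>, ident C A), u, (Y, \<chi>))"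
  let ?E = "ident ?S (Y \<otimes> Y \<otimes> Y, (Y \<triangleleft> \<chi>2) \<cdot> (\<chi> \<triangleright> Y \<otimes> Y))"
  have ass: "associator ?S (Y, \<chi>) (Y, \<chi>) (Y, \<chi>) = ?E" "inverse_arr ?S ?E = ?E"
    using S_inverse_ident[OF Y3] by (simp_all add: S_simps(9) tt ttt)
  have ce: "(Q, f, (Z, \<omega>)) \<cdot>\<^bsub>?S\<^esub> ?E = ((Y \<otimes> Y \<otimes> Y, (Y \<triangleleft> \<chi>2) \<cdot> (\<chi> \<triangleright> Y \<otimes> Y)), f, (Z, \<omega>))"
    if "f \<in> hom C (Y \<otimes> Y \<otimes> Y) (Z \<otimes> A)" "Z \<in> objs C" for Q f Z \<omega>
    using S_cmp_ident(1)[OF that] by (simp add: S_simps)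
  have wm: "?m \<triangleright>\<^bsub>?S\<^esub> (Y, \<chi>) \<cdot>\<^bsub>?S\<^esub> ?E = ?m \<triangleright>\<^bsub>?S\<^esub> (Y, \<chi>)"
    "((Y, \<chi>) \<triangleleft>\<^bsub>?S\<^esub> ?m) \<cdot>\<^bsub>?S\<^esub> ?E = (Y, \<chi>) \<triangleleft>\<^bsub>?S\<^esub> ?m"
    unfolding w tt ttt by (rule ce; simp add: hom_def)+
  have wm2: "?m \<cdot>\<^bsub>?S\<^esub> ((Y, \<chi>) \<triangleleft>\<^bsub>?S\<^esub> ?m) \<cdot>\<^bsub>?S\<^esub> ?E = ?m \<cdot>\<^bsub>?S\<^esub> ((Y, \<chi>) \<triangleleft>\<^bsub>?S\<^esub> ?m)"
    unfolding w tt ttt S_simps(5) by (rule ce) (simp_all add: hom_def)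
  have alg: "algebra ?S (Y, \<chi>) ?m ?u \<longleftrightarrow>
    (Y \<triangleleft> m) \<cdot> (\<mu> \<triangleright> A) \<cdot> (Y \<triangleleft> \<chi>) \<cdot> (\<mu> \<triangleright> Y) = (Y \<triangleleft> m) \<cdot> (\<mu> \<triangleright> A) \<cdot> (Y \<triangleleft> \<mu>) \<and>
    (Y \<triangleleft> m) \<cdot> (\<mu> \<triangleright> A) \<cdot> (Y \<triangleleft> \<chi>) \<cdot> (u \<triangleright> Y) = Y \<triangleleft> \<eta> \<and>
    (Y \<triangleleft> m) \<cdot> (\<mu> \<triangleright> A) \<cdot> (Y \<triangleleft> u) = Y \<triangleleft> \<eta>"
    unfolding algebra_def ass wm2 unfolding w tt ttt S_simps(10,11)
    using Y m u by (simp add: S_simps S_hom tt ttt)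
  have sep: "(\<exists>\<sigma>. ?m \<cdot>\<^bsub>?S\<^esub> \<sigma> = ident ?S (Y, \<chi>) \<and>
        bilinear ?S (Y, \<chi>) ((Y, \<chi>), ?m, ?m)
          ((Y, \<chi>) \<otimes>\<^bsub>?S\<^esub> (Y, \<chi>), ?m \<triangleright>\<^bsub>?S\<^esub> (Y, \<chi>), (Y, \<chi>) \<triangleleft>\<^bsub>?S\<^esub> ?m) \<sigma>) \<longleftrightarrow>
    (\<exists>\<sigma>. \<sigma> \<in> hom C Y (Y \<otimes> Y \<otimes> A) \<and>
      (Y \<otimes> Y \<triangleleft> m) \<cdot> (\<sigma> \<triangleright> A) \<cdot> \<chi> = (Y \<otimes> Y \<triangleleft> m) \<cdot> (\<chi>2 \<triangleright> A) \<cdot> (A \<triangleleft> \<sigma>) \<and>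
      (Y \<triangleleft> m) \<cdot> (\<mu> \<triangleright> A) \<cdot> \<sigma> = Y \<triangleleft> \<eta> \<and>
      (Y \<otimes> Y \<triangleleft> m) \<cdot> (\<sigma> \<triangleright> A) \<cdot> \<mu> = (Y \<otimes> Y \<triangleleft> m) \<cdot> (Y \<triangleleft> \<chi> \<triangleright> A) \<cdot> (\<mu> \<triangleright> Y \<otimes> A) \<cdot> (Y \<triangleleft> \<sigma>) \<and>
      (Y \<otimes> Y \<triangleleft> m) \<cdot> (\<sigma> \<triangleright> A) \<cdot> \<mu> = (Y \<otimes> Y \<triangleleft> m) \<cdot> (Y \<triangleleft> \<mu> \<triangleright> A) \<cdot> (Y \<otimes> Y \<triangleleft> \<chi>) \<cdot> (\<sigma> \<triangleright> Y))"
    (is "(\<exists>\<sigma>. ?L \<sigma>) \<longleftrightarrow> (\<exists>\<sigma>. ?R \<sigma>)")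
  proof -
    have arr: "Sarr (Y, \<chi>) (Y \<otimes> Y, \<chi>2) s \<longleftrightarrow> s \<in> hom C Y (Y \<otimes> Y \<otimes> A) \<and>
      (Y \<otimes> Y \<triangleleft> m) \<cdot> (s \<triangleright> A) \<cdot> \<chi> = (Y \<otimes> Y \<triangleleft> m) \<cdot> (\<chi>2 \<triangleright> A) \<cdot> (A \<triangleleft> s)" for s
      using Y Y2 by (simp add: Sarr_def)
    have LR: "?L ((Y, \<chi>), s, (Y \<otimes> Y, \<chi>2)) \<longleftrightarrow> ?R s" if s: "s \<in> hom C Y (Y \<otimes> Y \<otimes> A)" for s
    proof -
      have s': "s \<in> hom C Y ((Y \<otimes> Y) \<otimes> A)" using s by simp
      note ws = S_whisker_right[OF s' SobD(1)[OF Y2] Y] S_whisker_left[OF s' SobD(1)[OF Y] Y2]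
      note [simp] = homD(1-3)[OF s]
      show ?thesis unfolding bilinear_def w ws S_simps(7) tt ttt
        using arr[of s] s by (simp add: S_simps S_hom tt ttt) blast
    qed
    have "\<exists>s. \<sigma> = ((Y, \<chi>), s, (Y \<otimes> Y, \<chi>2)) \<and> s \<in> hom C Y (Y \<otimes> Y \<otimes> A)" if "?L \<sigma>" for \<sigma>
    proof -
      have "\<sigma> \<in> hom ?S (Y, \<chi>) (Y \<otimes> Y, \<chi>2)" using that by (simp add: bilinear_def S_simps(7) tt)
      then show ?thesis using arr by (auto simp: S_hom)
    qed
    then show ?thesis using LR by blast
  qed
  show ?thesis unfolding separable_algebra_def tt ass wm alg sep by blast
qed

end

context cow
begin

text \<open>Here the retraction is kept whole instead of being reduced to a Casimir form, because
  its mate has the type of a section of \<open>mY\<close>.\<close>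

definition coseparator :: "'a \<Rightarrow> bool" where
  "coseparator \<pi> \<longleftrightarrow> \<pi> \<in> hom C (X \<otimes> X) (A \<otimes> X) \<and>
    (m \<triangleright> X) \<cdot> (A \<triangleleft> \<pi>) \<cdot> \<psi>2 = (m \<triangleright> X) \<cdot> (A \<triangleleft> \<psi>) \<cdot> (\<pi> \<triangleright> A) \<and>
    (m \<triangleright> X) \<cdot> (A \<triangleleft> \<pi>) \<cdot> \<delta> = \<eta> \<triangleright> X \<and>
    (m \<triangleright> X \<otimes> X) \<cdot> (A \<triangleleft> \<delta>) \<cdot> \<pi> = (m \<triangleright> X \<otimes> X) \<cdot> (A \<triangleleft> \<psi> \<triangleright> X) \<cdot> (A \<otimes> X \<triangleleft> \<pi>) \<cdot> (\<delta> \<triangleright> X) \<and>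
    (m \<triangleright> X \<otimes> X) \<cdot> (A \<triangleleft> \<delta>) \<cdot> \<pi> = (m \<triangleright> X \<otimes> X) \<cdot> (A \<triangleleft> \<pi> \<triangleright> X) \<cdot> (\<psi> \<triangleright> X \<otimes> X) \<cdot> (X \<triangleleft> \<delta>)"

lemma coseparable_iff_ex_coseparator:
  "coseparable_coalgebra (T_sharp C A m \<eta>) (X, \<psi>) (cow_comult C X \<psi> \<delta>) (cow_counit C A X \<psi> \<epsilon>) \<longleftrightarrow>
    (\<exists>\<pi>. coseparator \<pi>)"
proof -
  let ?T = "T_sharp C A m \<eta>"
  interpret T: strict_monoidal_category ?T by (rule T_sharp_strict_monoidal)
  interpret T: diagrams ?T ..
  have co: "coalgebra ?T (X, \<psi>) (cow_comult C X \<psi> \<delta>) (cow_counit C A X \<psi> \<epsilon>)"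
    using cow by (simp add: cowreath_def)
  have *: "(X, \<psi>) \<otimes>\<^bsub>?T\<^esub> (X, \<psi>) = (X \<otimes> X, \<psi>2)" by (simp add: T_simps)
  have arr: "Tarr (X \<otimes> X, \<psi>2) (X, \<psi>) \<pi> \<longleftrightarrow> \<pi> \<in> hom C (X \<otimes> X) (A \<otimes> X) \<and>
      (m \<triangleright> X) \<cdot> (A \<triangleleft> \<pi>) \<cdot> \<psi>2 = (m \<triangleright> X) \<cdot> (A \<triangleleft> \<psi>) \<cdot> (\<pi> \<triangleright> A)" for \<pi>
    using Tob_tensor[OF cow_arrs(1,1)] cow_arrs(1) by (auto simp: Tarr_def)
  have hom: "\<pi>' \<in> hom ?T (X \<otimes> X, \<psi>2) (X, \<psi>) \<longleftrightarrow>
      (\<exists>\<pi>. \<pi>' = ((X \<otimes> X, \<psi>2), \<pi>, (X, \<psi>)) \<and> Tarr (X \<otimes> X, \<psi>2) (X, \<psi>) \<pi>)" for \<pi>'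
    by (simp add: T_hom)
  let ?d = "cow_comult C X \<psi> \<delta>"
  have eqs: "(let p = ((X \<otimes> X, \<psi>2), \<pi>, (X, \<psi>)) in
      p \<cdot>\<^bsub>?T\<^esub> ?d = ident ?T (X, \<psi>) \<and>
      ?d \<cdot>\<^bsub>?T\<^esub> p = ((X, \<psi>) \<triangleleft>\<^bsub>?T\<^esub> p) \<cdot>\<^bsub>?T\<^esub> (?d \<triangleright>\<^bsub>?T\<^esub> (X, \<psi>)) \<and>
      ?d \<cdot>\<^bsub>?T\<^esub> p = (p \<triangleright>\<^bsub>?T\<^esub> (X, \<psi>)) \<cdot>\<^bsub>?T\<^esub> ((X, \<psi>) \<triangleleft>\<^bsub>?T\<^esub> ?d)) \<longleftrightarrow> coseparator \<pi>"
    if \<pi>: "Tarr (X \<otimes> X, \<psi>2) (X, \<psi>) \<pi>" for \<pi>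
  proof -
    have h: "\<pi> \<in> hom C (X \<otimes> X) (A \<otimes> X)" using \<pi> arr by blast
    show ?thesis
      using \<pi>[unfolded arr] homD(1-3)[OF h]
      unfolding Let_def cow_eq whiskers T_whisker_right[OF \<pi> cow_arrs(1)] T_whisker_left[OF cow_arrs(1) \<pi>] coseparator_def
      by (simp add: T_simps T_sharp_tensor_def)
  qed
  have "coseparator \<pi> \<Longrightarrow> Tarr (X \<otimes> X, \<psi>2) (X, \<psi>) \<pi>" for \<pi>
    unfolding arr coseparator_def by blast
  then show ?thesis
    unfolding T.coseparable_iff * using co hom eqs unfolding Let_def by (metis (no_types, lifting))
qed

end

section \<open>The dual algebra; retractions and sections as mates\<close>

context cowd
begin

lemma Sob_dual: "Sob Y \<phi>"
proof -
  have 1: "run [(0, Dx), (1, Ph), (1, M)] (start [X, A, A, Y]) =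
      run [(0, Dx), (2, M), (1, Ph), (2, Ph)] (start [X, A, A, Y])"
    by (simp add: xnf)
  have 2: "run [(0, Dx), (1, Ph), (1, E)] (start [X, Y]) = run [(0, Dx), (2, E)] (start [X, Y])"
    by (simp add: xnf)
  have "\<phi> \<cdot> (m \<triangleright> Y) = (Y \<triangleleft> m) \<cdot> (\<phi> \<triangleright> A) \<cdot> (A \<triangleleft> \<phi>)"
    by (rule transpose_inj[of _ "A \<otimes> A \<otimes> Y" A]) (use diagram_eq[OF 1] in \<open>simp_all add: hom_def\<close>)
  moreover have "\<phi> \<cdot> (\<eta> \<triangleright> Y) = Y \<triangleleft> \<eta>"
    by (rule transpose_inj[of _ Y A]) (use diagram_eq[OF 2] in \<open>simp_all add: hom_def\<close>)
  ultimately show ?thesis by (simp add: sharp_T_ob_def hom_def)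
qed

abbreviation "\<phi>2 \<equiv> (Y \<triangleleft> \<phi>) \<cdot> (\<phi> \<triangleright> Y)"

lemma Sarr_mY: "Sarr (Y \<otimes> Y, \<phi>2) (Y, \<phi>) mY"
proof -
  have 1: "run [(0, Dx), (2, M), (1, MY), (2, Ph), (1, Ph)] (start [X, A, Y, Y]) =
      run [(0, Dx), (2, M), (1, Ph), (2, MY)] (start [X, A, Y, Y])"
    by (simp add: xnf)
  have "(Y \<triangleleft> m) \<cdot> (mY \<triangleright> A) \<cdot> \<phi>2 = (Y \<triangleleft> m) \<cdot> (\<phi> \<triangleright> A) \<cdot> (A \<triangleleft> mY)"
    by (rule transpose_inj[of _ "A \<otimes> Y \<otimes> Y" A]) (use diagram_eq[OF 1] in \<open>simp_all add: hom_def\<close>)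
  then show ?thesis using Sob_tensor[OF Sob_dual Sob_dual] Sob_dual by (simp add: Sarr_def hom_def)
qed

lemma Sarr_uS: "Sarr (\<one>, ident C A) (Y, \<phi>) uS"
proof -
  have 1: "run [(0, Dx), (2, M), (1, US)] (start [X, A]) =
      run [(0, Dx), (2, M), (1, Ph), (2, US)] (start [X, A])"
    by (simp add: xnf)
  have "(Y \<triangleleft> m) \<cdot> (uS \<triangleright> A) \<cdot> ident C A = (Y \<triangleleft> m) \<cdot> (\<phi> \<triangleright> A) \<cdot> (A \<triangleleft> uS)"
    by (rule transpose_inj[of _ A A]) (use diagram_eq[OF 1] in \<open>simp_all add: hom_def\<close>)
  then show ?thesis using Sob_unit Sob_dual by (simp add: Sarr_def hom_def)
qed

lemma dual_algebra:
  "(Y \<triangleleft> m) \<cdot> (mY \<triangleright> A) \<cdot> (Y \<triangleleft> \<phi>) \<cdot> (mY \<triangleright> Y) = (Y \<triangleleft> m) \<cdot> (mY \<triangleright> A) \<cdot> (Y \<triangleleft> mY)"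
  "(Y \<triangleleft> m) \<cdot> (mY \<triangleright> A) \<cdot> (Y \<triangleleft> \<phi>) \<cdot> (uS \<triangleright> Y) = Y \<triangleleft> \<eta>"
  "(Y \<triangleleft> m) \<cdot> (mY \<triangleright> A) \<cdot> (Y \<triangleleft> uS) = Y \<triangleleft> \<eta>"
proof -
  have 1: "run [(0, Dx), (2, M), (1, MY), (2, Ph), (1, MY)] (start [X, Y, Y, Y]) =
      run [(0, Dx), (2, M), (1, MY), (2, MY)] (start [X, Y, Y, Y])"
    by (simp add: xnf)
  have 2: "run [(0, Dx), (2, M), (1, MY), (2, Ph), (1, US)] (start [X, Y]) = run [(0, Dx), (2, E)] (start [X, Y])"
    by (simp add: xnf)
  have 3: "run [(0, Dx), (2, M), (1, MY), (2, US)] (start [X, Y]) = run [(0, Dx), (2, E)] (start [X, Y])"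
    by (simp add: xnf)
  show "(Y \<triangleleft> m) \<cdot> (mY \<triangleright> A) \<cdot> (Y \<triangleleft> \<phi>) \<cdot> (mY \<triangleright> Y) = (Y \<triangleleft> m) \<cdot> (mY \<triangleright> A) \<cdot> (Y \<triangleleft> mY)"
    by (rule transpose_inj[of _ "Y \<otimes> Y \<otimes> Y" A]) (use diagram_eq[OF 1] in \<open>simp_all add: hom_def\<close>)
  show "(Y \<triangleleft> m) \<cdot> (mY \<triangleright> A) \<cdot> (Y \<triangleleft> \<phi>) \<cdot> (uS \<triangleright> Y) = Y \<triangleleft> \<eta>"
    by (rule transpose_inj[of _ Y A]) (use diagram_eq[OF 2] in \<open>simp_all add: hom_def\<close>)
  show "(Y \<triangleleft> m) \<cdot> (mY \<triangleright> A) \<cdot> (Y \<triangleleft> uS) = Y \<triangleleft> \<eta>"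
    by (rule transpose_inj[of _ Y A]) (use diagram_eq[OF 3] in \<open>simp_all add: hom_def\<close>)
qed

definition separator :: "'a \<Rightarrow> bool" where
  "separator \<sigma> \<longleftrightarrow> \<sigma> \<in> hom C Y (Y \<otimes> Y \<otimes> A) \<and>
      (Y \<otimes> Y \<triangleleft> m) \<cdot> (\<sigma> \<triangleright> A) \<cdot> \<phi> = (Y \<otimes> Y \<triangleleft> m) \<cdot> (\<phi>2 \<triangleright> A) \<cdot> (A \<triangleleft> \<sigma>) \<and>
      (Y \<triangleleft> m) \<cdot> (mY \<triangleright> A) \<cdot> \<sigma> = Y \<triangleleft> \<eta> \<and>
      (Y \<otimes> Y \<triangleleft> m) \<cdot> (\<sigma> \<triangleright> A) \<cdot> mY = (Y \<otimes> Y \<triangleleft> m) \<cdot> (Y \<triangleleft> \<phi> \<triangleright> A) \<cdot> (mY \<triangleright> Y \<otimes> A) \<cdot> (Y \<triangleleft> \<sigma>) \<and>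
      (Y \<otimes> Y \<triangleleft> m) \<cdot> (\<sigma> \<triangleright> A) \<cdot> mY = (Y \<otimes> Y \<triangleleft> m) \<cdot> (Y \<triangleleft> mY \<triangleright> A) \<cdot> (Y \<otimes> Y \<triangleleft> \<phi>) \<cdot> (\<sigma> \<triangleright> Y)"

lemma separable_iff_ex_separator:
  "separable_algebra (sharp_T C A m \<eta>) (Y, \<phi>)
      (sharp_T_tensor C (Y, \<phi>) (Y, \<phi>), mY, (Y, \<phi>)) ((\<one>, ident C A), dual_unit C Y \<epsilon> b, (Y, \<phi>)) \<longleftrightarrow>
    (\<exists>\<sigma>. separator \<sigma>)"
  using S_separable_iff[OF Sob_dual Sarr_mY Sarr_uS] dual_algebra
  unfolding separator_def wreath_unit_def dual_unit_def by blast

text \<open>The inputs \<open>XX\<close> become the outputs \<open>YY\<close> through nested cups,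
  and the output \<open>X\<close> becomes the input \<open>Y\<close> through a cap; the strand
  \<open>A\<close> stays where it is.\<close>

definition mate :: "'a \<Rightarrow> 'a" where
  "mate \<pi> = (Y \<otimes> Y \<otimes> A \<triangleleft> d) \<cdot> (Y \<otimes> Y \<triangleleft> \<pi> \<triangleright> Y) \<cdot> (Y \<triangleleft> b \<triangleright> X \<otimes> Y) \<cdot> (b \<triangleright> Y)"

lemma mate_unfold:
  assumes "\<pi> \<in> hom C (X \<otimes> X) (A \<otimes> X)"
  shows "sl n (Box (mate \<pi>) [Y] [Y, Y, A]) st =
    sl (Suc (Suc (Suc n))) Dx (sl (Suc (Suc n)) (Box \<pi> [X, X] [A, X]) (sl (Suc n) Bx (sl n Bx st)))"
proof -
  note [simp] = homD(1-3)[OF assms]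
  show ?thesis
    using lift_eq[of "[(0, Box (mate \<pi>) [Y] [Y, Y, A])]" "[Y]" "[(3, Dx), (2, Box \<pi> [X, X] [A, X]), (1, Bx), (0, Bx)]" n st]
    by (simp add: mate_def gout)
qed

lemma mate_hom:
  assumes "\<pi> \<in> hom C (X \<otimes> X) (A \<otimes> X)" shows "mate \<pi> \<in> hom C Y (Y \<otimes> Y \<otimes> A)"
  using homD[OF assms] by (simp add: hom_def mate_def)

lemma mate_surj:
  assumes "\<sigma> \<in> hom C Y (Y \<otimes> Y \<otimes> A)"
  obtains \<pi> where "\<pi> \<in> hom C (X \<otimes> X) (A \<otimes> X)" "\<sigma> = mate \<pi>"
proof
  note [simp] = homD(1-3)[OF assms]
  let ?\<pi> = "(d \<triangleright> A \<otimes> X) \<cdot> (X \<triangleleft> d \<triangleright> Y \<otimes> A \<otimes> X) \<cdot> (X \<otimes> X \<triangleleft> \<sigma> \<triangleright> X) \<cdot> (X \<otimes> X \<triangleleft> b)"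
  show "?\<pi> \<in> hom C (X \<otimes> X) (A \<otimes> X)" by (simp add: hom_def)
  let ?S = "Box \<sigma> [Y] [Y, Y, A]"
  \<comment> \<open>Cups have to be delayed past every box on their right, and by \<open>cap\<close>
    the caps have to be applied earlier than boxes on their left. Each cap then reaches its
    cup.\<close>
  have late: "sl k \<gamma> (sl n \<beta> st) = sl n \<beta> (sl (k - length (bcod \<beta>)) \<gamma> st)"
    if "bdom \<beta> = []" "n + length (bcod \<beta>) \<le> k" for k \<gamma> n \<beta> st
    using exchange[of n \<beta> "k - length (bcod \<beta>)" \<gamma> st] that by simp
  have cap: "sl k \<gamma> (sl n \<beta> st) = sl n \<beta> (sl (k - length (bcod \<beta>) + length (bdom \<beta>)) \<gamma> st)"
    if "bcod \<gamma> = []" "bdom \<beta> \<noteq> []" "n + length (bcod \<beta>) \<le> k" for k \<gamma> n \<beta> st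
    using exchange[of n \<beta> "k - length (bcod \<beta>) + length (bdom \<beta>)" \<gamma> st] that by simp
  have "run [(3, Dx), (2, Dx), (3, Dx), (4, ?S), (4, Bx), (1, Bx), (0, Bx)] (start [Y]) = run [(0, ?S)] (start [Y])"
    by (simp add: late cap gin zigzag)
  from diagram_eq[OF this] show "\<sigma> = mate ?\<pi>" by (simp add: mate_def)
qed

text \<open>The two colinearity laws share one side. Both are oriented towards the expression with
  \<open>\<pi>\<close> applied after a comultiplication of the first factor, so that all three
  expressions have one normal form.\<close>

lemma coseparator_rules:
  assumes "coseparator \<pi>"
  defines "Pi \<equiv> Box \<pi> [X, X] [A, X]"
  shows "sl n M (sl (Suc n) Pi (sl n P (sl (Suc n) P st))) = sl n M (sl (Suc n) P (sl n Pi st))"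
    "sl n M (sl (Suc n) Pi (sl n D st)) = sl n E (gd n X st)"
    "sl n M (sl (Suc n) D (sl n Pi st)) = sl n M (sl (Suc n) P (sl (Suc (Suc n)) Pi (sl n D st)))"
    "sl n M (sl (Suc n) Pi (sl n P (sl (Suc n) D st))) = sl n M (sl (Suc n) P (sl (Suc (Suc n)) Pi (sl n D st)))"
proof -
  have h: "\<pi> \<in> hom C (X \<otimes> X) (A \<otimes> X)" and eqs:
    "(m \<triangleright> X) \<cdot> (A \<triangleleft> \<pi>) \<cdot> \<psi>2 = (m \<triangleright> X) \<cdot> (A \<triangleleft> \<psi>) \<cdot> (\<pi> \<triangleright> A)"
    "(m \<triangleright> X) \<cdot> (A \<triangleleft> \<pi>) \<cdot> \<delta> = \<eta> \<triangleright> X"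
    "(m \<triangleright> X \<otimes> X) \<cdot> (A \<triangleleft> \<delta>) \<cdot> \<pi> = (m \<triangleright> X \<otimes> X) \<cdot> (A \<triangleleft> \<psi> \<triangleright> X) \<cdot> (A \<otimes> X \<triangleleft> \<pi>) \<cdot> (\<delta> \<triangleright> X)"
    "(m \<triangleright> X \<otimes> X) \<cdot> (A \<triangleleft> \<delta>) \<cdot> \<pi> = (m \<triangleright> X \<otimes> X) \<cdot> (A \<triangleleft> \<pi> \<triangleright> X) \<cdot> (\<psi> \<triangleright> X \<otimes> X) \<cdot> (X \<triangleleft> \<delta>)"
    using assms(1) unfolding coseparator_def by auto
  note [simp] = homD(1-3)[OF h]
  show "sl n M (sl (Suc n) Pi (sl n P (sl (Suc n) P st))) = sl n M (sl (Suc n) P (sl n Pi st))"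
    using lift_eq[of "[(0, M), (1, Pi), (0, P), (1, P)]" "[X, X, A]" "[(0, M), (1, P), (0, Pi)]" n st] eqs(1)
    by (simp add: gout Pi_def)
  show "sl n M (sl (Suc n) Pi (sl n D st)) = sl n E (gd n X st)"
    using lift_eq[of "[(0, M), (1, Pi), (0, D)]" "[X]" "[(0, E)]" n st] eqs(2)
    by (simp add: gout Pi_def)
  show "sl n M (sl (Suc n) D (sl n Pi st)) = sl n M (sl (Suc n) P (sl (Suc (Suc n)) Pi (sl n D st)))"
    using lift_eq[of "[(0, M), (1, D), (0, Pi)]" "[X, X]" "[(0, M), (1, P), (2, Pi), (0, D)]" n st] eqs(3)
    by (simp add: gout Pi_def)
  show "sl n M (sl (Suc n) Pi (sl n P (sl (Suc n) D st))) = sl n M (sl (Suc n) P (sl (Suc (Suc n)) Pi (sl n D st)))"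
    using lift_eq[of "[(0, M), (1, Pi), (0, P), (1, D)]" "[X, X]" "[(0, M), (1, P), (2, Pi), (0, D)]" n st] eqs(3,4)
    by (simp add: gout Pi_def)
qed

lemma coseparator_imp_separator:
  assumes "coseparator \<pi>" shows "separator (mate \<pi>)"
proof -
  have h: "\<pi> \<in> hom C (X \<otimes> X) (A \<otimes> X)" using assms by (simp add: coseparator_def)
  note [simp] = homD(1-3)[OF h] homD(1-3)[OF mate_hom[OF h]]
  note c = coseparator_rules[OF assms]
  note r = mate_unfold[OF h] c c[THEN M_under]
  let ?s = "Box (mate \<pi>) [Y] [Y, Y, A]"
  have 1: "run [(0, Dx), (1, Dx), (4, M), (2, ?s), (2, Ph)] (start [X, X, A, Y]) =
      run [(0, Dx), (1, Dx), (4, M), (3, Ph), (2, Ph), (3, ?s)] (start [X, X, A, Y])"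
    by (simp add: xnf r)
  have 2: "run [(0, Dx), (2, M), (1, MY), (1, ?s)] (start [X, Y]) = run [(0, Dx), (2, E)] (start [X, Y])"
    by (simp add: xnf r)
  have 3: "run [(0, Dx), (1, Dx), (4, M), (2, ?s), (2, MY)] (start [X, X, Y, Y]) =
      run [(0, Dx), (1, Dx), (4, M), (3, Ph), (2, MY), (3, ?s)] (start [X, X, Y, Y])"
    by (simp add: xnf r)
  have 4: "run [(0, Dx), (1, Dx), (4, M), (2, ?s), (2, MY)] (start [X, X, Y, Y]) =
      run [(0, Dx), (1, Dx), (4, M), (3, MY), (4, Ph), (2, ?s)] (start [X, X, Y, Y])"
    by (simp add: xnf r)
  show ?thesis unfolding separator_def
  proof (intro conjI)
    show "mate \<pi> \<in> hom C Y (Y \<otimes> Y \<otimes> A)" by (rule mate_hom[OF h])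
    show "(Y \<otimes> Y \<triangleleft> m) \<cdot> (mate \<pi> \<triangleright> A) \<cdot> \<phi> = (Y \<otimes> Y \<triangleleft> m) \<cdot> (\<phi>2 \<triangleright> A) \<cdot> (A \<triangleleft> mate \<pi>)"
      by (rule double_transpose_inj[of _ "A \<otimes> Y" A])
        (use diagram_eq[OF 1] in \<open>simp_all add: hom_def\<close>)
    show "(Y \<triangleleft> m) \<cdot> (mY \<triangleright> A) \<cdot> mate \<pi> = Y \<triangleleft> \<eta>"
      by (rule transpose_inj[of _ Y A])
        (use diagram_eq[OF 2] in \<open>simp_all add: hom_def\<close>)
    show "(Y \<otimes> Y \<triangleleft> m) \<cdot> (mate \<pi> \<triangleright> A) \<cdot> mY = (Y \<otimes> Y \<triangleleft> m) \<cdot> (Y \<triangleleft> \<phi> \<triangleright> A) \<cdot> (mY \<triangleright> Y \<otimes> A) \<cdot> (Y \<triangleleft> mate \<pi>)"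
      by (rule double_transpose_inj[of _ "Y \<otimes> Y" A])
        (use diagram_eq[OF 3] in \<open>simp_all add: hom_def\<close>)
    show "(Y \<otimes> Y \<triangleleft> m) \<cdot> (mate \<pi> \<triangleright> A) \<cdot> mY = (Y \<otimes> Y \<triangleleft> m) \<cdot> (Y \<triangleleft> mY \<triangleright> A) \<cdot> (Y \<otimes> Y \<triangleleft> \<phi>) \<cdot> (mate \<pi> \<triangleright> Y)"
      by (rule double_transpose_inj[of _ "Y \<otimes> Y" A])
        (use diagram_eq[OF 4] in \<open>simp_all add: hom_def\<close>)
  qed
qed

lemma separator_imp_coseparator:
  assumes "separator (mate \<pi>)" and h: "\<pi> \<in> hom C (X \<otimes> X) (A \<otimes> X)"
  shows "coseparator \<pi>"
proof -
  note [simp] = homD(1-3)[OF h] homD(1-3)[OF mate_hom[OF h]]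
  note r = mate_unfold[OF h]
  let ?s = "Box (mate \<pi>) [Y] [Y, Y, A]" and ?p = "Box \<pi> [X, X] [A, X]"
  have eqs: "(Y \<otimes> Y \<triangleleft> m) \<cdot> (mate \<pi> \<triangleright> A) \<cdot> \<phi> = (Y \<otimes> Y \<triangleleft> m) \<cdot> (\<phi>2 \<triangleright> A) \<cdot> (A \<triangleleft> mate \<pi>)"
    "(Y \<triangleleft> m) \<cdot> (mY \<triangleright> A) \<cdot> mate \<pi> = Y \<triangleleft> \<eta>"
    "(Y \<otimes> Y \<triangleleft> m) \<cdot> (mate \<pi> \<triangleright> A) \<cdot> mY = (Y \<otimes> Y \<triangleleft> m) \<cdot> (Y \<triangleleft> \<phi> \<triangleright> A) \<cdot> (mY \<triangleright> Y \<otimes> A) \<cdot> (Y \<triangleleft> mate \<pi>)"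
    "(Y \<otimes> Y \<triangleleft> m) \<cdot> (mate \<pi> \<triangleright> A) \<cdot> mY = (Y \<otimes> Y \<triangleleft> m) \<cdot> (Y \<triangleleft> mY \<triangleright> A) \<cdot> (Y \<otimes> Y \<triangleleft> \<phi>) \<cdot> (mate \<pi> \<triangleright> Y)"
    using assms(1) unfolding separator_def by blast+
  have 1: "sl 0 Dx (sl 1 Dx (run_from 2 [(2, M), (0, ?s), (0, Ph)] (gds 2 [A, Y] st))) =
      sl 0 Dx (sl 1 Dx (run_from 2 [(2, M), (1, Ph), (0, Ph), (1, ?s)] (gds 2 [A, Y] st)))" for st
    using lift_eq[of "[(2, M), (0, ?s), (0, Ph)]" "[A, Y]" "[(2, M), (1, Ph), (0, Ph), (1, ?s)]" 2 st] eqs(1)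
    by simp
  have 2: "sl 0 Dx (run_from 1 [(1, M), (0, MY), (0, ?s)] (gds 1 [Y] st)) = sl 0 Dx (run_from 1 [(1, E)] (gds 1 [Y] st))" for st
    using lift_eq[of "[(1, M), (0, MY), (0, ?s)]" "[Y]" "[(1, E)]" 1 st] eqs(2)
    by simp
  have 3: "sl 0 Dx (sl 1 Dx (run_from 2 [(2, M), (0, ?s), (0, MY)] (gds 2 [Y, Y] st))) =
      sl 0 Dx (sl 1 Dx (run_from 2 [(2, M), (1, Ph), (0, MY), (1, ?s)] (gds 2 [Y, Y] st)))" for st
    using lift_eq[of "[(2, M), (0, ?s), (0, MY)]" "[Y, Y]" "[(2, M), (1, Ph), (0, MY), (1, ?s)]" 2 st] eqs(3)
    by simp
  have 4: "sl 0 Dx (sl 1 Dx (run_from 2 [(2, M), (0, ?s), (0, MY)] (gds 2 [Y, Y] st))) =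
      sl 0 Dx (sl 1 Dx (run_from 2 [(2, M), (1, MY), (2, Ph), (0, ?s)] (gds 2 [Y, Y] st)))" for st
    using lift_eq[of "[(2, M), (0, ?s), (0, MY)]" "[Y, Y]" "[(2, M), (1, MY), (2, Ph), (0, ?s)]" 2 st] eqs(4)
    by simp
  \<comment> \<open>In this and the following equations every cup feeds its \<open>Y\<close> end to
    the given law and leaves its \<open>X\<close> end as an output, which bends an input
    \<open>Y\<close> of the law back to an output \<open>X\<close>.\<close>
  have a: "run [(0, M), (1, ?p), (0, P), (1, P)] (start [X, X, A]) = run [(0, M), (1, P), (0, ?p)] (start [X, X, A])"
    using 1[of "sl 3 Bx (start [X, X, A])"] by (simp add: xnf r)
  have b: "run [(0, M), (1, ?p), (0, D)] (start [X]) = run [(0, E)] (start [X])"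
    using 2[of "sl 1 Bx (start [X])"] by (simp add: xnf r)
  \<comment> \<open>Nested cups reverse the order of the factors. Left linearity of the section
    therefore turns into right colinearity of \<open>\<pi>\<close>, and in \<open>d\<close> right
    linearity turns into left colinearity.\<close>
  have c: "run [(0, M), (1, D), (0, ?p)] (start [X, X]) = run [(0, M), (1, ?p), (0, P), (1, D)] (start [X, X])"
    using 3[of "sl 3 Bx (sl 2 Bx (start [X, X]))"] by (simp add: xnf r)
  have d: "run [(0, M), (1, D), (0, ?p)] (start [X, X]) = run [(0, M), (1, P), (2, ?p), (0, D)] (start [X, X])"
    using 4[of "sl 3 Bx (sl 2 Bx (start [X, X]))"] by (simp add: xnf r)
  show ?thesis unfolding coseparator_def
    using diagram_eq[OF a] diagram_eq[OF b] diagram_eq[OF c] diagram_eq[OF d] h by simp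
qed

lemma ex_coseparator_iff_ex_separator: "(\<exists>\<pi>. coseparator \<pi>) \<longleftrightarrow> (\<exists>\<sigma>. separator \<sigma>)"
proof
  show "\<exists>\<sigma>. separator \<sigma>" if "\<exists>\<pi>. coseparator \<pi>" using that coseparator_imp_separator by blast
  show "\<exists>\<pi>. coseparator \<pi>" if "\<exists>\<sigma>. separator \<sigma>"
  proof -
    from that obtain \<sigma> where s: "separator \<sigma>" by blast
    then obtain \<pi> where "\<pi> \<in> hom C (X \<otimes> X) (A \<otimes> X)" "\<sigma> = mate \<pi>" by (auto simp: separator_def elim: mate_surj)
    then show ?thesis using s separator_imp_coseparator by blast
  qed
qed

end

section \<open>Tensor products over \<open>A\<close> and bimodules\<close>

context diagrams
begin

definition epi :: "'a \<Rightarrow> bool" where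
  "epi q \<longleftrightarrow> q \<in> arrs C \<and> (\<forall>h \<in> arrs C. \<forall>k \<in> arrs C. source C h = target C q \<longrightarrow> source C k = target C q \<longrightarrow>
     h \<cdot> q = k \<cdot> q \<longrightarrow> h = k)"

lemma epiD:
  "epi q \<Longrightarrow> h \<cdot> q = k \<cdot> q \<Longrightarrow> h \<in> arrs C \<Longrightarrow> k \<in> arrs C \<Longrightarrow> source C h = target C q \<Longrightarrow>
    source C k = target C q \<Longrightarrow> h = k"
  unfolding epi_def by blast

lemma epi_cmp:
  assumes "epi p" "epi q" "source C p = target C q"
  shows "epi (p \<cdot> q)"
  unfolding epi_def
proof (intro conjI ballI impI)
  have pq: "p \<in> arrs C" "q \<in> arrs C" using assms by (simp_all add: epi_def)
  then show "p \<cdot> q \<in> arrs C" using assms by simp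
  fix h k assume *: "h \<in> arrs C" "k \<in> arrs C" "source C h = target C (p \<cdot> q)" "source C k = target C (p \<cdot> q)"
    "h \<cdot> (p \<cdot> q) = k \<cdot> (p \<cdot> q)"
  have "h \<cdot> p = k \<cdot> p"
    by (rule epiD[OF assms(2)]) (use * pq assms(3) in simp_all)
  then show "h = k"
    by (rule epiD[OF assms(1)]) (use * pq assms(3) in simp_all)
qed

lemma coequalizerD:
  assumes "is_coequalizer C f g q"
  shows "f \<in> arrs C" "g \<in> arrs C" "source C g = source C f" "target C g = target C f"
    "q \<in> arrs C" "source C q = target C f" "q \<cdot> f = q \<cdot> g"
  using assms unfolding is_coequalizer_def hom_def by auto

lemma coequalizer_epi:
  assumes "is_coequalizer C f g q" shows "epi q"
  unfolding epi_def
proof (intro conjI ballI impI)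
  note [simp] = coequalizerD(1-6)[OF assms]
  show "q \<in> arrs C" by simp
  fix h k assume *: "h \<in> arrs C" "k \<in> arrs C" "source C h = target C q" "source C k = target C q" "h \<cdot> q = k \<cdot> q"
  have hq: "(h \<cdot> q) \<cdot> f = (h \<cdot> q) \<cdot> g" using * coequalizerD(7)[OF assms] by simp
  have ex1: "\<exists>!x. x \<in> hom C (target C q) (target C z) \<and> x \<cdot> q = z"
    if "z \<in> arrs C" "source C z = target C f" "z \<cdot> f = z \<cdot> g" for z
    using assms that unfolding is_coequalizer_def by blast
  have "\<exists>!x. x \<in> hom C (target C q) (target C (h \<cdot> q)) \<and> x \<cdot> q = h \<cdot> q"
    by (rule ex1) (use * hq in simp_all)
  moreover have "h \<in> hom C (target C q) (target C (h \<cdot> q))" using *(1-4) by (simp add: hom_def)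
  moreover have "k \<in> hom C (target C q) (target C (h \<cdot> q))" unfolding *(5) using *(1-4) by (simp add: hom_def)
  ultimately show "h = k" using *(5)[symmetric] by blast
qed

text \<open>An epi admits at most one factorization, so any known one is the value of
  \<open>induced\<close>. This also covers composites of quotient maps, through which the associator
  of bimodules is defined.\<close>

lemma induced_eqI:
  assumes "epi q" "k \<in> hom C (target C q) (target C h)" "k \<cdot> q = h"
  shows "induced C q h = k"
  unfolding induced_def
proof (rule the_equality)
  show "k \<in> hom C (target C q) (target C h) \<and> k \<cdot> q = h" using assms by simp
  fix x assume "x \<in> hom C (target C q) (target C h) \<and> x \<cdot> q = h"
  then show "x = k" using epiD[OF assms(1), of x k] assms(2,3) by (auto simp: hom_def)
qed

lemma induced_coequalizer:
  assumes "is_coequalizer C f g q" "h \<in> hom C (target C f) Z" "h \<cdot> f = h \<cdot> g"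
  shows "induced C q h \<in> hom C (target C q) Z" "induced C q h \<cdot> q = h"
proof -
  from homD[OF assms(2)] assms(1,3) have "\<exists>!k. k \<in> hom C (target C q) (target C h) \<and> k \<cdot> q = h"
    unfolding is_coequalizer_def by blast
  then obtain k where k: "k \<in> hom C (target C q) (target C h)" "k \<cdot> q = h" by blast
  with induced_eqI[OF coequalizer_epi[OF assms(1)] k] homD[OF assms(2)]
  show "induced C q h \<in> hom C (target C q) Z" "induced C q h \<cdot> q = h" by auto
qed

text \<open>Interchange read against the direction of \<open>nf\<close>: a box is applied before one
  on its left. It is mostly used as a rule for named boxes, since alongside
  \<open>exchange_early\<close> it would loop.\<close>

lemma bubble:
  assumes "n + length (bcod \<beta>) \<le> k"
  shows "sl k \<gamma> (sl n \<beta> st) = sl n \<beta> (sl (k - length (bcod \<beta>) + length (bdom \<beta>)) \<gamma> st)"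
  using exchange[of n \<beta> "k - length (bcod \<beta>) + length (bdom \<beta>)" \<gamma> st] assms by simp

end

context strict_algebra
begin

lemma left_moduleD:
  assumes "left_module C A m \<eta> N \<nu>"
  defines "L \<equiv> Box \<nu> [A, N] [N]"
  shows "N \<in> objs C" "\<nu> \<in> arrs C" "source C \<nu> = A \<otimes> N" "target C \<nu> = N"
    "sl n L (sl n M st) = sl n L (sl (Suc n) L st)" "sl n L (sl n E st) = gd n N st"
proof -
  have N: "N \<in> objs C" and h: "\<nu> \<in> hom C (A \<otimes> N) N"
    and eqs: "\<nu> \<cdot> (A \<triangleleft> \<nu>) = \<nu> \<cdot> (m \<triangleright> N)" "\<nu> \<cdot> (\<eta> \<triangleright> N) = ident C N"
    using assms(1) unfolding left_module_def by auto
  note [simp] = N homD[OF h]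
  show "N \<in> objs C" "\<nu> \<in> arrs C" "source C \<nu> = A \<otimes> N" "target C \<nu> = N" by simp_all
  show "sl n L (sl n M st) = sl n L (sl (Suc n) L st)" "sl n L (sl n E st) = gd n N st"
    using lift_eq[of "[(0, L), (0, M)]" "[A, A, N]" "[(0, L), (1, L)]" n st]
      lift_eq[of "[(0, L), (0, E)]" "[N]" "[]" n st]
    by (simp_all add: eqs gout L_def)
qed

lemma right_moduleD:
  assumes "right_module C A m \<eta> N \<mu>"
  defines "R \<equiv> Box \<mu> [N, A] [N]"
  shows "N \<in> objs C" "\<mu> \<in> arrs C" "source C \<mu> = N \<otimes> A" "target C \<mu> = N"
    "sl n R (sl (Suc n) M st) = sl n R (sl n R st)" "sl n R (sl (Suc n) E st) = gd n N st"
proof -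
  have N: "N \<in> objs C" and h: "\<mu> \<in> hom C (N \<otimes> A) N"
    and eqs: "\<mu> \<cdot> (\<mu> \<triangleright> A) = \<mu> \<cdot> (N \<triangleleft> m)" "\<mu> \<cdot> (N \<triangleleft> \<eta>) = ident C N"
    using assms(1) unfolding right_module_def by auto
  note [simp] = N homD[OF h]
  show "N \<in> objs C" "\<mu> \<in> arrs C" "source C \<mu> = N \<otimes> A" "target C \<mu> = N" by simp_all
  show "sl n R (sl (Suc n) M st) = sl n R (sl n R st)" "sl n R (sl (Suc n) E st) = gd n N st"
    using lift_eq[of "[(0, R), (1, M)]" "[N, A, A]" "[(0, R), (0, R)]" n st]
      lift_eq[of "[(0, R), (1, E)]" "[N]" "[]" n st]
    by (simp_all add: eqs gout R_def)
qed

lemma bimoduleD: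
  assumes "bimodule C A m \<eta> (N, \<nu>, \<mu>)"
  shows "left_module C A m \<eta> N \<nu>" "right_module C A m \<eta> N \<mu>"
    "sl n (Box \<nu> [A, N] [N]) (sl (Suc n) (Box \<mu> [N, A] [N]) st) =
      sl n (Box \<mu> [N, A] [N]) (sl n (Box \<nu> [A, N] [N]) st)"
proof -
  show 1: "left_module C A m \<eta> N \<nu>" "right_module C A m \<eta> N \<mu>"
    using assms by (simp_all add: bimodule_def)
  note [simp] = left_moduleD(1-4)[OF 1(1)] right_moduleD(1-4)[OF 1(2)]
  show "sl n (Box \<nu> [A, N] [N]) (sl (Suc n) (Box \<mu> [N, A] [N]) st) =
      sl n (Box \<mu> [N, A] [N]) (sl n (Box \<nu> [A, N] [N]) st)"
    using lift_eq[of "[(0, Box \<nu> [A, N] [N]), (1, Box \<mu> [N, A] [N])]" "[A, N, A]"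
        "[(0, Box \<mu> [N, A] [N]), (0, Box \<nu> [A, N] [N])]" n st] assms
    by (simp add: gout bimodule_def)
qed

end

section \<open>Tensor products of bimodules\<close>

locale coflat_algebra = strict_algebra C A m \<eta> for C :: "('o, 'a) moncat" (structure) and A m \<eta> +
  assumes coeqs: "has_coequalizers C"
    and coflat: "\<And>Z. Z \<in> objs C \<Longrightarrow> left_coflat C Z"
    and robust: "\<And>N \<nu>. left_module C A m \<eta> N \<nu> \<Longrightarrow> robust C A m \<eta> N \<nu>"
begin

lemma balanced_coequalizer:
  assumes "right_module C A m \<eta> X \<mu>" "left_module C A m \<eta> Y \<nu>"
  shows "is_coequalizer C (\<mu> \<triangleright> Y) (X \<triangleleft> \<nu>) (balanced C X \<mu> Y \<nu>)"
proof -
  note [simp] = right_moduleD(1-4)[OF assms(1)] left_moduleD(1-4)[OF assms(2)]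
  have "\<mu> \<triangleright> Y \<in> hom C (X \<otimes> A \<otimes> Y) (X \<otimes> Y)" "X \<triangleleft> \<nu> \<in> hom C (X \<otimes> A \<otimes> Y) (X \<otimes> Y)"
    by (simp_all add: hom_def)
  then obtain q where "is_coequalizer C (\<mu> \<triangleright> Y) (X \<triangleleft> \<nu>) q"
    using coeqs unfolding has_coequalizers_def by blast
  then show ?thesis unfolding balanced_def coequalizer_def by (rule someI)
qed

text \<open>Robustness preserves the coequalizer under whiskering on the left, left coflatness under
  whiskering on the right, and one after the other gives both.\<close>

lemma balanced_coequalizers:
  assumes "right_module C A m \<eta> X \<mu>" "left_module C A m \<eta> Y \<nu>" "N \<in> objs C" "Z \<in> objs C"
  defines "q \<equiv> balanced C X \<mu> Y \<nu>"
  shows "is_coequalizer C (\<mu> \<triangleright> Y) (X \<triangleleft> \<nu>) q"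
    "is_coequalizer C (N \<triangleleft> \<mu> \<triangleright> Y) (N \<otimes> X \<triangleleft> \<nu>) (N \<triangleleft> q)"
    "is_coequalizer C (\<mu> \<triangleright> Y \<otimes> Z) (X \<triangleleft> \<nu> \<triangleright> Z) (q \<triangleright> Z)"
    "is_coequalizer C (N \<triangleleft> \<mu> \<triangleright> Y \<otimes> Z) (N \<otimes> X \<triangleleft> \<nu> \<triangleright> Z) (N \<triangleleft> q \<triangleright> Z)"
proof -
  note [simp] = right_moduleD(1-4)[OF assms(1)] left_moduleD(1-4)[OF assms(2)] assms(3,4)
  show 1: "is_coequalizer C (\<mu> \<triangleright> Y) (X \<triangleleft> \<nu>) q"
    unfolding q_def by (rule balanced_coequalizer[OF assms(1,2)])
  note [simp] = coequalizerD(5,6)[OF 1]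
  show 2: "is_coequalizer C (N \<triangleleft> \<mu> \<triangleright> Y) (N \<otimes> X \<triangleleft> \<nu>) (N \<triangleleft> q)"
    using robust[OF assms(2)] assms(1,3) unfolding robust_def q_def by blast
  show "is_coequalizer C (\<mu> \<triangleright> Y \<otimes> Z) (X \<triangleleft> \<nu> \<triangleright> Z) (q \<triangleright> Z)"
    using coflat[OF assms(4)] 1 unfolding left_coflat_def by fastforce
  show "is_coequalizer C (N \<triangleleft> \<mu> \<triangleright> Y \<otimes> Z) (N \<otimes> X \<triangleleft> \<nu> \<triangleright> Z) (N \<triangleleft> q \<triangleright> Z)"
    using coflat[OF assms(4)] 2 unfolding left_coflat_def by fastforce
qed

text \<open>A relation, so that the quotient map and the three components of the product become
  variables. Iterated tensor products can then be handled without expanding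
  \<open>bimod_tensor\<close>.\<close>

definition tens :: "'o \<times> 'a \<times> 'a \<Rightarrow> 'o \<times> 'a \<times> 'a \<Rightarrow> 'a \<Rightarrow> 'o \<times> 'a \<times> 'a \<Rightarrow> bool" where
  "tens P Q q R \<longleftrightarrow> bimodule C A m \<eta> P \<and> bimodule C A m \<eta> Q \<and> q = bimod_q C P Q \<and> R = bimod_tensor C A P Q"

lemma tensI:
  "bimodule C A m \<eta> P \<Longrightarrow> bimodule C A m \<eta> Q \<Longrightarrow> tens P Q (bimod_q C P Q) (bimod_tensor C A P Q)"
  by (simp add: tens_def)

text \<open>All working facts about one tensor product over \<open>A\<close>. The bimodule laws of
  the product hold because, composed with a whiskered and hence epi quotient map, each turns into a
  law of one of the factors.\<close>

lemma tensD:
  assumes t: "tens (X, \<nu>, \<mu>) (Y, \<nu>', \<mu>') q (T, l, r)"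
  shows "bimodule C A m \<eta> (X, \<nu>, \<mu>)" "bimodule C A m \<eta> (Y, \<nu>', \<mu>')" "bimodule C A m \<eta> (T, l, r)"
    "T \<in> objs C" "q \<in> arrs C" "source C q = X \<otimes> Y" "target C q = T"
    "l \<in> arrs C" "source C l = A \<otimes> T" "target C l = T" "r \<in> arrs C" "source C r = T \<otimes> A" "target C r = T"
    "sl n (Box q [X, Y] [T]) (sl n (Box \<mu> [X, A] [X]) st) = sl n (Box q [X, Y] [T]) (sl (Suc n) (Box \<nu>' [A, Y] [Y]) st)"
    "sl n (Box l [A, T] [T]) (sl (Suc n) (Box q [X, Y] [T]) st) = sl n (Box q [X, Y] [T]) (sl n (Box \<nu> [A, X] [X]) st)"
    "sl n (Box r [T, A] [T]) (sl n (Box q [X, Y] [T]) st) = sl n (Box q [X, Y] [T]) (sl (Suc n) (Box \<mu>' [Y, A] [Y]) st)"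
    "epi q" "N \<in> objs C \<Longrightarrow> epi (N \<triangleleft> q)" "Z \<in> objs C \<Longrightarrow> epi (q \<triangleright> Z)"
    "N \<in> objs C \<Longrightarrow> Z \<in> objs C \<Longrightarrow> epi (N \<triangleleft> q \<triangleright> Z)"
    "is_coequalizer C (\<mu> \<triangleright> Y) (X \<triangleleft> \<nu>') q"
    "N \<in> objs C \<Longrightarrow> is_coequalizer C (N \<triangleleft> \<mu> \<triangleright> Y) (N \<otimes> X \<triangleleft> \<nu>') (N \<triangleleft> q)"
    "Z \<in> objs C \<Longrightarrow> is_coequalizer C (\<mu> \<triangleright> Y \<otimes> Z) (X \<triangleleft> \<nu>' \<triangleright> Z) (q \<triangleright> Z)"
proof -
  have P: "bimodule C A m \<eta> (X, \<nu>, \<mu>)" and Q: "bimodule C A m \<eta> (Y, \<nu>', \<mu>')"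
    and defs: "balanced C X \<mu> Y \<nu>' = q" "target C q = T"
      "induced C (A \<triangleleft> q) (q \<cdot> (\<nu> \<triangleright> Y)) = l" "induced C (q \<triangleright> A) (q \<cdot> (X \<triangleleft> \<mu>')) = r"
    using t by (simp_all add: tens_def bimod_q_def bimod_tensor_def Let_def)
  show "bimodule C A m \<eta> (X, \<nu>, \<mu>)" "bimodule C A m \<eta> (Y, \<nu>', \<mu>')" by fact+
  note P' = bimoduleD[OF P] and Q' = bimoduleD[OF Q]
  note [simp] = left_moduleD(1-4)[OF P'(1)] right_moduleD(1-4)[OF P'(2)] left_moduleD(1-4)[OF Q'(1)] right_moduleD(1-4)[OF Q'(2)]
  note co = balanced_coequalizers[OF P'(2) Q'(1), unfolded defs(1)]
  have q: "q \<in> arrs C" "source C q = X \<otimes> Y" "target C q = T" "T \<in> objs C"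
    using coequalizerD[OF co(1)[of \<one> \<one>]] obj_simps(4)[of q] by (simp_all add: defs(2))
  then show "T \<in> objs C" "q \<in> arrs C" "source C q = X \<otimes> Y" "target C q = T" by simp_all
  note [simp] = q
  show ep: "epi q" "N \<in> objs C \<Longrightarrow> epi (N \<triangleleft> q)" "Z \<in> objs C \<Longrightarrow> epi (q \<triangleright> Z)"
    "N \<in> objs C \<Longrightarrow> Z \<in> objs C \<Longrightarrow> epi (N \<triangleleft> q \<triangleright> Z)" for N Z
    using coequalizer_epi[OF co(1)[of \<one> \<one>]] coequalizer_epi[OF co(2)[of N \<one>]] coequalizer_epi[OF co(3)[of \<one> Z]]
      coequalizer_epi[OF co(4)[of N Z]] by simp_all
  let ?QQ = "Box q [X, Y] [T]" and ?N = "Box \<nu> [A, X] [X]" and ?M = "Box \<mu> [X, A] [X]" and ?N' = "Box \<nu>' [A, Y] [Y]" and ?M' = "Box \<mu>' [Y, A] [Y]"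
  show "is_coequalizer C (\<mu> \<triangleright> Y) (X \<triangleleft> \<nu>') q"
    "N \<in> objs C \<Longrightarrow> is_coequalizer C (N \<triangleleft> \<mu> \<triangleright> Y) (N \<otimes> X \<triangleleft> \<nu>') (N \<triangleleft> q)"
    "Z \<in> objs C \<Longrightarrow> is_coequalizer C (\<mu> \<triangleright> Y \<otimes> Z) (X \<triangleleft> \<nu>' \<triangleright> Z) (q \<triangleright> Z)"
    using co(1)[of \<one> \<one>] co(2)[of N \<one>] co(3)[of \<one> Z] by simp_all
  show bal: "sl n ?QQ (sl n ?M st) = sl n ?QQ (sl (Suc n) ?N' st)" for n st
    using lift_eq[of "[(0, ?QQ), (0, ?M)]" "[X, A, Y]" "[(0, ?QQ), (1, ?N')]" n st] coequalizerD(7)[OF co(1)[of \<one> \<one>]]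
    by (simp add: gout)
  \<comment> \<open>The outer actions respect the balancing relation because the two actions of each
    bimodule commute. This and the next equation are what the universal property needs to define
    \<open>l\<close> and \<open>r\<close>.\<close>
  have 1: "run [(0, ?QQ), (0, ?N), (1, ?M)] (start [A, X, A, Y]) = run [(0, ?QQ), (0, ?N), (2, ?N')] (start [A, X, A, Y])"
    by (simp add: nf P'(3) bal)
  have 2: "run [(0, ?QQ), (1, ?M'), (0, ?M)] (start [X, A, Y, A]) = run [(0, ?QQ), (1, ?M'), (1, ?N')] (start [X, A, Y, A])"
    by (simp add: gin bubble[of _ ?M _ ?M'] bal Q'(3))
  have l: "l \<in> hom C (A \<otimes> T) T" "l \<cdot> (A \<triangleleft> q) = q \<cdot> (\<nu> \<triangleright> Y)"
    using induced_coequalizer[OF co(2)[of A \<one>], of "q \<cdot> (\<nu> \<triangleright> Y)" T] diagram_eq[OF 1]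
    by (simp_all add: hom_def defs)
  have r: "r \<in> hom C (T \<otimes> A) T" "r \<cdot> (q \<triangleright> A) = q \<cdot> (X \<triangleleft> \<mu>')"
    using induced_coequalizer[OF co(3)[of \<one> A], of "q \<cdot> (X \<triangleleft> \<mu>')" T] diagram_eq[OF 2]
    by (simp_all add: hom_def defs)
  from homD[OF l(1)] homD[OF r(1)]
  show lr: "l \<in> arrs C" "source C l = A \<otimes> T" "target C l = T" "r \<in> arrs C" "source C r = T \<otimes> A" "target C r = T"
    by simp_all
  note [simp] = lr
  let ?L = "Box l [A, T] [T]" and ?R = "Box r [T, A] [T]"
  show lq: "sl n ?L (sl (Suc n) ?QQ st) = sl n ?QQ (sl n ?N st)" for n st
    using lift_eq[of "[(0, ?L), (1, ?QQ)]" "[A, X, Y]" "[(0, ?QQ), (0, ?N)]" n st] l(2)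
    by (simp add: gout)
  show rq: "sl n ?R (sl n ?QQ st) = sl n ?QQ (sl (Suc n) ?M' st)" for n st
    using lift_eq[of "[(0, ?R), (0, ?QQ)]" "[X, Y, A]" "[(0, ?QQ), (1, ?M')]" n st] r(2)
    by (simp add: gout)
  note rules = lq rq left_moduleD(5,6)[OF P'(1)] right_moduleD(5,6)[OF Q'(2)] gin
  have a: "run [(0, ?L), (1, ?L), (2, ?QQ)] (start [A, A, X, Y]) = run [(0, ?L), (0, M), (2, ?QQ)] (start [A, A, X, Y])"
    by (simp add: rules exchange[of _ M _ ?QQ])
  have b: "run [(0, ?L), (0, E), (0, ?QQ)] (start [X, Y]) = run [(0, ?QQ)] (start [X, Y])"
    by (simp add: rules exchange[of _ E _ ?QQ])
  have c: "run [(0, ?R), (0, ?R), (0, ?QQ)] (start [X, Y, A, A]) = run [(0, ?R), (1, M), (0, ?QQ)] (start [X, Y, A, A])"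
    by (simp add: rules bubble[of _ ?QQ _ M])
  have d: "run [(0, ?R), (1, E), (0, ?QQ)] (start [X, Y]) = run [(0, ?QQ)] (start [X, Y])"
    by (simp add: rules bubble[of _ ?QQ _ E])
  have e: "run [(0, ?L), (1, ?R), (1, ?QQ)] (start [A, X, Y, A]) = run [(0, ?R), (0, ?L), (1, ?QQ)] (start [A, X, Y, A])"
    by (simp add: rules bubble[of _ ?N _ ?M'])
  have "l \<cdot> (A \<triangleleft> l) = l \<cdot> (m \<triangleright> T)"
    by (rule epiD[OF ep(2)[of "A \<otimes> A"]]) (use diagram_eq[OF a] in simp_all)
  moreover have "l \<cdot> (\<eta> \<triangleright> T) = ident C T"
    by (rule epiD[OF ep(1)]) (use diagram_eq[OF b] in simp_all)
  moreover have "r \<cdot> (r \<triangleright> A) = r \<cdot> (T \<triangleleft> m)"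
    by (rule epiD[OF ep(3)[of "A \<otimes> A"]]) (use diagram_eq[OF c] in simp_all)
  moreover have "r \<cdot> (T \<triangleleft> \<eta>) = ident C T"
    by (rule epiD[OF ep(1)]) (use diagram_eq[OF d] in simp_all)
  moreover have "l \<cdot> (A \<triangleleft> r) = r \<cdot> (l \<triangleright> A)"
    by (rule epiD[OF ep(4)[of A A]]) (use diagram_eq[OF e] in simp_all)
  ultimately show "bimodule C A m \<eta> (T, l, r)"
    unfolding bimodule_def left_module_def right_module_def by (simp add: hom_def)
qed

lemma bimodule_facts:
  assumes "bimodule C A m \<eta> (N, \<nu>, \<mu>)"
  shows "N \<in> objs C" "\<nu> \<in> arrs C" "source C \<nu> = A \<otimes> N" "target C \<nu> = N"
    "\<mu> \<in> arrs C" "source C \<mu> = N \<otimes> A" "target C \<mu> = N"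
  using left_moduleD(1-4)[OF bimoduleD(1)[OF assms]] right_moduleD(1-4)[OF bimoduleD(2)[OF assms]] by auto

text \<open>On representatives \<open>\<alpha>\<close> and \<open>\<beta>\<close> change nothing but
  the bracketing. Each is built in two stages, one coequalizer at a time, and everything else is
  checked after composing with both quotient maps, which together are epi.\<close>

lemma associatorD:
  assumes tq: "tens (X, \<nu>, \<mu>) (Y, \<nu>', \<mu>') q (T, l, r)" and tq': "tens (Y, \<nu>', \<mu>') (Z, \<nu>'', \<mu>'') q' (T', l', r')"
    and tU: "tens (T, l, r) (Z, \<nu>'', \<mu>'') qU (U, lU, rU)" and tW: "tens (X, \<nu>, \<mu>) (T', l', r') qW (W, lW, rW)"
  obtains \<alpha> \<beta> where
    "bilinear C A (U, lU, rU) (W, lW, rW) \<alpha>" "bilinear C A (W, lW, rW) (U, lU, rU) \<beta>"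
    "\<alpha> \<in> hom C U W" "\<beta> \<in> hom C W U"
    "\<alpha> \<cdot> qU \<cdot> (q \<triangleright> Z) = qW \<cdot> (X \<triangleleft> q')" "\<beta> \<cdot> qW \<cdot> (X \<triangleleft> q') = qU \<cdot> (q \<triangleright> Z)"
    "induced C (qU \<cdot> (q \<triangleright> Z)) (qW \<cdot> (X \<triangleleft> q')) = \<alpha>"
    "\<beta> \<cdot> \<alpha> = ident C U" "\<alpha> \<cdot> \<beta> = ident C W"
proof -
  note q = tensD[OF tq] and q' = tensD[OF tq'] and qU = tensD[OF tU] and qW = tensD[OF tW]
  note bX = bimodule_facts[OF q(1)] and bY = bimodule_facts[OF q(2)] and bZ = bimodule_facts[OF q'(2)]
  note [simp] = q(4-13) q'(4-13) qU(4-13) qW(4-13) bX bY bZ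
  let ?N = "Box \<nu> [A, X] [X]" and ?M = "Box \<mu> [X, A] [X]"
  let ?N' = "Box \<nu>' [A, Y] [Y]" and ?M' = "Box \<mu>' [Y, A] [Y]"
  let ?N'' = "Box \<nu>'' [A, Z] [Z]" and ?M'' = "Box \<mu>'' [Z, A] [Z]"
  let ?L = "Box l [A, T] [T]" and ?R = "Box r [T, A] [T]" and ?L' = "Box l' [A, T'] [T']" and ?R' = "Box r' [T', A] [T']"
  let ?Q = "Box q [X, Y] [T]" and ?Q' = "Box q' [Y, Z] [T']" and ?QU = "Box qU [T, Z] [U]" and ?QW = "Box qW [X, T'] [W]"
  let ?LU = "Box lU [A, U] [U]" and ?RU = "Box rU [U, A] [U]" and ?LW = "Box lW [A, W] [W]" and ?RW = "Box rW [W, A] [W]"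
  note rules = q(14-16) q'(14-16) qU(14-16) qW(14-16)
  have 1: "run [(0, ?QW), (1, ?Q'), (0, ?M)] (start [X, A, Y, Z]) = run [(0, ?QW), (1, ?Q'), (1, ?N')] (start [X, A, Y, Z])"
    by (simp add: rules bubble[of _ ?M _ ?Q'])
  let ?a0 = "induced C (q \<triangleright> Z) (qW \<cdot> (X \<triangleleft> q'))"
  have a0: "?a0 \<in> hom C (T \<otimes> Z) W" "?a0 \<cdot> (q \<triangleright> Z) = qW \<cdot> (X \<triangleleft> q')"
    using induced_coequalizer[OF q(23)[of Z], of "qW \<cdot> (X \<triangleleft> q')" W] diagram_eq[OF 1]
    by (simp_all add: hom_def)
  note [simp] = homD(1-3)[OF a0(1)]
  let ?A0 = "Box ?a0 [T, Z] [W]"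
  have ra0: "sl n ?A0 (sl n ?Q st) = sl n ?QW (sl (Suc n) ?Q' st)" for n st
    using lift_eq[of "[(0, ?A0), (0, ?Q)]" "[X, Y, Z]" "[(0, ?QW), (1, ?Q')]" n st] a0(2)
    by (simp add: gout)
  have 2: "run [(0, ?A0), (0, ?R), (0, ?Q)] (start [X, Y, A, Z]) = run [(0, ?A0), (1, ?N''), (0, ?Q)] (start [X, Y, A, Z])"
    by (simp add: rules ra0 bubble[of _ ?Q _ ?N''])
  have "?a0 \<cdot> (r \<triangleright> Z) = ?a0 \<cdot> (T \<triangleleft> \<nu>'')"
    by (rule epiD[OF q(19)[of "A \<otimes> Z"]]) (use diagram_eq[OF 2] in simp_all)
  then have al: "induced C qU ?a0 \<in> hom C U W" "induced C qU ?a0 \<cdot> qU = ?a0"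
    using induced_coequalizer[OF qU(21), of ?a0 W] a0(1) by simp_all
  define \<alpha> where "\<alpha> = induced C qU ?a0"
  note al = al[folded \<alpha>_def]
  have b1: "run [(0, ?QU), (0, ?Q), (1, ?M')] (start [X, Y, A, Z]) = run [(0, ?QU), (0, ?Q), (2, ?N'')] (start [X, Y, A, Z])"
  proof -
    \<comment> \<open>The rule for the right action of \<open>T\<close> has to be applied against
      its orientation: the balancing of \<open>qU\<close> refers to that action and not to the
      action on \<open>Y\<close>.\<close>
    let ?st = "start [X, Y, A, Z]"
    have "sl 0 ?QU (sl 0 ?Q (sl 1 ?M' ?st)) = sl 0 ?QU (sl 0 ?R (sl 0 ?Q ?st))" by (simp add: q(16))
    also have "\<dots> = sl 0 ?QU (sl 1 ?N'' (sl 0 ?Q ?st))" by (simp add: qU(14))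
    also have "\<dots> = sl 0 ?QU (sl 0 ?Q (sl 2 ?N'' ?st))" by (simp add: bubble[of _ ?Q _ ?N''])
    finally show ?thesis by simp
  qed
  let ?b0 = "induced C (X \<triangleleft> q') (qU \<cdot> (q \<triangleright> Z))"
  have b0: "?b0 \<in> hom C (X \<otimes> T') U" "?b0 \<cdot> (X \<triangleleft> q') = qU \<cdot> (q \<triangleright> Z)"
    using induced_coequalizer[OF q'(22)[of X], of "qU \<cdot> (q \<triangleright> Z)" U] diagram_eq[OF b1]
    by (simp_all add: hom_def)
  note [simp] = homD(1-3)[OF b0(1)]
  let ?B0 = "Box ?b0 [X, T'] [U]"
  have rb0: "sl n ?B0 (sl (Suc n) ?Q' st) = sl n ?QU (sl n ?Q st)" for n st
    using lift_eq[of "[(0, ?B0), (1, ?Q')]" "[X, Y, Z]" "[(0, ?QU), (0, ?Q)]" n st] b0(2)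
    by (simp add: gout)
  have 3: "run [(0, ?B0), (0, ?M), (2, ?Q')] (start [X, A, Y, Z]) = run [(0, ?B0), (1, ?L'), (2, ?Q')] (start [X, A, Y, Z])"
    by (simp add: rules rb0 exchange[of _ ?M _ ?Q'])
  have "?b0 \<cdot> (\<mu> \<triangleright> T') = ?b0 \<cdot> (X \<triangleleft> l')"
    by (rule epiD[OF q'(18)[of "X \<otimes> A"]]) (use diagram_eq[OF 3] in simp_all)
  then have be: "induced C qW ?b0 \<in> hom C W U" "induced C qW ?b0 \<cdot> qW = ?b0"
    using induced_coequalizer[OF qW(21), of ?b0 U] b0(1) by simp_all
  define \<beta> where "\<beta> = induced C qW ?b0"
  note be = be[folded \<beta>_def]
  note [simp] = homD(1-3)[OF al(1)] homD(1-3)[OF be(1)]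
  have ae: "\<alpha> \<cdot> (qU \<cdot> (q \<triangleright> Z)) = qW \<cdot> (X \<triangleleft> q')" using al(2) a0(2) by (simp flip: cmp_assoc_simp)
  have be: "\<beta> \<cdot> (qW \<cdot> (X \<triangleleft> q')) = qU \<cdot> (q \<triangleright> Z)" using be(2) b0(2) by (simp flip: cmp_assoc_simp)
  have e1: "epi (qU \<cdot> (q \<triangleright> Z))" by (rule epi_cmp) (simp_all add: qU(17) q(19))
  have e2: "epi (qW \<cdot> (X \<triangleleft> q'))" by (rule epi_cmp) (simp_all add: qW(17) q'(18))
  have e1A: "epi ((A \<triangleleft> qU) \<cdot> (A \<triangleleft> q \<triangleright> Z))" "epi ((qU \<triangleright> A) \<cdot> (q \<triangleright> Z \<otimes> A))"
    by (rule epi_cmp; simp add: qU(18,19) q(19,20))+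
  have e2A: "epi ((A \<triangleleft> qW) \<cdot> (A \<otimes> X \<triangleleft> q'))" "epi ((qW \<triangleright> A) \<cdot> (X \<triangleleft> q' \<triangleright> A))"
    by (rule epi_cmp; simp add: qW(18,19) q'(18,20))+
  let ?AL = "Box \<alpha> [U] [W]" and ?BE = "Box \<beta> [W] [U]"
  have ra: "sl n ?AL (sl n ?QU (sl n ?Q st)) = sl n ?QW (sl (Suc n) ?Q' st)" for n st
    using lift_eq[of "[(0, ?AL), (0, ?QU), (0, ?Q)]" "[X, Y, Z]" "[(0, ?QW), (1, ?Q')]" n st] ae
    by (simp add: gout)
  have rb: "sl n ?BE (sl n ?QW (sl (Suc n) ?Q' st)) = sl n ?QU (sl n ?Q st)" for n st
    using lift_eq[of "[(0, ?BE), (0, ?QW), (1, ?Q')]" "[X, Y, Z]" "[(0, ?QU), (0, ?Q)]" n st] be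
    by (simp add: gout)
  have r1: "run [(0, ?AL), (0, ?LU), (1, ?QU), (1, ?Q)] (start [A, X, Y, Z]) =
      run [(0, ?LW), (1, ?AL), (1, ?QU), (1, ?Q)] (start [A, X, Y, Z])"
    by (simp add: rules ra exchange[of _ ?N _ ?Q'])
  have r2: "run [(0, ?AL), (0, ?RU), (0, ?QU), (0, ?Q)] (start [X, Y, Z, A]) =
      run [(0, ?RW), (0, ?AL), (0, ?QU), (0, ?Q)] (start [X, Y, Z, A])"
    by (simp add: rules ra bubble[of _ ?Q _ ?M''])
  have r3: "run [(0, ?BE), (0, ?LW), (1, ?QW), (2, ?Q')] (start [A, X, Y, Z]) =
      run [(0, ?LU), (1, ?BE), (1, ?QW), (2, ?Q')] (start [A, X, Y, Z])"
    by (simp add: rules rb exchange[of _ ?N _ ?Q'])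
  have r4: "run [(0, ?BE), (0, ?RW), (0, ?QW), (1, ?Q')] (start [X, Y, Z, A]) =
      run [(0, ?RU), (0, ?BE), (0, ?QW), (1, ?Q')] (start [X, Y, Z, A])"
    by (simp add: rules rb bubble[of _ ?Q _ ?M''])
  have bil_a: "bilinear C A (U, lU, rU) (W, lW, rW) \<alpha>"
    unfolding bilinear_def prod.case
  proof (intro conjI)
    show "\<alpha> \<in> hom C U W" by (rule al(1))
    show "\<alpha> \<cdot> lU = lW \<cdot> (A \<triangleleft> \<alpha>)"
      by (rule epiD[OF e1A(1)]) (use diagram_eq[OF r1] in simp_all)
    show "\<alpha> \<cdot> rU = rW \<cdot> (\<alpha> \<triangleright> A)"
      by (rule epiD[OF e1A(2)]) (use diagram_eq[OF r2] in simp_all)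
  qed
  have bh: "\<beta> \<in> hom C W U" by (simp add: hom_def)
  have bil_b: "bilinear C A (W, lW, rW) (U, lU, rU) \<beta>"
    unfolding bilinear_def prod.case
  proof (intro conjI)
    show "\<beta> \<in> hom C W U" by (rule bh)
    show "\<beta> \<cdot> lW = lU \<cdot> (A \<triangleleft> \<beta>)"
      by (rule epiD[OF e2A(1)]) (use diagram_eq[OF r3] in simp_all)
    show "\<beta> \<cdot> rW = rU \<cdot> (\<beta> \<triangleright> A)"
      by (rule epiD[OF e2A(2)]) (use diagram_eq[OF r4] in simp_all)
  qed
  \<comment> \<open>The category \<open>bimodules\<close> defines the associator by factoring
    through the composite of two quotient maps. That composite is epi, so the description picks out
    the arrow constructed in stages.\<close>
  have "induced C (qU \<cdot> (q \<triangleright> Z)) (qW \<cdot> (X \<triangleleft> q')) = \<alpha>"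
    by (rule induced_eqI[OF e1]) (simp_all add: ae hom_def)
  moreover have "\<beta> \<cdot> \<alpha> = ident C U"
    by (rule epiD[OF e1]) (simp_all add: ae be)
  moreover have "\<alpha> \<cdot> \<beta> = ident C W"
    by (rule epiD[OF e2]) (simp_all add: ae be)
  ultimately show thesis using that[of \<alpha> \<beta>] bil_a bil_b al(1) bh ae be by simp
qed

section \<open>Explicit form of the monoidal category of bimodules\<close>

lemma bimod_simps:
  "objs (bimodules C A m \<eta>) = {P. bimodule C A m \<eta> P}"
  "source (bimodules C A m \<eta>) (P, f, Q) = P"
  "target (bimodules C A m \<eta>) (P, f, Q) = Q"
  "ident (bimodules C A m \<eta>) P = (P, ident C (fst P), P)"
  "(Q', g, R) \<cdot>\<^bsub>bimodules C A m \<eta>\<^esub> (P, f, Q) = (P, g \<cdot> f, R)"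
  "\<one>\<^bsub>bimodules C A m \<eta>\<^esub> = (A, m, m)"
  "P \<otimes>\<^bsub>bimodules C A m \<eta>\<^esub> Q = bimod_tensor C A P Q"
  "(P, f, P') \<boxtimes>\<^bsub>bimodules C A m \<eta>\<^esub> (Q, g, Q') =
     (bimod_tensor C A P Q, induced C (bimod_q C P Q) (bimod_q C P' Q' \<cdot> (f \<boxtimes> g)), bimod_tensor C A P' Q')"
  "associator (bimodules C A m \<eta>) P Q R =
     (bimod_tensor C A (bimod_tensor C A P Q) R,
      induced C (bimod_q C (bimod_tensor C A P Q) R \<cdot> (bimod_q C P Q \<triangleright> fst R))
        (bimod_q C P (bimod_tensor C A Q R) \<cdot> (fst P \<triangleleft> bimod_q C Q R)),
      bimod_tensor C A P (bimod_tensor C A Q R))"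
  "left_unitor (bimodules C A m \<eta>) P =
     (bimod_tensor C A (A, m, m) P, induced C (bimod_q C (A, m, m) P) (fst (snd P)), P)"
  "right_unitor (bimodules C A m \<eta>) P =
     (bimod_tensor C A P (A, m, m), induced C (bimod_q C P (A, m, m)) (snd (snd P)), P)"
  by (simp_all add: bimodules_def)

lemma bimod_arrs: "(P, f, Q) \<in> arrs (bimodules C A m \<eta>) \<longleftrightarrow>
    bimodule C A m \<eta> P \<and> bimodule C A m \<eta> Q \<and> bilinear C A P Q f"
  by (simp add: bimodules_def)

lemma bimod_hom: "F \<in> hom (bimodules C A m \<eta>) P Q \<longleftrightarrow>
    (\<exists>f. F = (P, f, Q) \<and> bimodule C A m \<eta> P \<and> bimodule C A m \<eta> Q \<and> bilinear C A P Q f)"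
  by (cases F) (auto simp: hom_def bimod_simps bimod_arrs)

lemma bilinear_hom: "bilinear C A P Q f \<Longrightarrow> f \<in> hom C (fst P) (fst Q)"
  by (cases P; cases Q) (simp add: bilinear_def)

lemma bimodules_inverse:
  assumes "bimodule C A m \<eta> P" "bimodule C A m \<eta> Q" "bilinear C A P Q f" "bilinear C A Q P g"
    "g \<cdot> f = ident C (fst P)" "f \<cdot> g = ident C (fst Q)"
  shows "inverse_arr (bimodules C A m \<eta>) (P, f, Q) = (Q, g, P)"
  unfolding inverse_arr_def
proof (rule the_equality)
  show "is_inverse (bimodules C A m \<eta>) (P, f, Q) (Q, g, P)"
    using assms by (simp add: is_inverse_def bimod_simps bimod_arrs bimod_hom)
  fix h assume h: "is_inverse (bimodules C A m \<eta>) (P, f, Q) h"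
  then obtain k where k: "h = (Q, k, P)" "bilinear C A Q P k" by (auto simp: is_inverse_def bimod_simps bimod_hom)
  note [simp] = homD[OF bilinear_hom[OF k(2)]] homD[OF bilinear_hom[OF assms(3)]] homD[OF bilinear_hom[OF assms(4)]]
  have "k \<cdot> f = ident C (fst P)" using h by (simp add: is_inverse_def bimod_simps k(1))
  then have "(k \<cdot> f) \<cdot> g = g" by simp
  moreover have "(k \<cdot> f) \<cdot> g = k" using assms(6) by simp
  ultimately show "h = (Q, g, P)" by (simp add: k(1))
qed

end

section \<open>Separable extensions and separable rings\<close>

locale algebra_extension = coflat_algebra C A m \<eta> for C :: "('o, 'a) moncat" (structure) and A m \<eta> +
  fixes S :: 'o and mS uS i :: 'a
  assumes algS: "algebra C S mS uS" and mor: "algebra_morphism C A m \<eta> S mS uS i"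
begin

lemma S_facts [simp]:
  "S \<in> objs C" "mS \<in> arrs C" "source C mS = S \<otimes> S" "target C mS = S"
  "uS \<in> arrs C" "source C uS = \<one>" "target C uS = S"
  "i \<in> arrs C" "source C i = A" "target C i = S"
proof -
  have "mS \<in> hom C (S \<otimes> S) S" "uS \<in> hom C \<one> S" "i \<in> hom C A S" "S \<in> objs C"
    using algS mor unfolding algebra_def algebra_morphism_def by blast+
  then show "S \<in> objs C" "mS \<in> arrs C" "source C mS = S \<otimes> S" "target C mS = S"
    "uS \<in> arrs C" "source C uS = \<one>" "target C uS = S" "i \<in> arrs C" "source C i = A" "target C i = S"
    by (simp_all add: hom_def)
qed

abbreviation "SM \<equiv> Box mS [S, S] [S]"
abbreviation "US \<equiv> Box uS [] [S]"
abbreviation "I \<equiv> Box i [A] [S]"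

lemma S_rules:
  "sl n SM (sl (Suc n) SM st) = sl n SM (sl n SM st)"
  "sl n SM (sl n US st) = gd n S st" "sl n SM (sl (Suc n) US st) = gd n S st"
  "sl n I (sl n M st) = sl n SM (sl n I (sl (Suc n) I st))" "sl n I (sl n E st) = sl n US st"
proof -
  have a: "mS \<cdot> (mS \<triangleright> S) = mS \<cdot> (S \<triangleleft> mS)" "mS \<cdot> (uS \<triangleright> S) = ident C S" "mS \<cdot> (S \<triangleleft> uS) = ident C S"
    using algS unfolding algebra_def
    by (simp_all add: strict_associator strict_left_unitor strict_right_unitor)
  have s: "i \<boxtimes> i = (i \<triangleright> S) \<cdot> (A \<triangleleft> i)" by (rule tensor_split) (simp_all add: hom_def)
  have b: "i \<cdot> m = mS \<cdot> (i \<triangleright> S) \<cdot> (A \<triangleleft> i)" "i \<cdot> \<eta> = uS"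
    using mor s unfolding algebra_morphism_def by simp_all
  show "sl n SM (sl (Suc n) SM st) = sl n SM (sl n SM st)"
    using lift_eq[of "[(0, SM), (1, SM)]" "[S, S, S]" "[(0, SM), (0, SM)]" n st] a(1)
    by (simp add: gout)
  show "sl n SM (sl n US st) = gd n S st" "sl n SM (sl (Suc n) US st) = gd n S st"
    using lift_eq[of "[(0, SM), (0, US)]" "[S]" "[]" n st] lift_eq[of "[(0, SM), (1, US)]" "[S]" "[]" n st] a(2,3)
    by (simp_all add: gout)
  show "sl n I (sl n M st) = sl n SM (sl n I (sl (Suc n) I st))"
    using lift_eq[of "[(0, I), (0, M)]" "[A, A]" "[(0, SM), (0, I), (1, I)]" n st] b(1)
    by (simp add: gout)
  show "sl n I (sl n E st) = sl n US st"
    using lift_eq[of "[(0, I), (0, E)]" "[]" "[(0, US)]" n st] b(2)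
    by (simp add: gout)
qed

lemmas snf = anf S_rules

abbreviation "\<nu> \<equiv> ext_left C S mS i"
abbreviation "\<mu> \<equiv> ext_right C S mS i"

lemma ext_facts [simp]:
  "\<nu> \<in> arrs C" "source C \<nu> = A \<otimes> S" "target C \<nu> = S" "\<mu> \<in> arrs C" "source C \<mu> = S \<otimes> A" "target C \<mu> = S"
  by (simp_all add: ext_left_def ext_right_def)

lemma ext_unfold:
  "sl n (Box \<nu> [A, S] [S]) st = sl n SM (sl n I st)" "sl n (Box \<mu> [S, A] [S]) st = sl n SM (sl (Suc n) I st)"
proof -
  have 1: "sl n (Box \<nu> [A, S] [S]) (gds n [A, S] st) = sl n SM (sl n I (gds n [A, S] st))"
    using lift_eq[of "[(0, Box \<nu> [A, S] [S])]" "[A, S]" "[(0, SM), (0, I)]" n st]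
    by (simp add: ext_left_def)
  have 2: "sl n (Box \<mu> [S, A] [S]) (gds n [S, A] st) = sl n SM (sl (Suc n) I (gds n [S, A] st))"
    using lift_eq[of "[(0, Box \<mu> [S, A] [S])]" "[S, A]" "[(0, SM), (1, I)]" n st]
    by (simp add: ext_right_def)
  from 1 2 show "sl n (Box \<nu> [A, S] [S]) st = sl n SM (sl n I st)" "sl n (Box \<mu> [S, A] [S]) st = sl n SM (sl (Suc n) I st)"
    by (simp_all add: gout)
qed

lemma bimodule_ext: "bimodule C A m \<eta> (S, \<nu>, \<mu>)"
proof -
  have 1: "run [(0, SM), (0, I), (1, SM), (1, I)] (start [A, A, S]) = run [(0, SM), (0, I), (0, M)] (start [A, A, S])"
    by (simp add: snf)
  have 2: "run [(0, SM), (0, I), (0, E)] (start [S]) = run [] (start [S])" by (simp add: snf)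
  have 3: "run [(0, SM), (1, I), (0, SM), (1, I)] (start [S, A, A]) = run [(0, SM), (1, I), (1, M)] (start [S, A, A])"
    by (simp add: snf)
  have 4: "run [(0, SM), (1, I), (1, E)] (start [S]) = run [] (start [S])" by (simp add: snf)
  have 5: "run [(0, SM), (0, I), (1, SM), (2, I)] (start [A, S, A]) = run [(0, SM), (1, I), (0, SM), (0, I)] (start [A, S, A])"
    by (simp add: snf)
  show ?thesis
    using diagram_eq[OF 1] diagram_eq[OF 2] diagram_eq[OF 3] diagram_eq[OF 4] diagram_eq[OF 5]
    by (simp add: bimodule_def left_module_def right_module_def ext_left_def ext_right_def hom_def)
qed

section \<open>The tensor square of \<open>S\<close> over \<open>A\<close> as an
  \<open>S\<close>-bimodule\<close>

abbreviation "q \<equiv> ext_q C S mS i"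
abbreviation "T \<equiv> target C q"
abbreviation "lT \<equiv> induced C (A \<triangleleft> q) (q \<cdot> (\<nu> \<triangleright> S))"
abbreviation "rT \<equiv> induced C (q \<triangleright> A) (q \<cdot> (S \<triangleleft> \<mu>))"

lemma tens_ext: "tens (S, \<nu>, \<mu>) (S, \<nu>, \<mu>) q (T, lT, rT)"
  using tensI[OF bimodule_ext bimodule_ext]
  by (simp add: bimod_q_def bimod_tensor_def ext_q_def Let_def)

lemmas tq = tensD[OF tens_ext]

lemma T_facts [simp]:
  "T \<in> objs C" "q \<in> arrs C" "source C q = S \<otimes> S"
  "lT \<in> arrs C" "source C lT = A \<otimes> T" "target C lT = T" "rT \<in> arrs C" "source C rT = T \<otimes> A" "target C rT = T"
  using tq(4-6,8-13) by simp_all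

abbreviation "QT \<equiv> Box q [S, S] [T]"

lemma QT_balanced: "sl n QT (sl n SM (sl (Suc n) I st)) = sl n QT (sl (Suc n) SM (sl (Suc n) I st))"
  using tq(14) by (simp add: ext_unfold)

abbreviation "mbar \<equiv> induced C q mS"
abbreviation "nuT \<equiv> induced C (S \<triangleleft> q) (q \<cdot> (mS \<triangleright> S))"
abbreviation "muT \<equiv> induced C (q \<triangleright> S) (q \<cdot> (S \<triangleleft> mS))"

lemma T_induced:
  "mbar \<in> hom C T S" "mbar \<cdot> q = mS" "nuT \<in> hom C (S \<otimes> T) T" "nuT \<cdot> (S \<triangleleft> q) = q \<cdot> (mS \<triangleright> S)"
  "muT \<in> hom C (T \<otimes> S) T" "muT \<cdot> (q \<triangleright> S) = q \<cdot> (S \<triangleleft> mS)"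
proof -
  have 1: "run [(0, SM), (0, SM), (1, I)] (start [S, A, S]) = run [(0, SM), (1, SM), (1, I)] (start [S, A, S])"
    by (simp add: snf)
  show "mbar \<in> hom C T S" "mbar \<cdot> q = mS"
    using induced_coequalizer[OF tq(21), of mS S] diagram_eq[OF 1]
    by (simp_all add: hom_def ext_left_def ext_right_def)
  have 2: "run [(0, QT), (0, SM), (1, SM), (2, I)] (start [S, S, A, S]) =
      run [(0, QT), (0, SM), (2, SM), (2, I)] (start [S, S, A, S])"
    by (simp add: snf QT_balanced)
  show "nuT \<in> hom C (S \<otimes> T) T" "nuT \<cdot> (S \<triangleleft> q) = q \<cdot> (mS \<triangleright> S)"
    using induced_coequalizer[OF tq(22)[of S], of "q \<cdot> (mS \<triangleright> S)" T] diagram_eq[OF 2]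
    by (simp_all add: hom_def ext_left_def ext_right_def)
  have 3: "run [(0, QT), (1, SM), (0, SM), (1, I)] (start [S, A, S, S]) =
      run [(0, QT), (1, SM), (1, SM), (1, I)] (start [S, A, S, S])"
  proof -
    \<comment> \<open>The product of the last two factors is applied first, which places the action
      of \<open>A\<close> directly under \<open>QT\<close>, where the balancing relation
      applies.\<close>
    let ?st = "start [S, A, S, S]"
    have "sl 0 QT (sl 1 SM (sl 0 SM (sl 1 I ?st))) = sl 0 QT (sl 0 SM (sl 1 I (sl 2 SM ?st)))"
      by (simp add: nf)
    also have "\<dots> = sl 0 QT (sl 1 SM (sl 1 I (sl 2 SM ?st)))" using QT_balanced[of 0] by simp
    also have "\<dots> = sl 0 QT (sl 1 SM (sl 1 SM (sl 1 I ?st)))" by (simp add: snf)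
    finally show ?thesis by simp
  qed
  show "muT \<in> hom C (T \<otimes> S) T" "muT \<cdot> (q \<triangleright> S) = q \<cdot> (S \<triangleleft> mS)"
    using induced_coequalizer[OF tq(23)[of S], of "q \<cdot> (S \<triangleleft> mS)" T] diagram_eq[OF 3]
    by (simp_all add: hom_def ext_left_def ext_right_def)
qed

lemma T_induced_facts [simp]:
  "mbar \<in> arrs C" "source C mbar = T" "target C mbar = S"
  "nuT \<in> arrs C" "source C nuT = S \<otimes> T" "target C nuT = T"
  "muT \<in> arrs C" "source C muT = T \<otimes> S" "target C muT = T"
  using homD[OF T_induced(1)] homD[OF T_induced(3)] homD[OF T_induced(5)] by simp_all

abbreviation "MB \<equiv> Box mbar [T] [S]"
abbreviation "NT \<equiv> Box nuT [S, T] [T]"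
abbreviation "MT \<equiv> Box muT [T, S] [T]"

lemma QT_rules:
  "sl n MB (sl n QT st) = sl n SM st"
  "sl n NT (sl (Suc n) QT st) = sl n QT (sl n SM st)"
  "sl n MT (sl n QT st) = sl n QT (sl (Suc n) SM st)"
  using lift_eq[of "[(0, MB), (0, QT)]" "[S, S]" "[(0, SM)]" n st]
    lift_eq[of "[(0, NT), (1, QT)]" "[S, S, S]" "[(0, QT), (0, SM)]" n st]
    lift_eq[of "[(0, MT), (0, QT)]" "[S, S, S]" "[(0, QT), (1, SM)]" n st] T_induced(2,4,6)
  by (simp_all add: gout)

lemma T_eqs:
  "muT \<cdot> (muT \<triangleright> S) = muT \<cdot> (T \<triangleleft> mS)" "muT \<cdot> (T \<triangleleft> uS) = ident C T"
  "nuT \<cdot> (S \<triangleleft> nuT) = nuT \<cdot> (mS \<triangleright> T)" "nuT \<cdot> (uS \<triangleright> T) = ident C T"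
  "nuT \<cdot> (S \<triangleleft> muT) = muT \<cdot> (nuT \<triangleright> S)"
  "mbar \<cdot> nuT = mS \<cdot> (S \<triangleleft> mbar)" "mbar \<cdot> muT = mS \<cdot> (mbar \<triangleright> S)"
proof -
  note rules = QT_rules S_rules gin
  have 1: "run [(0, MT), (0, MT), (0, QT)] (start [S, S, S, S]) = run [(0, MT), (1, SM), (0, QT)] (start [S, S, S, S])"
    by (simp add: rules bubble[of _ QT _ SM])
  have 2: "run [(0, MT), (1, US), (0, QT)] (start [S, S]) = run [(0, QT)] (start [S, S])"
    by (simp add: rules bubble[of _ QT _ US])
  have 3: "run [(0, NT), (1, NT), (2, QT)] (start [S, S, S, S]) = run [(0, NT), (0, SM), (2, QT)] (start [S, S, S, S])"
    by (simp add: rules exchange[of _ SM _ QT])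
  have 4: "run [(0, NT), (0, US), (0, QT)] (start [S, S]) = run [(0, QT)] (start [S, S])"
    by (simp add: rules exchange[of _ US _ QT])
  have 5: "run [(0, NT), (1, MT), (1, QT)] (start [S, S, S, S]) = run [(0, MT), (0, NT), (1, QT)] (start [S, S, S, S])"
    by (simp add: rules exchange[of _ SM _ SM])
  have 6: "run [(0, MB), (0, NT), (1, QT)] (start [S, S, S]) = run [(0, SM), (1, MB), (1, QT)] (start [S, S, S])"
    by (simp add: rules)
  have 7: "run [(0, MB), (0, MT), (0, QT)] (start [S, S, S]) = run [(0, SM), (0, MB), (0, QT)] (start [S, S, S])"
    by (simp add: rules)
  show "muT \<cdot> (muT \<triangleright> S) = muT \<cdot> (T \<triangleleft> mS)"
    by (rule epiD[OF tq(19)[of "S \<otimes> S"]]) (use diagram_eq[OF 1] in simp_all)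
  show "muT \<cdot> (T \<triangleleft> uS) = ident C T"
    by (rule epiD[OF tq(17)]) (use diagram_eq[OF 2] in simp_all)
  show "nuT \<cdot> (S \<triangleleft> nuT) = nuT \<cdot> (mS \<triangleright> T)"
    by (rule epiD[OF tq(18)[of "S \<otimes> S"]]) (use diagram_eq[OF 3] in simp_all)
  show "nuT \<cdot> (uS \<triangleright> T) = ident C T"
    by (rule epiD[OF tq(17)]) (use diagram_eq[OF 4] in simp_all)
  show "nuT \<cdot> (S \<triangleleft> muT) = muT \<cdot> (nuT \<triangleright> S)"
    by (rule epiD[OF tq(20)[of S S]]) (use diagram_eq[OF 5] in simp_all)
  show "mbar \<cdot> nuT = mS \<cdot> (S \<triangleleft> mbar)"
    by (rule epiD[OF tq(18)[of S]]) (use diagram_eq[OF 6] in simp_all)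
  show "mbar \<cdot> muT = mS \<cdot> (mbar \<triangleright> S)"
    by (rule epiD[OF tq(19)[of S]]) (use diagram_eq[OF 7] in simp_all)
qed

lemma T_rules:
  "sl n MT (sl (Suc n) SM st) = sl n MT (sl n MT st)" "sl n MT (sl (Suc n) US st) = gd n T st"
  "sl n NT (sl n SM st) = sl n NT (sl (Suc n) NT st)" "sl n NT (sl n US st) = gd n T st"
  "sl n NT (sl (Suc n) MT st) = sl n MT (sl n NT st)"
  "sl n MB (sl n NT st) = sl n SM (sl (Suc n) MB st)" "sl n MB (sl n MT st) = sl n SM (sl n MB st)"
  using lift_eq[of "[(0, MT), (1, SM)]" "[T, S, S]" "[(0, MT), (0, MT)]" n st]
    lift_eq[of "[(0, MT), (1, US)]" "[T]" "[]" n st]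
    lift_eq[of "[(0, NT), (0, SM)]" "[S, S, T]" "[(0, NT), (1, NT)]" n st]
    lift_eq[of "[(0, NT), (0, US)]" "[T]" "[]" n st]
    lift_eq[of "[(0, NT), (1, MT)]" "[S, T, S]" "[(0, MT), (0, NT)]" n st]
    lift_eq[of "[(0, MB), (0, NT)]" "[S, T]" "[(0, SM), (1, MB)]" n st]
    lift_eq[of "[(0, MB), (0, MT)]" "[T, S]" "[(0, SM), (0, MB)]" n st] T_eqs
  by (simp_all add: gout)

definition bilinear_section :: "'a \<Rightarrow> bool" where
  "bilinear_section \<sigma> \<longleftrightarrow> \<sigma> \<in> hom C S T \<and> mbar \<cdot> \<sigma> = ident C S \<and>
    \<sigma> \<cdot> mS = nuT \<cdot> (S \<triangleleft> \<sigma>) \<and> \<sigma> \<cdot> mS = muT \<cdot> (\<sigma> \<triangleright> S)"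

lemma separable_extension_iff_section:
  "separable_extension C A m \<eta> S mS uS i \<longleftrightarrow> (\<exists>\<sigma>. bilinear_section \<sigma>)"
  using alg algS mor unfolding separable_extension_def bilinear_section_def bilinear_def Let_def by auto

definition casimir_element :: "'a \<Rightarrow> bool" where
  "casimir_element e \<longleftrightarrow> e \<in> hom C \<one> T \<and> nuT \<cdot> (S \<triangleleft> e) = muT \<cdot> (e \<triangleright> S) \<and> mbar \<cdot> e = uS"

text \<open>A Casimir element \<open>e\<close> gives the section \<open>s \<mapsto> e s\<close>,
  which by centrality is also \<open>s \<mapsto> s e\<close>. Each expression makes linearity on one
  side an instance of associativity of an action.\<close>

lemma ex_section_iff_ex_casimir_element: "(\<exists>\<sigma>. bilinear_section \<sigma>) \<longleftrightarrow> (\<exists>e. casimir_element e)"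
proof
  assume "\<exists>\<sigma>. bilinear_section \<sigma>"
  then obtain \<sigma> where h: "\<sigma> \<in> hom C S T" and eqs: "mbar \<cdot> \<sigma> = ident C S"
    "\<sigma> \<cdot> mS = nuT \<cdot> (S \<triangleleft> \<sigma>)" "\<sigma> \<cdot> mS = muT \<cdot> (\<sigma> \<triangleright> S)"
    unfolding bilinear_section_def by blast
  note [simp] = homD(1-3)[OF h]
  let ?s = "Box \<sigma> [S] [T]"
  have r: "sl n MB (sl n ?s st) = gd n S st" "sl n NT (sl (Suc n) ?s st) = sl n ?s (sl n SM st)"
    "sl n MT (sl n ?s st) = sl n ?s (sl n SM st)" for n st
    using lift_eq[of "[(0, MB), (0, ?s)]" "[S]" "[]" n st]
      lift_eq[of "[(0, NT), (1, ?s)]" "[S, S]" "[(0, ?s), (0, SM)]" n st]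
      lift_eq[of "[(0, MT), (0, ?s)]" "[S, S]" "[(0, ?s), (0, SM)]" n st] eqs(1) eqs(2,3)[symmetric]
    by (simp_all add: gout)
  have 1: "run [(0, NT), (1, ?s), (1, US)] (start [S]) = run [(0, MT), (0, ?s), (0, US)] (start [S])"
    by (simp add: r S_rules gin)
  have 2: "run [(0, MB), (0, ?s), (0, US)] (start []) = run [(0, US)] (start [])"
    by (simp add: r gin)
  show "\<exists>e. casimir_element e"
    using diagram_eq[OF 1] diagram_eq[OF 2]
    by (intro exI[of _ "\<sigma> \<cdot> uS"]) (simp add: casimir_element_def hom_def)
next
  assume "\<exists>e. casimir_element e"
  then obtain e where h: "e \<in> hom C \<one> T" and eqs: "nuT \<cdot> (S \<triangleleft> e) = muT \<cdot> (e \<triangleright> S)" "mbar \<cdot> e = uS"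
    unfolding casimir_element_def by blast
  note [simp] = homD(1-3)[OF h]
  let ?e = "Box e [] [T]"
  have r: "sl n NT (sl (Suc n) ?e st) = sl n MT (sl n ?e st)" "sl n MB (sl n ?e st) = sl n US st" for n st
    using lift_eq[of "[(0, NT), (1, ?e)]" "[S]" "[(0, MT), (0, ?e)]" n st]
      lift_eq[of "[(0, MB), (0, ?e)]" "[]" "[(0, US)]" n st] eqs
    by (simp_all add: gout)
  have 1: "run [(0, MB), (0, MT), (0, ?e)] (start [S]) = run [] (start [S])"
    by (simp add: r T_rules S_rules gin)
  have 2: "run [(0, MT), (0, ?e), (0, SM)] (start [S, S]) = run [(0, MT), (0, MT), (0, ?e)] (start [S, S])"
    by (simp add: T_rules exchange[of _ ?e _ SM])
  have 3: "run [(0, MT), (0, ?e), (0, SM)] (start [S, S]) = run [(0, NT), (1, MT), (1, ?e)] (start [S, S])"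
  proof -
    let ?st = "start [S, S]"
    have "sl 0 MT (sl 0 ?e (sl 0 SM ?st)) = sl 0 NT (sl 1 ?e (sl 0 SM ?st))" by (simp add: r)
    also have "\<dots> = sl 0 NT (sl 0 SM (sl 2 ?e ?st))" by (simp add: bubble[of _ SM _ ?e])
    also have "\<dots> = sl 0 NT (sl 1 NT (sl 2 ?e ?st))" by (simp add: T_rules)
    also have "\<dots> = sl 0 NT (sl 1 MT (sl 1 ?e ?st))" using r(1)[of 1] by simp
    finally show ?thesis by simp
  qed
  show "\<exists>\<sigma>. bilinear_section \<sigma>"
    using diagram_eq[OF 1] diagram_eq[OF 2] diagram_eq[OF 3] eqs(1)
    by (intro exI[of _ "muT \<cdot> (e \<triangleright> S)"]) (simp add: bilinear_section_def hom_def)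
qed

text \<open>On representatives both actions multiply an outer factor by an element of
  \<open>A\<close>. Hence the bimodule structure of the tensor product is restricted from
  \<open>S\<close>, and \<open>S\<close>-bilinear maps are arrows of
  \<open>bimodules\<close>.\<close>

lemma lT_eq: "lT = nuT \<cdot> (i \<triangleright> T)" and rT_eq: "rT = muT \<cdot> (T \<triangleleft> i)"
proof -
  note rules = QT_rules tq(15,16) ext_unfold gin
  have 1: "run [(0, Box lT [A, T] [T]), (1, QT)] (start [A, S, S]) = run [(0, NT), (0, I), (1, QT)] (start [A, S, S])"
    by (simp add: rules exchange[of _ I _ QT])
  have 2: "run [(0, Box rT [T, A] [T]), (0, QT)] (start [S, S, A]) = run [(0, MT), (1, I), (0, QT)] (start [S, S, A])"
    by (simp add: rules bubble[of _ QT _ I])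
  show "lT = nuT \<cdot> (i \<triangleright> T)"
    by (rule epiD[OF tq(18)[of A]]) (use diagram_eq[OF 1] in simp_all)
  show "rT = muT \<cdot> (T \<triangleleft> i)"
    by (rule epiD[OF tq(19)[of A]]) (use diagram_eq[OF 2] in simp_all)
qed

lemma lT_unfold: "sl n (Box lT [A, T] [T]) st = sl n NT (sl n I st)"
  and rT_unfold: "sl n (Box rT [T, A] [T]) st = sl n MT (sl (Suc n) I st)"
proof -
  have 1: "sl n (Box lT [A, T] [T]) (gds n [A, T] st) = sl n NT (sl n I (gds n [A, T] st))"
    using lift_eq[of "[(0, Box lT [A, T] [T])]" "[A, T]" "[(0, NT), (0, I)]" n st] lT_eq
    by simp
  have 2: "sl n (Box rT [T, A] [T]) (gds n [T, A] st) = sl n MT (sl (Suc n) I (gds n [T, A] st))"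
    using lift_eq[of "[(0, Box rT [T, A] [T])]" "[T, A]" "[(0, MT), (1, I)]" n st] rT_eq
    by simp
  from 1 2 show "sl n (Box lT [A, T] [T]) st = sl n NT (sl n I st)"
    "sl n (Box rT [T, A] [T]) st = sl n MT (sl (Suc n) I st)"
    by (simp_all add: gout)
qed

lemma section_bilinear:
  assumes "bilinear_section \<sigma>" shows "bilinear C A (S, \<nu>, \<mu>) (T, lT, rT) \<sigma>"
proof -
  have h: "\<sigma> \<in> hom C S T" and eqs: "\<sigma> \<cdot> mS = nuT \<cdot> (S \<triangleleft> \<sigma>)" "\<sigma> \<cdot> mS = muT \<cdot> (\<sigma> \<triangleright> S)"
    using assms unfolding bilinear_section_def by blast+
  note [simp] = homD(1-3)[OF h]
  let ?s = "Box \<sigma> [S] [T]"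
  have r: "sl n ?s (sl n SM st) = sl n NT (sl (Suc n) ?s st)" "sl n ?s (sl n SM st) = sl n MT (sl n ?s st)" for n st
    using lift_eq[of "[(0, ?s), (0, SM)]" "[S, S]" "[(0, NT), (1, ?s)]" n st]
      lift_eq[of "[(0, ?s), (0, SM)]" "[S, S]" "[(0, MT), (0, ?s)]" n st] eqs
    by (simp_all add: gout)
  have 1: "run [(0, ?s), (0, SM), (0, I)] (start [A, S]) = run [(0, NT), (0, I), (1, ?s)] (start [A, S])"
    by (simp add: r(1) exchange[of _ I _ ?s])
  have 2: "run [(0, ?s), (0, SM), (1, I)] (start [S, A]) = run [(0, MT), (1, I), (0, ?s)] (start [S, A])"
    by (simp add: r(2) bubble[of _ ?s _ I])
  have "\<sigma> \<cdot> \<nu> = lT \<cdot> (A \<triangleleft> \<sigma>)" unfolding lT_eq unfolding ext_left_def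
    using diagram_eq[OF 1] by simp
  moreover have "\<sigma> \<cdot> \<mu> = rT \<cdot> (\<sigma> \<triangleright> A)" unfolding rT_eq unfolding ext_right_def
    using diagram_eq[OF 2] by simp
  ultimately show ?thesis using h by (simp add: bilinear_def)
qed

section \<open>Separable rings in the category of bimodules\<close>

lemma bimodule_unit: "bimodule C A m \<eta> (A, m, m)"
  using alg_eqs by (simp add: bimodule_def left_module_def right_module_def hom_def)

lemma bilinear_mbar: "bilinear C A (T, lT, rT) (S, \<nu>, \<mu>) mbar"
proof -
  have 1: "run [(0, MB), (0, NT), (0, I)] (start [A, T]) = run [(0, SM), (0, I), (1, MB)] (start [A, T])"
    by (simp add: T_rules exchange[of _ I _ MB])
  have 2: "run [(0, MB), (0, MT), (1, I)] (start [T, A]) = run [(0, SM), (1, I), (0, MB)] (start [T, A])"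
    by (simp add: T_rules bubble[of _ MB _ I])
  have "mbar \<cdot> lT = \<nu> \<cdot> (A \<triangleleft> mbar)" unfolding lT_eq unfolding ext_left_def
    using diagram_eq[OF 1] by simp
  moreover have "mbar \<cdot> rT = \<mu> \<cdot> (mbar \<triangleright> A)" unfolding rT_eq unfolding ext_right_def
    using diagram_eq[OF 2] by simp
  ultimately show ?thesis using T_induced(1) by (simp add: bilinear_def)
qed

lemma bilinear_i: "bilinear C A (A, m, m) (S, \<nu>, \<mu>) i"
proof -
  have 1: "run [(0, I), (0, M)] (start [A, A]) = run [(0, SM), (0, I), (1, I)] (start [A, A])"
    by (simp add: S_rules)
  have 2: "run [(0, I), (0, M)] (start [A, A]) = run [(0, SM), (1, I), (0, I)] (start [A, A])"
    by (simp add: S_rules exchange[of _ I _ I])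
  show ?thesis using diagram_eq[OF 1] diagram_eq[OF 2]
    by (simp add: bilinear_def hom_def ext_left_def ext_right_def)
qed

text \<open>In bimodules the ring acts on its square through the multiplication whiskered on one
  side and an associator. Composed with the quotient maps these actions are \<open>nuT\<close> and
  \<open>muT\<close>, so cancelling epis translates linearity over the ring into linearity over
  \<open>S\<close>.\<close>

lemma separable_ring_iff_section: "separable_ring C A m \<eta> S mS i \<longleftrightarrow> (\<exists>\<sigma>. bilinear_section \<sigma>)"
proof -
  let ?B = "bimodules C A m \<eta>" and ?R = "(S, \<nu>, \<mu>)" and ?TT = "(T, lT, rT)" and ?A = "(A, m, m)"
  have RR: "bimod_tensor C A ?R ?R = ?TT" "bimod_q C ?R ?R = q" using tens_ext unfolding tens_def by metis+
  define qU where "qU = bimod_q C ?TT ?R"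
  define qW where "qW = bimod_q C ?R ?TT"
  define qA where "qA = bimod_q C ?A ?R"
  define qB where "qB = bimod_q C ?R ?A"
  \<comment> \<open>\<open>U\<close> and \<open>W\<close> are the two bracketings of the threefold
    product; \<open>V\<close> and \<open>V'\<close> are the products with the unit bimodule on the
    left and on the right.\<close>
  obtain U lU rU where U: "bimod_tensor C A ?TT ?R = (U, lU, rU)" by (metis surj_pair)
  obtain W lW rW where W: "bimod_tensor C A ?R ?TT = (W, lW, rW)" by (metis surj_pair)
  obtain V lV rV where V: "bimod_tensor C A ?A ?R = (V, lV, rV)" by (metis surj_pair)
  obtain V' lV' rV' where V': "bimod_tensor C A ?R ?A = (V', lV', rV')" by (metis surj_pair)
  have tU: "tens ?TT ?R qU (U, lU, rU)" using tensI[OF tq(3) bimodule_ext] U by (simp add: qU_def)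
  have tW: "tens ?R ?TT qW (W, lW, rW)" using tensI[OF bimodule_ext tq(3)] W by (simp add: qW_def)
  have tA: "tens ?A ?R qA (V, lV, rV)" using tensI[OF bimodule_unit bimodule_ext] V by (simp add: qA_def)
  have tB: "tens ?R ?A qB (V', lV', rV')" using tensI[OF bimodule_ext bimodule_unit] V' by (simp add: qB_def)
  note DU = tensD[OF tU] and DW = tensD[OF tW] and DA = tensD[OF tA] and DB = tensD[OF tB]
  note [simp] = DU(4-7) DW(4-7) DA(4-7) DB(4-7)
  obtain \<alpha> \<beta> where ab: "bilinear C A (U, lU, rU) (W, lW, rW) \<alpha>" "bilinear C A (W, lW, rW) (U, lU, rU) \<beta>"
    "\<alpha> \<in> hom C U W" "\<beta> \<in> hom C W U"
    "\<alpha> \<cdot> qU \<cdot> (q \<triangleright> S) = qW \<cdot> (S \<triangleleft> q)" "\<beta> \<cdot> qW \<cdot> (S \<triangleleft> q) = qU \<cdot> (q \<triangleright> S)"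
    "induced C (qU \<cdot> (q \<triangleright> S)) (qW \<cdot> (S \<triangleleft> q)) = \<alpha>" "\<beta> \<cdot> \<alpha> = ident C U" "\<alpha> \<cdot> \<beta> = ident C W"
    using associatorD[OF tens_ext tens_ext tU tW] by blast
  note [simp] = homD(1-3)[OF ab(3)] homD(1-3)[OF ab(4)]
  have ass: "associator ?B ?R ?R ?R = ((U, lU, rU), \<alpha>, (W, lW, rW))"
    using ab(7) by (simp add: bimod_simps RR U W flip: qU_def qW_def)
  have inv: "inverse_arr ?B ((U, lU, rU), \<alpha>, (W, lW, rW)) = ((W, lW, rW), \<beta>, (U, lU, rU))"
    using bimodules_inverse[OF DU(3) DW(3) ab(1,2)] ab(8,9) by simp
  let ?QU = "Box qU [T, S] [U]" and ?QW = "Box qW [S, T] [W]" and ?AL = "Box \<alpha> [U] [W]" and ?BE = "Box \<beta> [W] [U]"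
  have rAB: "sl n ?AL (sl n ?QU (sl n QT st)) = sl n ?QW (sl (Suc n) QT st)"
    "sl n ?BE (sl n ?QW (sl (Suc n) QT st)) = sl n ?QU (sl n QT st)" for n st
    using lift_eq[of "[(0, ?AL), (0, ?QU), (0, QT)]" "[S, S, S]" "[(0, ?QW), (1, QT)]" n st]
      lift_eq[of "[(0, ?BE), (0, ?QW), (1, QT)]" "[S, S, S]" "[(0, ?QU), (0, QT)]" n st] ab(5,6)
    by (simp_all add: gout)
  \<comment> \<open>\<open>x1\<close> and \<open>x2\<close> are the multiplication whiskered with
    \<open>S\<close> over \<open>A\<close> on the right and on the left.\<close>
  define x1 where "x1 = induced C qU (q \<cdot> (mbar \<triangleright> S))"
  define x2 where "x2 = induced C qW (q \<cdot> (S \<triangleleft> mbar))"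
  have 1: "run [(0, QT), (0, MB), (0, MT), (1, I)] (start [T, A, S]) = run [(0, QT), (0, MB), (1, SM), (1, I)] (start [T, A, S])"
    by (simp add: T_rules QT_balanced nf)
  have x1: "x1 \<in> hom C U T" "x1 \<cdot> qU = q \<cdot> (mbar \<triangleright> S)"
    using induced_coequalizer[OF DU(21), of "q \<cdot> (mbar \<triangleright> S)" T] diagram_eq[OF 1]
    by (simp_all add: x1_def hom_def rT_eq ext_left_def)
  have 2: "run [(0, QT), (1, MB), (0, SM), (1, I)] (start [S, A, T]) = run [(0, QT), (1, MB), (1, NT), (1, I)] (start [S, A, T])"
    by (simp add: T_rules QT_balanced bubble[of _ _ _ MB])
  have x2: "x2 \<in> hom C W T" "x2 \<cdot> qW = q \<cdot> (S \<triangleleft> mbar)"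
    using induced_coequalizer[OF DW(21), of "q \<cdot> (S \<triangleleft> mbar)" T] diagram_eq[OF 2]
    by (simp_all add: x2_def hom_def lT_eq ext_right_def)
  note [simp] = homD(1-3)[OF x1(1)] homD(1-3)[OF x2(1)]
  let ?X1 = "Box x1 [U] [T]" and ?X2 = "Box x2 [W] [T]"
  have rX: "sl n ?X1 (sl n ?QU st) = sl n QT (sl n MB st)" "sl n ?X2 (sl n ?QW st) = sl n QT (sl (Suc n) MB st)" for n st
    using lift_eq[of "[(0, ?X1), (0, ?QU)]" "[T, S]" "[(0, QT), (0, MB)]" n st]
      lift_eq[of "[(0, ?X2), (0, ?QW)]" "[S, T]" "[(0, QT), (1, MB)]" n st] x1(2) x2(2)
    by (simp_all add: gout)
  \<comment> \<open>On representatives both sides send \<open>s \<otimes> (x \<otimes> y)\<close> to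
    \<open>s x \<otimes> y\<close>; the next fact is the mirror image.\<close>
  have XN: "x1 \<cdot> \<beta> \<cdot> qW = nuT"
  proof -
    have r: "run [(0, ?X1), (0, ?BE), (0, ?QW), (1, QT)] (start [S, S, S]) = run [(0, NT), (1, QT)] (start [S, S, S])"
      by (simp add: rAB rX QT_rules)
    show ?thesis
      by (rule epiD[OF tq(18)[of S]]) (use diagram_eq[OF r] in simp_all)
  qed
  have XM: "x2 \<cdot> \<alpha> \<cdot> qU = muT"
  proof -
    have r: "run [(0, ?X2), (0, ?AL), (0, ?QU), (0, QT)] (start [S, S, S]) = run [(0, MT), (0, QT)] (start [S, S, S])"
      by (simp add: rAB rX QT_rules)
    show ?thesis
      by (rule epiD[OF tq(19)[of S]]) (use diagram_eq[OF r] in simp_all)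
  qed
  let ?mm = "(?TT, mbar, ?R)" and ?uu = "(?A, i, ?R)"
  have w1: "?mm \<triangleright>\<^bsub>?B\<^esub> ?R = ((U, lU, rU), x1, ?TT)" "?R \<triangleleft>\<^bsub>?B\<^esub> ?mm = ((W, lW, rW), x2, ?TT)"
    by (simp_all add: bimod_simps RR U W x1_def x2_def flip: qU_def qW_def)
  have e1: "epi (qU \<cdot> (q \<triangleright> S))" by (rule epi_cmp) (simp_all add: DU(17) tq(19))
  have 3: "run [(0, MB), (0, ?X1), (0, ?QU), (0, QT)] (start [S, S, S]) =
      run [(0, MB), (0, ?X2), (0, ?AL), (0, ?QU), (0, QT)] (start [S, S, S])"
    by (simp add: rAB rX QT_rules S_rules)
  have assoc: "mbar \<cdot> x1 = mbar \<cdot> (x2 \<cdot> \<alpha>)"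
    by (rule epiD[OF e1]) (use diagram_eq[OF 3] in simp_all)
  have 4: "run [(0, QT), (0, I), (0, M)] (start [A, A, S]) = run [(0, QT), (0, I), (1, SM), (1, I)] (start [A, A, S])"
    by (simp add: S_rules QT_balanced nf)
  have z: "induced C qA (q \<cdot> (i \<triangleright> S)) \<in> hom C V T" "induced C qA (q \<cdot> (i \<triangleright> S)) \<cdot> qA = q \<cdot> (i \<triangleright> S)"
    using induced_coequalizer[OF DA(21), of "q \<cdot> (i \<triangleright> S)" T] diagram_eq[OF 4]
    by (simp_all add: hom_def ext_left_def)
  have 5: "run [(0, QT), (1, I), (0, SM), (1, I)] (start [S, A, A]) = run [(0, QT), (1, I), (1, M)] (start [S, A, A])"
  proof -
    let ?st = "start [S, A, A]"
    have "sl 0 QT (sl 1 I (sl 0 SM (sl 1 I ?st))) = sl 0 QT (sl 0 SM (sl 1 I (sl 2 I ?st)))"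
      by (simp add: bubble[of 0 SM] bubble[of "Suc 0" I "Suc (Suc 0)" I])
    also have "\<dots> = sl 0 QT (sl 1 SM (sl 1 I (sl 2 I ?st)))" using QT_balanced[of 0] by simp
    also have "\<dots> = sl 0 QT (sl 1 I (sl 1 M ?st))" using S_rules(4)[of 1] by simp
    finally show ?thesis by simp
  qed
  have z': "induced C qB (q \<cdot> (S \<triangleleft> i)) \<in> hom C V' T" "induced C qB (q \<cdot> (S \<triangleleft> i)) \<cdot> qB = q \<cdot> (S \<triangleleft> i)"
    using induced_coequalizer[OF DB(21), of "q \<cdot> (S \<triangleleft> i)" T] diagram_eq[OF 5]
    by (simp_all add: hom_def ext_right_def)
  note [simp] = homD(1-3)[OF z(1)] homD(1-3)[OF z'(1)]
  have mq: "mbar \<cdot> (q \<cdot> f) = mS \<cdot> f" if "f \<in> arrs C" "target C f = S \<otimes> S" for f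
    using T_induced(2) that by (simp flip: cmp_assoc_simp)
  \<comment> \<open>The left unitor is induced by the action of \<open>A\<close>, and this action is
    multiplication after \<open>i\<close>; so the unit law already holds before passing to the
    quotient. The right unitor is treated alike.\<close>
  have lu: "induced C qA \<nu> = mbar \<cdot> induced C qA (q \<cdot> (i \<triangleright> S))"
    by (rule induced_eqI[OF DA(17)]) (simp_all add: hom_def z(2) mq ext_left_def)
  have ru: "induced C qB \<mu> = mbar \<cdot> induced C qB (q \<cdot> (S \<triangleleft> i))"
    by (rule induced_eqI[OF DB(17)]) (simp_all add: hom_def z'(2) mq ext_right_def)
  have w2: "?uu \<triangleright>\<^bsub>?B\<^esub> ?R = ((V, lV, rV), induced C qA (q \<cdot> (i \<triangleright> S)), ?TT)"
    "?R \<triangleleft>\<^bsub>?B\<^esub> ?uu = ((V', lV', rV'), induced C qB (q \<cdot> (S \<triangleleft> i)), ?TT)"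
    "left_unitor ?B ?R = ((V, lV, rV), induced C qA \<nu>, ?R)"
    "right_unitor ?B ?R = ((V', lV', rV'), induced C qB \<mu>, ?R)"
    by (simp_all add: bimod_simps RR V V' flip: qA_def qB_def)
  have tt: "?R \<otimes>\<^bsub>?B\<^esub> ?R = ?TT" "\<one>\<^bsub>?B\<^esub> = ?A" by (simp_all add: bimod_simps RR)
  have algR: "algebra ?B ?R ?mm ?uu"
    unfolding algebra_def ass w1 w2 tt
    using bimodule_ext bimodule_unit tq(3) bilinear_mbar bilinear_i assoc lu ru
    by (simp add: bimod_simps bimod_hom)
  let ?sec = "\<lambda>\<tau>. ?mm \<cdot>\<^bsub>?B\<^esub> \<tau> = ident ?B ?R \<and>
      bilinear ?B ?R (?R, ?mm, ?mm) (?TT, (((U, lU, rU), x1, ?TT)) \<cdot>\<^bsub>?B\<^esub> ((W, lW, rW), \<beta>, (U, lU, rU)),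
        (((W, lW, rW), x2, ?TT)) \<cdot>\<^bsub>?B\<^esub> ((U, lU, rU), \<alpha>, (W, lW, rW))) \<tau>"
  have key: "?sec (?R, \<sigma>, ?TT) \<longleftrightarrow> bilinear_section \<sigma>"
    if b: "bilinear C A ?R ?TT \<sigma>" for \<sigma>
  proof -
    have h: "\<sigma> \<in> hom C S T" using bilinear_hom[OF b] by simp
    note [simp] = homD(1-3)[OF h]
    let ?s = "Box \<sigma> [S] [T]"
    have r: "sl n ?s (sl n SM (sl n I st)) = sl n NT (sl n I (sl (Suc n) ?s st))"
      "sl n ?s (sl n SM (sl (Suc n) I st)) = sl n MT (sl (Suc n) I (sl n ?s st))" for n st
      using lift_eq[of "[(0, ?s), (0, Box \<nu> [A, S] [S])]" "[A, S]" "[(0, Box lT [A, T] [T]), (1, ?s)]" n st]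
        lift_eq[of "[(0, ?s), (0, Box \<mu> [S, A] [S])]" "[S, A]" "[(0, Box rT [T, A] [T]), (0, ?s)]" n st] b
      by (simp_all add: gout bilinear_def ext_unfold lT_unfold rT_unfold)
    \<comment> \<open>Whiskering \<open>\<sigma>\<close> with \<open>S\<close> over \<open>A\<close>
      is well defined because \<open>\<sigma>\<close> commutes with the actions of \<open>A\<close>;
      \<open>7\<close> does the same on the other side.\<close>
    have 6: "run [(0, ?QW), (1, ?s), (0, SM), (1, I)] (start [S, A, S]) = run [(0, ?QW), (1, ?s), (1, SM), (1, I)] (start [S, A, S])"
      using DW(14)[of 0] by (simp add: r ext_unfold lT_unfold bubble[of _ _ _ ?s])
    have y: "induced C q (qW \<cdot> (S \<triangleleft> \<sigma>)) \<in> hom C T W" "induced C q (qW \<cdot> (S \<triangleleft> \<sigma>)) \<cdot> q = qW \<cdot> (S \<triangleleft> \<sigma>)"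
      using induced_coequalizer[OF tq(21), of "qW \<cdot> (S \<triangleleft> \<sigma>)" W] diagram_eq[OF 6]
      by (simp_all add: hom_def ext_left_def ext_right_def)
    have 7: "run [(0, ?QU), (0, ?s), (0, SM), (1, I)] (start [S, A, S]) = run [(0, ?QU), (0, ?s), (1, SM), (1, I)] (start [S, A, S])"
    proof -
      let ?st = "start [S, A, S]"
      have "sl 0 ?QU (sl 0 ?s (sl 0 SM (sl 1 I ?st))) = sl 0 ?QU (sl 0 MT (sl 1 I (sl 0 ?s ?st)))"
        using r(2)[of 0] by simp
      also have "\<dots> = sl 0 ?QU (sl 1 SM (sl 1 I (sl 0 ?s ?st)))"
        using DU(14)[of 0] by (simp add: ext_unfold rT_unfold)
      also have "\<dots> = sl 0 ?QU (sl 0 ?s (sl 1 SM (sl 1 I ?st)))" by (simp add: nf)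
      finally show ?thesis by simp
    qed
    have y': "induced C q (qU \<cdot> (\<sigma> \<triangleright> S)) \<in> hom C T U" "induced C q (qU \<cdot> (\<sigma> \<triangleright> S)) \<cdot> q = qU \<cdot> (\<sigma> \<triangleright> S)"
      using induced_coequalizer[OF tq(21), of "qU \<cdot> (\<sigma> \<triangleright> S)" U] diagram_eq[OF 7]
      by (simp_all add: hom_def ext_left_def ext_right_def)
    note [simp] = homD(1-3)[OF y(1)] homD(1-3)[OF y'(1)]
    have XNf: "x1 \<cdot> (\<beta> \<cdot> (qW \<cdot> f)) = nuT \<cdot> f" if "f \<in> arrs C" "target C f = S \<otimes> T" for f
      using XN that by (simp flip: cmp_assoc_simp)
    have XMf: "x2 \<cdot> (\<alpha> \<cdot> (qU \<cdot> f)) = muT \<cdot> f" if "f \<in> arrs C" "target C f = T \<otimes> S" for f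
      using XM that by (simp flip: cmp_assoc_simp)
    \<comment> \<open>Both sides start at \<open>T\<close>, so they may be compared after the epi
      \<open>q\<close>; there they become the two sides of the law over \<open>S\<close>.\<close>
    have 8: "\<sigma> \<cdot> mbar = x1 \<cdot> (\<beta> \<cdot> induced C q (qW \<cdot> (S \<triangleleft> \<sigma>))) \<longleftrightarrow> \<sigma> \<cdot> mS = nuT \<cdot> (S \<triangleleft> \<sigma>)"
    proof -
      have "(\<sigma> \<cdot> mbar) \<cdot> q = \<sigma> \<cdot> mS"
        "(x1 \<cdot> (\<beta> \<cdot> induced C q (qW \<cdot> (S \<triangleleft> \<sigma>)))) \<cdot> q = nuT \<cdot> (S \<triangleleft> \<sigma>)"
        using y(2) T_induced(2) by (simp_all add: XNf)
      then show ?thesis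
        using epiD[OF tq(17), of "\<sigma> \<cdot> mbar" "x1 \<cdot> (\<beta> \<cdot> induced C q (qW \<cdot> (S \<triangleleft> \<sigma>)))"] by fastforce
    qed
    have 9: "\<sigma> \<cdot> mbar = x2 \<cdot> (\<alpha> \<cdot> induced C q (qU \<cdot> (\<sigma> \<triangleright> S))) \<longleftrightarrow> \<sigma> \<cdot> mS = muT \<cdot> (\<sigma> \<triangleright> S)"
    proof -
      have "(\<sigma> \<cdot> mbar) \<cdot> q = \<sigma> \<cdot> mS"
        "(x2 \<cdot> (\<alpha> \<cdot> induced C q (qU \<cdot> (\<sigma> \<triangleright> S)))) \<cdot> q = muT \<cdot> (\<sigma> \<triangleright> S)"
        using y'(2) T_induced(2) by (simp_all add: XMf)
      then show ?thesis
        using epiD[OF tq(17), of "\<sigma> \<cdot> mbar" "x2 \<cdot> (\<alpha> \<cdot> induced C q (qU \<cdot> (\<sigma> \<triangleright> S)))"] by fastforce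
    qed
    have w3: "?R \<triangleleft>\<^bsub>?B\<^esub> (?R, \<sigma>, ?TT) = (?TT, induced C q (qW \<cdot> (S \<triangleleft> \<sigma>)), (W, lW, rW))"
      "(?R, \<sigma>, ?TT) \<triangleright>\<^bsub>?B\<^esub> ?R = (?TT, induced C q (qU \<cdot> (\<sigma> \<triangleright> S)), (U, lU, rU))"
      by (simp_all add: bimod_simps RR U W flip: qU_def qW_def)
    show ?thesis
      unfolding bilinear_def prod.case w3 bilinear_section_def
      using b bimodule_ext tq(3) h 8 9 by (simp add: bimod_simps bimod_hom)
  qed
  have "separable_ring C A m \<eta> S mS i \<longleftrightarrow> (\<exists>\<tau>. ?sec \<tau>)"
    unfolding separable_ring_def ring_bimod_def Let_def separable_algebra_def RR ass inv w1 tt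
    using algR by simp
  also have "\<dots> \<longleftrightarrow> (\<exists>\<sigma>. bilinear_section \<sigma>)"
  proof
    assume "\<exists>\<sigma>. bilinear_section \<sigma>"
    then obtain \<sigma> where s: "bilinear_section \<sigma>" by blast
    \<comment> \<open>An arrow of \<open>bimodules\<close> has to be bilinear over \<open>A\<close>,
      which a section over \<open>S\<close> inherits by \<open>section_bilinear\<close>.\<close>
    show "\<exists>\<tau>. ?sec \<tau>"
      using key[OF section_bilinear[OF s]] s by blast
  next
    assume "\<exists>\<tau>. ?sec \<tau>"
    then obtain \<tau> where t: "?sec \<tau>" by blast
    have "\<tau> \<in> hom ?B ?R ?TT" using t by (simp add: bilinear_def)
    then obtain \<sigma> where "\<tau> = (?R, \<sigma>, ?TT)" "bilinear C A ?R ?TT \<sigma>" by (auto simp: bimod_hom)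
    then show "\<exists>\<sigma>. bilinear_section \<sigma>" using key t by blast
  qed
  finally show ?thesis .
qed

end

section \<open>Restriction of scalars and the equivalence theorem\<close>

lemma right_modules_simps:
  "objs (right_modules C K k e) = {(N, \<mu>). right_module C K k e N \<mu>}"
  "source (right_modules C K k e) (P, f, Q) = P"
  "target (right_modules C K k e) (P, f, Q) = Q"
  "ident (right_modules C K k e) P = (P, ident C (fst P), P)"
  "(Q', g, R) \<cdot>\<^bsub>right_modules C K k e\<^esub> (P, f, Q) = (P, g \<cdot>\<^bsub>C\<^esub> f, R)"
  by (simp_all add: right_modules_def split: prod.split)

lemma right_modules_hom:
  "F \<in> hom (right_modules C K k e) (N, \<mu>) (N', \<mu>') \<longleftrightarrow> (\<exists>f. F = ((N, \<mu>), f, (N', \<mu>')) \<and>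
    right_module C K k e N \<mu> \<and> right_module C K k e N' \<mu>' \<and> f \<in> hom C N N' \<and>
    f \<cdot>\<^bsub>C\<^esub> \<mu> = \<mu>' \<cdot>\<^bsub>C\<^esub> (f \<triangleright>\<^bsub>C\<^esub> K))"
  by (cases F) (auto simp: hom_def right_modules_def)

context algebra_extension
begin

section \<open>Restriction of scalars, and retractions from Casimir elements\<close>

lemma S_moduleD:
  assumes "right_module C S mS uS N \<kappa>"
  shows "N \<in> objs C" "\<kappa> \<in> arrs C" "source C \<kappa> = N \<otimes> S" "target C \<kappa> = N"
    "sl n (Box \<kappa> [N, S] [N]) (sl (Suc n) SM st) = sl n (Box \<kappa> [N, S] [N]) (sl n (Box \<kappa> [N, S] [N]) st)"
    "sl n (Box \<kappa> [N, S] [N]) (sl (Suc n) US st) = gd n N st"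
proof -
  interpret SS: strict_algebra C S mS uS by unfold_locales (rule algS)
  show "N \<in> objs C" "\<kappa> \<in> arrs C" "source C \<kappa> = N \<otimes> S" "target C \<kappa> = N"
    "sl n (Box \<kappa> [N, S] [N]) (sl (Suc n) SM st) = sl n (Box \<kappa> [N, S] [N]) (sl n (Box \<kappa> [N, S] [N]) st)"
    "sl n (Box \<kappa> [N, S] [N]) (sl (Suc n) US st) = gd n N st"
    using SS.right_moduleD[OF assms] by blast+
qed

lemma restrict_module:
  assumes "right_module C S mS uS N \<kappa>"
  shows "right_module C A m \<eta> N (\<kappa> \<cdot> (N \<triangleleft> i))"
proof -
  note K = S_moduleD[OF assms]
  note [simp] = K(1-4)
  let ?K = "Box \<kappa> [N, S] [N]"
  have 1: "run [(0, ?K), (1, I), (0, ?K), (1, I)] (start [N, A, A]) = run [(0, ?K), (1, I), (1, M)] (start [N, A, A])"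
    by (simp add: snf K)
  have 2: "run [(0, ?K), (1, I), (1, E)] (start [N]) = run [] (start [N])" by (simp add: snf K)
  show ?thesis using diagram_eq[OF 1] diagram_eq[OF 2]
    by (simp add: right_module_def hom_def)
qed

lemma restrict_linear:
  assumes "right_module C S mS uS N \<kappa>" "right_module C S mS uS N' \<kappa>'" "f \<in> hom C N N'"
    "f \<cdot> \<kappa> = \<kappa>' \<cdot> (f \<triangleright> S)"
  shows "f \<cdot> (\<kappa> \<cdot> (N \<triangleleft> i)) = \<kappa>' \<cdot> (N' \<triangleleft> i) \<cdot> (f \<triangleright> A)"
proof -
  note [simp] = S_moduleD(1-4)[OF assms(1)] S_moduleD(1-4)[OF assms(2)] homD(1-3)[OF assms(3)]
  let ?K = "Box \<kappa> [N, S] [N]" and ?K' = "Box \<kappa>' [N', S] [N']" and ?F = "Box f [N] [N']"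
  have r: "sl n ?F (sl n ?K st) = sl n ?K' (sl n ?F st)" for n st
    using lift_eq[of "[(0, ?F), (0, ?K)]" "[N, S]" "[(0, ?K'), (0, ?F)]" n st] assms(4)
    by (simp add: gout)
  have 1: "run [(0, ?F), (0, ?K), (1, I)] (start [N, A]) = run [(0, ?K'), (1, I), (0, ?F)] (start [N, A])"
    by (simp add: nf r)
  show ?thesis using diagram_eq[OF 1] by simp
qed

abbreviation "S_mods \<equiv> right_modules C S mS uS"
abbreviation "A_mods \<equiv> right_modules C A m \<eta>"

lemma restrict_functor: "is_functor S_mods A_mods (restrict_ob C i) (restrict_arr C i)"
  unfolding is_functor_def
proof (intro conjI ballI allI impI; (elim conjE)?)
  fix X assume "X \<in> objs S_mods"
  then show "restrict_ob C i X \<in> objs A_mods"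
    "restrict_arr C i (ident S_mods X) = ident A_mods (restrict_ob C i X)"
    by (auto simp: right_modules_simps restrict_ob_def restrict_arr_def restrict_module)
next
  fix X Y F assume "F \<in> hom S_mods X Y"
  then show "restrict_arr C i F \<in> hom A_mods (restrict_ob C i X) (restrict_ob C i Y)"
    by (cases X; cases Y)
      (auto simp: right_modules_hom restrict_ob_def restrict_arr_def restrict_module intro: restrict_linear)
next
  fix X Y Z F G assume "F \<in> hom S_mods X Y" "G \<in> hom S_mods Y Z"
  then show "restrict_arr C i (G \<cdot>\<^bsub>S_mods\<^esub> F) = restrict_arr C i G \<cdot>\<^bsub>A_mods\<^esub> restrict_arr C i F"
    by (cases X; cases Y; cases Z)
      (auto simp: right_modules_hom right_modules_simps restrict_arr_def)
qed

text \<open>On representatives this is \<open>n \<otimes> x \<otimes> y \<mapsto> f (n x) y\<close>.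
  The whole tensor square remains an input, so that the properties of a Casimir element can be used
  separately when it is inserted.\<close>

definition theta :: "'o \<Rightarrow> 'a \<Rightarrow> 'a \<Rightarrow> 'a \<Rightarrow> 'a" where
  "theta N \<kappa> \<kappa>' f = induced C (N \<triangleleft> q) (\<kappa>' \<cdot> (f \<triangleright> S) \<cdot> (\<kappa> \<triangleright> S))"

text \<open>Linearity of \<open>f\<close> over \<open>A\<close> gives
  \<open>f (n x a) y = f (n x) (a y)\<close>, hence the formula is balanced. The last two rules say
  that an element of \<open>S\<close> may pass from \<open>n\<close> into the tensor square, and
  that the result is right linear over \<open>S\<close>.\<close>

lemma thetaD:
  assumes N: "right_module C S mS uS N \<kappa>" "right_module C S mS uS N' \<kappa>'" and f: "f \<in> hom C N N'"
    and lin: "f \<cdot> (\<kappa> \<cdot> (N \<triangleleft> i)) = \<kappa>' \<cdot> (N' \<triangleleft> i) \<cdot> (f \<triangleright> A)"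
  defines "TH \<equiv> Box (theta N \<kappa> \<kappa>' f) [N, T] [N']"
  shows "theta N \<kappa> \<kappa>' f \<in> hom C (N \<otimes> T) N'"
    "sl n TH (sl (Suc n) QT st) = sl n (Box \<kappa>' [N', S] [N']) (sl n (Box f [N] [N']) (sl n (Box \<kappa> [N, S] [N]) st))"
    "sl n TH (sl n (Box \<kappa> [N, S] [N]) st) = sl n TH (sl (Suc n) NT st)"
    "sl n TH (sl (Suc n) MT st) = sl n (Box \<kappa>' [N', S] [N']) (sl n TH st)"
proof -
  note K = S_moduleD[OF N(1)] and K' = S_moduleD[OF N(2)]
  note [simp] = K(1-4) K'(1-4) homD(1-3)[OF f]
  let ?K = "Box \<kappa> [N, S] [N]" and ?K' = "Box \<kappa>' [N', S] [N']" and ?F = "Box f [N] [N']"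
  have r: "sl n ?F (sl n ?K (sl (Suc n) I st)) = sl n ?K' (sl (Suc n) I (sl n ?F st))" for n st
    using lift_eq[of "[(0, ?F), (0, ?K), (1, I)]" "[N, A]" "[(0, ?K'), (1, I), (0, ?F)]" n st] lin
    by (simp add: gout)
  have 1: "run [(0, ?K'), (0, ?F), (0, ?K), (1, SM), (2, I)] (start [N, S, A, S]) =
      run [(0, ?K'), (0, ?F), (0, ?K), (2, SM), (2, I)] (start [N, S, A, S])"
    by (simp add: nf K(5) K'(5) r)
  have th: "theta N \<kappa> \<kappa>' f \<in> hom C (N \<otimes> T) N'" "theta N \<kappa> \<kappa>' f \<cdot> (N \<triangleleft> q) = \<kappa>' \<cdot> (f \<triangleright> S) \<cdot> (\<kappa> \<triangleright> S)"
    using induced_coequalizer[OF tq(22)[OF K(1)], of "\<kappa>' \<cdot> (f \<triangleright> S) \<cdot> (\<kappa> \<triangleright> S)" N'] diagram_eq[OF 1]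
    by (simp_all add: theta_def hom_def ext_left_def ext_right_def)
  show "theta N \<kappa> \<kappa>' f \<in> hom C (N \<otimes> T) N'" by (rule th(1))
  note [simp] = homD(1-3)[OF th(1)]
  have [simp]: "bdom TH = [N, T]" "bcod TH = [N']" "barr TH = theta N \<kappa> \<kappa>' f" "wfb TH" by (simp_all add: TH_def)
  show t: "sl n TH (sl (Suc n) QT st) = sl n ?K' (sl n ?F (sl n ?K st))" for n st
    using lift_eq[of "[(0, TH), (1, QT)]" "[N, S, S]" "[(0, ?K'), (0, ?F), (0, ?K)]" n st] th(2)
    by (simp add: gout)
  have 2: "run [(0, TH), (0, ?K), (2, QT)] (start [N, S, S, S]) = run [(0, TH), (1, NT), (2, QT)] (start [N, S, S, S])"
    by (simp add: t QT_rules K(5) exchange[of _ ?K _ QT])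
  have 3: "run [(0, TH), (1, MT), (1, QT)] (start [N, S, S, S]) = run [(0, ?K'), (0, TH), (1, QT)] (start [N, S, S, S])"
    by (simp add: t QT_rules nf K'(5))
  have e2: "theta N \<kappa> \<kappa>' f \<cdot> (\<kappa> \<triangleright> T) = theta N \<kappa> \<kappa>' f \<cdot> (N \<triangleleft> nuT)"
    by (rule epiD[OF tq(18)[of "N \<otimes> S"]]) (use diagram_eq[OF 2] in simp_all)
  have e3: "theta N \<kappa> \<kappa>' f \<cdot> (N \<triangleleft> muT) = \<kappa>' \<cdot> (theta N \<kappa> \<kappa>' f \<triangleright> S)"
    by (rule epiD[OF tq(20)[of N S]]) (use diagram_eq[OF 3] in simp_all)
  show "sl n TH (sl n ?K st) = sl n TH (sl (Suc n) NT st)"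
    using lift_eq[of "[(0, TH), (0, ?K)]" "[N, S, T]" "[(0, TH), (1, NT)]" n st] e2
    by (simp add: gout)
  show "sl n TH (sl (Suc n) MT st) = sl n ?K' (sl n TH st)"
    using lift_eq[of "[(0, TH), (1, MT)]" "[N, T, S]" "[(0, ?K'), (0, TH)]" n st] e3
    by (simp add: gout)
qed

text \<open>The element \<open>s\<close> in \<open>n s \<otimes> e\<close> moves to
  \<open>n \<otimes> s e\<close>, by centrality to \<open>n \<otimes> e s\<close>, and from there
  out of \<open>theta\<close> on the right.\<close>

lemma theta_linear:
  assumes e: "casimir_element e" and N: "right_module C S mS uS N \<kappa>" "right_module C S mS uS N' \<kappa>'"
    and f: "f \<in> hom C N N'" "f \<cdot> (\<kappa> \<cdot> (N \<triangleleft> i)) = \<kappa>' \<cdot> (N' \<triangleleft> i) \<cdot> (f \<triangleright> A)"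
  shows "theta N \<kappa> \<kappa>' f \<cdot> (N \<triangleleft> e) \<in> hom C N N'"
    "(theta N \<kappa> \<kappa>' f \<cdot> (N \<triangleleft> e)) \<cdot> \<kappa> = \<kappa>' \<cdot> ((theta N \<kappa> \<kappa>' f \<cdot> (N \<triangleleft> e)) \<triangleright> S)"
proof -
  have h: "e \<in> hom C \<one> T" and c: "nuT \<cdot> (S \<triangleleft> e) = muT \<cdot> (e \<triangleright> S)"
    using e unfolding casimir_element_def by auto
  note t = thetaD[OF N f]
  note [simp] = S_moduleD(1-4)[OF N(1)] S_moduleD(1-4)[OF N(2)] homD(1-3)[OF f(1)] homD(1-3)[OF h] homD(1-3)[OF t(1)]
  let ?K = "Box \<kappa> [N, S] [N]" and ?K' = "Box \<kappa>' [N', S] [N']" and ?e = "Box e [] [T]"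
    and ?TH = "Box (theta N \<kappa> \<kappa>' f) [N, T] [N']"
  have r: "sl n NT (sl (Suc n) ?e st) = sl n MT (sl n ?e st)" for n st
    using lift_eq[of "[(0, NT), (1, ?e)]" "[S]" "[(0, MT), (0, ?e)]" n st] c
    by (simp_all add: gout)
  have 1: "run [(0, ?TH), (1, ?e), (0, ?K)] (start [N, S]) = run [(0, ?K'), (0, ?TH), (1, ?e)] (start [N, S])"
    by (simp add: t r bubble[of _ ?K _ ?e])
  show "theta N \<kappa> \<kappa>' f \<cdot> (N \<triangleleft> e) \<in> hom C N N'" by (simp add: hom_def)
  show "(theta N \<kappa> \<kappa>' f \<cdot> (N \<triangleleft> e)) \<cdot> \<kappa> = \<kappa>' \<cdot> ((theta N \<kappa> \<kappa>' f \<cdot> (N \<triangleleft> e)) \<triangleright> S)"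
    using diagram_eq[OF 1] by simp
qed

text \<open>Linearity of \<open>g\<close> moves it past the inner action and linearity of
  \<open>h\<close> moves it past the outer one, for an arbitrary element \<open>e\<close>.\<close>

lemma theta_natural:
  assumes e: "e \<in> hom C \<one> T" and N: "right_module C S mS uS N \<kappa>" "right_module C S mS uS N' \<kappa>'"
    and f: "f \<in> hom C N N'" "f \<cdot> (\<kappa> \<cdot> (N \<triangleleft> i)) = \<kappa>' \<cdot> (N' \<triangleleft> i) \<cdot> (f \<triangleright> A)"
    and L: "right_module C S mS uS L \<rho>" and L': "right_module C S mS uS L' \<rho>'"
    and g: "g \<in> hom C L N" "g \<cdot> \<rho> = \<kappa> \<cdot> (g \<triangleright> S)" and h: "h \<in> hom C N' L'" "h \<cdot> \<kappa>' = \<rho>' \<cdot> (h \<triangleright> S)"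
  shows "theta L \<rho> \<rho>' (h \<cdot> f \<cdot> g) \<cdot> (L \<triangleleft> e) = h \<cdot> (theta N \<kappa> \<kappa>' f \<cdot> (N \<triangleleft> e)) \<cdot> g"
proof -
  note t = thetaD[OF N f]
  note [simp] = S_moduleD(1-4)[OF N(1)] S_moduleD(1-4)[OF N(2)] S_moduleD(1-4)[OF L] S_moduleD(1-4)[OF L']
    homD(1-3)[OF f(1)] homD(1-3)[OF e] homD(1-3)[OF t(1)] homD(1-3)[OF g(1)] homD(1-3)[OF h(1)]
  let ?K = "Box \<kappa> [N, S] [N]" and ?K' = "Box \<kappa>' [N', S] [N']" and ?e = "Box e [] [T]"
    and ?TH = "Box (theta N \<kappa> \<kappa>' f) [N, T] [N']" and ?L = "Box \<rho> [L, S] [L]" and ?L' = "Box \<rho>' [L', S] [L']"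
    and ?G = "Box g [L] [N]" and ?H = "Box h [N'] [L']" and ?F = "Box f [N] [N']"
  have r: "sl n ?K (sl n ?G st) = sl n ?G (sl n ?L st)" "sl n ?H (sl n ?K' st) = sl n ?L' (sl n ?H st)"
    "sl n ?F (sl n ?K (sl (Suc n) I st)) = sl n ?K' (sl (Suc n) I (sl n ?F st))" for n st
    using lift_eq[of "[(0, ?K), (0, ?G)]" "[L, S]" "[(0, ?G), (0, ?L)]" n st]
      lift_eq[of "[(0, ?H), (0, ?K')]" "[N', S]" "[(0, ?L'), (0, ?H)]" n st]
      lift_eq[of "[(0, ?F), (0, ?K), (1, I)]" "[N, A]" "[(0, ?K'), (1, I), (0, ?F)]" n st] f(2) g(2) h(2)
    by (simp_all add: gout)
  define f' where f': "f' = h \<cdot> f \<cdot> g"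
  have f'_hom: "f' \<in> hom C L L'" by (simp add: f' hom_def)
  note [simp] = homD(1-3)[OF f'_hom]
  let ?FF = "Box f' [L] [L']"
  have ff: "sl n ?FF st = sl n ?H (sl n ?F (sl n ?G st))" for n st
  proof -
    have "sl n ?FF (gds n [L] st) = sl n ?H (sl n ?F (sl n ?G (gds n [L] st)))"
      using lift_eq[of "[(0, ?FF)]" "[L]" "[(0, ?H), (0, ?F), (0, ?G)]" n st] by (simp add: f')
    then show ?thesis by (simp add: gout)
  qed
  have "h \<cdot> (f \<cdot> (g \<cdot> (\<rho> \<cdot> (L \<triangleleft> i)))) = \<rho>' \<cdot> ((L' \<triangleleft> i) \<cdot> ((h \<triangleright> A) \<cdot> ((f \<triangleright> A) \<cdot> (g \<triangleright> A))))"
  proof -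
    have 1: "run [(0, ?H), (0, ?F), (0, ?G), (0, ?L), (1, I)] (start [L, A]) =
        run [(0, ?L'), (1, I), (0, ?H), (0, ?F), (0, ?G)] (start [L, A])"
    proof -
      let ?st = "start [L, A]"
      have "sl 0 ?H (sl 0 ?F (sl 0 ?G (sl 0 ?L (sl 1 I ?st)))) = sl 0 ?H (sl 0 ?F (sl 0 ?K (sl 1 I (sl 0 ?G ?st))))"
        by (simp add: r(1) bubble[of _ ?G _ I])
      also have "\<dots> = sl 0 ?L' (sl 1 I (sl 0 ?H (sl 0 ?F (sl 0 ?G ?st))))"
        by (simp add: r(2,3) exchange[of _ ?H _ I])
      finally show ?thesis by simp
    qed
    from diagram_eq[OF 1] show ?thesis by simp
  qed
  then have lin: "f' \<cdot> (\<rho> \<cdot> (L \<triangleleft> i)) = \<rho>' \<cdot> (L' \<triangleleft> i) \<cdot> (f' \<triangleright> A)" by (simp add: f')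
  have fh: "f' \<in> hom C L L'" by (rule f'_hom)
  note t' = thetaD[OF L L' fh lin]
  note [simp] = homD(1-3)[OF t'(1)]
  let ?TH' = "Box (theta L \<rho> \<rho>' f') [L, T] [L']"
  have 1: "run [(0, ?TH'), (1, QT)] (start [L, S, S]) = run [(0, ?H), (0, ?TH), (0, ?G), (1, QT)] (start [L, S, S])"
    by (simp add: t'(2) t(2) ff r(1,2) exchange[of _ ?G _ QT])
  have eq: "theta L \<rho> \<rho>' f' = h \<cdot> (theta N \<kappa> \<kappa>' f \<cdot> (g \<triangleright> T))"
    by (rule epiD[OF tq(18)[of L]]) (use diagram_eq[OF 1] in simp_all)
  have 2: "run [(0, ?H), (0, ?TH), (0, ?G), (1, ?e)] (start [L]) = run [(0, ?H), (0, ?TH), (1, ?e), (0, ?G)] (start [L])"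
    by (simp add: nf)
  show ?thesis unfolding f'[symmetric] eq using diagram_eq[OF 2] by simp
qed

text \<open>If \<open>f\<close> is linear over \<open>S\<close>, then
  \<open>f (n x) y = f (n (x y))\<close>. So \<open>theta\<close> factors through the multiplication
  and sees only the image of \<open>e\<close>, which is the unit.\<close>

lemma theta_section:
  assumes e: "casimir_element e" and N: "right_module C S mS uS N \<kappa>" "right_module C S mS uS N' \<kappa>'"
    and f: "f \<in> hom C N N'" "f \<cdot> \<kappa> = \<kappa>' \<cdot> (f \<triangleright> S)"
  shows "theta N \<kappa> \<kappa>' f \<cdot> (N \<triangleleft> e) = f"
proof -
  have h: "e \<in> hom C \<one> T" and c: "mbar \<cdot> e = uS"
    using e unfolding casimir_element_def by auto
  note t = thetaD[OF N f(1) restrict_linear[OF N f]]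
  note K = S_moduleD[OF N(1)]
  note [simp] = K(1-4) S_moduleD(1-4)[OF N(2)] homD(1-3)[OF f(1)] homD(1-3)[OF h] homD(1-3)[OF t(1)]
  let ?K = "Box \<kappa> [N, S] [N]" and ?K' = "Box \<kappa>' [N', S] [N']" and ?e = "Box e [] [T]" and ?F = "Box f [N] [N']"
    and ?TH = "Box (theta N \<kappa> \<kappa>' f) [N, T] [N']"
  have r: "sl n ?F (sl n ?K st) = sl n ?K' (sl n ?F st)" "sl n MB (sl n ?e st) = sl n US st" for n st
    using lift_eq[of "[(0, ?F), (0, ?K)]" "[N, S]" "[(0, ?K'), (0, ?F)]" n st]
      lift_eq[of "[(0, MB), (0, ?e)]" "[]" "[(0, US)]" n st] f(2) c
    by (simp_all add: gout)
  have 1: "run [(0, ?TH), (1, QT)] (start [N, S, S]) = run [(0, ?F), (0, ?K), (1, MB), (1, QT)] (start [N, S, S])"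
    by (simp add: t(2) QT_rules K(5) r(1))
  have eq: "theta N \<kappa> \<kappa>' f = f \<cdot> (\<kappa> \<cdot> (N \<triangleleft> mbar))"
    by (rule epiD[OF tq(18)[of N]]) (use diagram_eq[OF 1] in simp_all)
  have 2: "run [(0, ?F), (0, ?K), (1, MB), (1, ?e)] (start [N]) = run [(0, ?F)] (start [N])"
    by (simp add: r(2) K(6) gin)
  show ?thesis unfolding eq using diagram_eq[OF 2] by simp
qed

lemma casimir_imp_separable_functor:
  assumes e: "casimir_element e"
  shows "separable_functor S_mods A_mods (restrict_ob C i) (restrict_arr C i)"
proof -
  let ?P = "\<lambda>(N, \<kappa>) (N', \<kappa>') F. ((N, \<kappa>), theta N \<kappa> \<kappa>' (fst (snd F)) \<cdot> (N \<triangleleft> e), (N', \<kappa>'))"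
  have eh: "e \<in> hom C \<one> T" using e by (simp add: casimir_element_def)
  show ?thesis
    unfolding separable_functor_def
  proof (intro conjI restrict_functor exI[of _ ?P] ballI)
    fix X Y F assume "X \<in> objs S_mods" "Y \<in> objs S_mods" "F \<in> hom A_mods (restrict_ob C i X) (restrict_ob C i Y)"
    then show "?P X Y F \<in> hom S_mods X Y"
      using theta_linear[OF e] by (cases X; cases Y) (auto simp: right_modules_simps right_modules_hom restrict_ob_def)
  next
    fix X' X Y Y' G F H
    assume a: "X' \<in> objs S_mods" "X \<in> objs S_mods" "Y \<in> objs S_mods" "Y' \<in> objs S_mods"
      "G \<in> hom S_mods X' X" "F \<in> hom A_mods (restrict_ob C i X) (restrict_ob C i Y)" "H \<in> hom S_mods Y Y'"
    obtain L \<rho> N \<kappa> N' \<kappa>' L' \<rho>' where [simp]: "X' = (L, \<rho>)" "X = (N, \<kappa>)" "Y = (N', \<kappa>')" "Y' = (L', \<rho>')"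
      by (meson surj_pair)
    from a(5) obtain g where g: "G = (X', g, X)" "g \<in> hom C L N" "g \<cdot> \<rho> = \<kappa> \<cdot> (g \<triangleright> S)"
      by (auto simp: right_modules_hom)
    from a(7) obtain h where h: "H = (Y, h, Y')" "h \<in> hom C N' L'" "h \<cdot> \<kappa>' = \<rho>' \<cdot> (h \<triangleright> S)"
      by (auto simp: right_modules_hom)
    from a(6) obtain f where f: "F = (restrict_ob C i X, f, restrict_ob C i Y)" "f \<in> hom C N N'"
      "f \<cdot> (\<kappa> \<cdot> (N \<triangleleft> i)) = \<kappa>' \<cdot> (N' \<triangleleft> i) \<cdot> (f \<triangleright> A)"
      by (auto simp: right_modules_hom restrict_ob_def)
    have mods: "right_module C S mS uS L \<rho>" "right_module C S mS uS N \<kappa>" "right_module C S mS uS N' \<kappa>'"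
      "right_module C S mS uS L' \<rho>'" using a(1-4) by (simp_all add: right_modules_simps)
    show "?P X' Y' (restrict_arr C i H \<cdot>\<^bsub>A_mods\<^esub> F \<cdot>\<^bsub>A_mods\<^esub> restrict_arr C i G) =
        H \<cdot>\<^bsub>S_mods\<^esub> ?P X Y F \<cdot>\<^bsub>S_mods\<^esub> G"
      using theta_natural[OF eh mods(2,3) f(2,3) mods(1,4) g(2,3) h(2,3)]
      by (simp add: f(1) g(1) h(1) restrict_arr_def right_modules_simps)
  next
    fix X Y F assume "X \<in> objs S_mods" "Y \<in> objs S_mods" "F \<in> hom S_mods X Y"
    then show "?P X Y (restrict_arr C i F) = F"
      using theta_section[OF e] by (cases X; cases Y) (auto simp: right_modules_hom restrict_arr_def)
  qed
qed

section \<open>From a natural retraction to a bilinear section\<close>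

lemma S_mods_homI:
  assumes "right_module C S mS uS N \<kappa>" "right_module C S mS uS N' \<kappa>'" "f \<in> hom C N N'"
    "f \<cdot> \<kappa> = \<kappa>' \<cdot> (f \<triangleright> S)"
  shows "((N, \<kappa>), f, (N', \<kappa>')) \<in> hom S_mods (N, \<kappa>) (N', \<kappa>')"
  using assms by (simp add: right_modules_hom)

lemma separable_functor_imp_section:
  assumes gen: "left_tensor_generator C \<one>"
    and sep: "separable_functor S_mods A_mods (restrict_ob C i) (restrict_arr C i)"
  shows "\<exists>\<sigma>. bilinear_section \<sigma>"
proof -
  let ?D = "S_mods" and ?E = "A_mods" and ?Fo = "restrict_ob C i" and ?Fa = "restrict_arr C i"
  let ?S = "(S, mS)" and ?T = "(T, muT)"
  obtain P where P1: "\<And>X Y F. X \<in> objs ?D \<Longrightarrow> Y \<in> objs ?D \<Longrightarrow> F \<in> hom ?E (?Fo X) (?Fo Y) \<Longrightarrow> P X Y F \<in> hom ?D X Y"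
    and P2: "\<And>X' X Y Y' G F H. X' \<in> objs ?D \<Longrightarrow> X \<in> objs ?D \<Longrightarrow> Y \<in> objs ?D \<Longrightarrow> Y' \<in> objs ?D \<Longrightarrow>
      G \<in> hom ?D X' X \<Longrightarrow> F \<in> hom ?E (?Fo X) (?Fo Y) \<Longrightarrow> H \<in> hom ?D Y Y' \<Longrightarrow>
      P X' Y' (?Fa H \<cdot>\<^bsub>?E\<^esub> F \<cdot>\<^bsub>?E\<^esub> ?Fa G) = H \<cdot>\<^bsub>?D\<^esub> P X Y F \<cdot>\<^bsub>?D\<^esub> G"
    and P3: "\<And>X Y F. X \<in> objs ?D \<Longrightarrow> Y \<in> objs ?D \<Longrightarrow> F \<in> hom ?D X Y \<Longrightarrow> P X Y (?Fa F) = F"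
    using sep unfolding separable_functor_def by (elim conjE exE) blast
  have a: "mS \<cdot> (mS \<triangleright> S) = mS \<cdot> (S \<triangleleft> mS)" "mS \<cdot> (S \<triangleleft> uS) = ident C S"
    using algS unfolding algebra_def
    by (simp_all add: strict_associator strict_left_unitor strict_right_unitor)
  have mS: "right_module C S mS uS S mS" using a by (simp add: right_module_def hom_def)
  have mT: "right_module C S mS uS T muT" using T_eqs(1,2) by (simp add: right_module_def hom_def)
  have objs: "?S \<in> objs ?D" "?T \<in> objs ?D" using mS mT by (simp_all add: right_modules_simps)
  let ?f = "q \<cdot> (S \<triangleleft> uS)"
  note rules = QT_rules S_rules T_rules gin
  \<comment> \<open>Linearity of \<open>?f\<close> over \<open>A\<close>: by balancing,
    \<open>s a \<otimes> 1 = s \<otimes> a = (s \<otimes> 1) a\<close>.\<close>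
  have 1: "run [(0, QT), (1, US), (0, SM), (1, I)] (start [S, A]) = run [(0, MT), (1, I), (0, QT), (1, US)] (start [S, A])"
  proof -
    let ?st = "start [S, A]"
    have "sl 0 QT (sl 1 US (sl 0 SM (sl 1 I ?st))) = sl 0 QT (sl 0 SM (sl 1 I (sl 2 US ?st)))"
      by (simp add: bubble[of 0 SM] bubble[of "Suc 0" I _ US])
    also have "\<dots> = sl 0 QT (sl 1 SM (sl 1 I (sl 2 US ?st)))" using QT_balanced[of 0] by simp
    also have "\<dots> = sl 0 QT (sl 1 I ?st)"
      by (simp add: S_rules gin exchange[of _ I _ US])
    also have "\<dots> = sl 0 MT (sl 1 I (sl 0 QT (sl 1 US ?st)))"
      by (simp add: QT_rules S_rules gin bubble[of _ _ _ I])
    finally show ?thesis by simp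
  qed
  have F: "(?Fo ?S, ?f, ?Fo ?T) \<in> hom ?E (?Fo ?S) (?Fo ?T)"
  proof -
    have "?f \<in> hom C S T" by (simp add: hom_def)
    then show ?thesis
      using restrict_module[OF mS] restrict_module[OF mT] diagram_eq[OF 1]
      by (simp add: restrict_ob_def right_modules_hom)
  qed
  obtain \<sigma> where \<sigma>: "P ?S ?T (?Fo ?S, ?f, ?Fo ?T) = (?S, \<sigma>, ?T)" "\<sigma> \<in> hom C S T" "\<sigma> \<cdot> mS = muT \<cdot> (\<sigma> \<triangleright> S)"
    using P1[OF objs F] by (auto simp: right_modules_hom)
  note [simp] = homD(1-3)[OF \<sigma>(2)]
  have idS: "(?S, ident C S, ?S) \<in> hom ?D ?S ?S" and idT: "(?T, ident C T, ?T) \<in> hom ?D ?T ?T"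
    using S_mods_homI[OF mS mS ident_hom] S_mods_homI[OF mT mT ident_hom] by simp_all
  have 2: "run [(0, MB), (0, QT), (1, US)] (start [S]) = run [] (start [S])" by (simp add: rules)
  have mb: "(?T, mbar, ?S) \<in> hom ?D ?T ?S"
    using S_mods_homI[OF mT mS T_induced(1) T_eqs(7)] .
  \<comment> \<open>Naturality along the linear map \<open>mbar\<close> applies because
    \<open>mbar\<close> after \<open>?f\<close> is the identity of \<open>S\<close>, on which the
    retraction is known.\<close>
  have "P ?S ?S (?Fa (?T, mbar, ?S) \<cdot>\<^bsub>?E\<^esub> (?Fo ?S, ?f, ?Fo ?T) \<cdot>\<^bsub>?E\<^esub> ?Fa (?S, ident C S, ?S)) =
      (?T, mbar, ?S) \<cdot>\<^bsub>?D\<^esub> (?S, \<sigma>, ?T) \<cdot>\<^bsub>?D\<^esub> (?S, ident C S, ?S)"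
    using P2[OF objs(1) objs(1) objs(2) objs(1) idS F mb] \<sigma>(1) by simp
  moreover have "?Fa (?T, mbar, ?S) \<cdot>\<^bsub>?E\<^esub> (?Fo ?S, ?f, ?Fo ?T) \<cdot>\<^bsub>?E\<^esub> ?Fa (?S, ident C S, ?S) = ?Fa (?S, ident C S, ?S)"
    using diagram_eq[OF 2] by (simp add: restrict_arr_def right_modules_simps)
  ultimately have unit: "mbar \<cdot> \<sigma> = ident C S"
    using P3[OF objs(1) objs(1) idS] by (simp add: right_modules_simps)
  have left: "(\<sigma> \<cdot> mS) \<cdot> (x \<triangleright> S) = (nuT \<cdot> (S \<triangleleft> \<sigma>)) \<cdot> (x \<triangleright> S)" if x: "x \<in> hom C \<one> S" for x
  proof -
    note [simp] = homD(1-3)[OF x]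
    let ?x = "Box x [] [S]"
    \<comment> \<open>Left multiplication by \<open>x\<close> is right linear on \<open>S\<close>
      and, in \<open>4\<close>, on \<open>T\<close>; both are therefore admissible in the naturality
      of \<open>P\<close>.\<close>
    have 3: "run [(0, SM), (0, ?x), (0, SM)] (start [S, S]) = run [(0, SM), (0, SM), (0, ?x)] (start [S, S])"
    proof -
      let ?st = "start [S, S]"
      have "sl 0 SM (sl 0 ?x (sl 0 SM ?st)) = sl 0 SM (sl 1 SM (sl 0 ?x ?st))"
        by (simp add: exchange[of 0 ?x])
      then show ?thesis by (simp add: S_rules)
    qed
    have 4: "run [(0, NT), (0, ?x), (0, MT)] (start [T, S]) = run [(0, MT), (0, NT), (0, ?x)] (start [T, S])"
    proof -
      let ?st = "start [T, S]"
      have "sl 0 NT (sl 0 ?x (sl 0 MT ?st)) = sl 0 NT (sl 1 MT (sl 0 ?x ?st))"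
        by (simp add: exchange[of 0 ?x])
      then show ?thesis by (simp add: T_rules)
    qed
    have xS: "(?S, mS \<cdot> (x \<triangleright> S), ?S) \<in> hom ?D ?S ?S"
      by (rule S_mods_homI[OF mS mS]) (use diagram_eq[OF 3] in \<open>simp_all add: hom_def\<close>)
    have xT: "(?T, nuT \<cdot> (x \<triangleright> T), ?T) \<in> hom ?D ?T ?T"
      by (rule S_mods_homI[OF mT mT]) (use diagram_eq[OF 4] in \<open>simp_all add: hom_def\<close>)
    \<comment> \<open>The map \<open>?f\<close> intertwines the left multiplications by
      \<open>x\<close> on \<open>S\<close> and on \<open>T\<close>. Naturality of \<open>P\<close>
      in its source and in its target transfers this to \<open>\<sigma>\<close>.\<close>
    have 5: "run [(0, QT), (1, US), (0, SM), (0, ?x)] (start [S]) = run [(0, NT), (0, ?x), (0, QT), (1, US)] (start [S])"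
    proof -
      let ?st = "start [S]"
      have "sl 0 NT (sl 0 ?x (sl 0 QT (sl 1 US ?st))) = sl 0 NT (sl 1 QT (sl 0 ?x (sl 1 US ?st)))"
        by (simp add: exchange[of 0 ?x 0 QT])
      also have "\<dots> = sl 0 QT (sl 0 SM (sl 0 ?x (sl 1 US ?st)))" by (simp add: QT_rules)
      also have "\<dots> = sl 0 QT (sl 1 US (sl 0 SM (sl 0 ?x ?st)))"
        by (simp add: exchange[of 0 ?x _ US] exchange[of 0 SM _ US])
      finally show ?thesis by simp
    qed
    have "P ?S ?T (?Fa (?T, ident C T, ?T) \<cdot>\<^bsub>?E\<^esub> (?Fo ?S, ?f, ?Fo ?T) \<cdot>\<^bsub>?E\<^esub> ?Fa (?S, mS \<cdot> (x \<triangleright> S), ?S)) =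
        (?T, ident C T, ?T) \<cdot>\<^bsub>?D\<^esub> (?S, \<sigma>, ?T) \<cdot>\<^bsub>?D\<^esub> (?S, mS \<cdot> (x \<triangleright> S), ?S)"
      using P2[OF objs(1) objs(1) objs(2) objs(2) xS F idT] \<sigma>(1) by simp
    moreover have "P ?S ?T (?Fa (?T, nuT \<cdot> (x \<triangleright> T), ?T) \<cdot>\<^bsub>?E\<^esub> (?Fo ?S, ?f, ?Fo ?T) \<cdot>\<^bsub>?E\<^esub> ?Fa (?S, ident C S, ?S)) =
        (?T, nuT \<cdot> (x \<triangleright> T), ?T) \<cdot>\<^bsub>?D\<^esub> (?S, \<sigma>, ?T) \<cdot>\<^bsub>?D\<^esub> (?S, ident C S, ?S)"
      using P2[OF objs(1) objs(1) objs(2) objs(2) idS F xT] \<sigma>(1) by simp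
    moreover have "?Fa (?T, ident C T, ?T) \<cdot>\<^bsub>?E\<^esub> (?Fo ?S, ?f, ?Fo ?T) \<cdot>\<^bsub>?E\<^esub> ?Fa (?S, mS \<cdot> (x \<triangleright> S), ?S) =
        ?Fa (?T, nuT \<cdot> (x \<triangleright> T), ?T) \<cdot>\<^bsub>?E\<^esub> (?Fo ?S, ?f, ?Fo ?T) \<cdot>\<^bsub>?E\<^esub> ?Fa (?S, ident C S, ?S)"
      using diagram_eq[OF 5] by (simp add: restrict_arr_def right_modules_simps)
    ultimately have e: "\<sigma> \<cdot> (mS \<cdot> (x \<triangleright> S)) = nuT \<cdot> ((x \<triangleright> T) \<cdot> \<sigma>)"
      by (simp add: right_modules_simps)
    have "run [(0, ?x), (0, Box \<sigma> [S] [T])] (start [S]) = run [(1, Box \<sigma> [S] [T]), (0, ?x)] (start [S])"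
      by (simp add: exchange[of 0 ?x])
    from diagram_eq[OF this] have "(x \<triangleright> T) \<cdot> \<sigma> = (S \<triangleleft> \<sigma>) \<cdot> (x \<triangleright> S)" by simp
    with e show ?thesis by simp
  qed
  \<comment> \<open>The generator property is applied with both tensor factors equal to
    \<open>S\<close>, the elements \<open>x\<close> being inserted in the first.\<close>
  have "\<sigma> \<cdot> mS = nuT \<cdot> (S \<triangleleft> \<sigma>)"
  proof -
    have "\<sigma> \<cdot> mS \<in> hom C (S \<otimes> S) T" "nuT \<cdot> (S \<triangleleft> \<sigma>) \<in> hom C (S \<otimes> S) T" by (simp_all add: hom_def)
    then show ?thesis using gen left S_facts(1) T_facts(1) unfolding left_tensor_generator_def by blast
  qed
  then show ?thesis using \<sigma>(2,3) unit unfolding bilinear_section_def by blast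
qed

lemma separable_functor_iff_section:
  assumes "left_tensor_generator C \<one>"
  shows "separable_functor S_mods A_mods (restrict_ob C i) (restrict_arr C i) \<longleftrightarrow> (\<exists>\<sigma>. bilinear_section \<sigma>)"
  using separable_functor_imp_section[OF assms] casimir_imp_separable_functor ex_section_iff_ex_casimir_element
  by blast

end

section \<open>The wreath product as an extension of \<open>A\<close>\<close>

locale coflat_cowreath = cowd C A m \<eta> X \<psi> \<delta> \<epsilon> Y b d + coflat_algebra C A m \<eta>
  for C :: "('o, 'a) moncat" (structure) and A m \<eta> X \<psi> \<delta> \<epsilon> Y b d

sublocale coflat_cowreath \<subseteq> W: algebra_extension C A m \<eta> "Y \<otimes> A" mS uS iS
proof unfold_locales
  show "algebra C (Y \<otimes> A) mS uS"
    using wreath_assoc wreath_units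
    by (simp add: algebra_def hom_def strict_associator strict_left_unitor strict_right_unitor)
  show "algebra_morphism C A m \<eta> (Y \<otimes> A) mS uS iS"
    using wreath_incl_mult wreath_incl_unit by (simp add: algebra_morphism_def hom_def)
qed

context coflat_cowreath
begin

text \<open>By the unit laws, multiplying by the image of \<open>A\<close> on the right only touches
  the last factor. This is the freeness behind the splitting below.\<close>

lemma ext_right_eq: "W.\<mu> = Y \<triangleleft> m"
proof -
  have 1: "run [(0, Dx), (1, MS), (3, IS)] (start [X, Y, A, A]) = run [(0, Dx), (2, M)] (start [X, Y, A, A])"
    by (simp add: xnf)
  show ?thesis unfolding ext_right_def
    by (rule transpose_inj[of _ "Y \<otimes> A \<otimes> A" A]) (use diagram_eq[OF 1] in \<open>simp_all add: hom_def\<close>)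
qed

text \<open>Since \<open>S = YA\<close> is a free right \<open>A\<close>-module, the coequalizer defining \<open>S \<otimes>\<^sub>A S\<close> is split and
  identifies it with \<open>YS\<close>.\<close>

lemma splitting:
  obtains k where "k \<in> hom C W.T (Y \<otimes> Y \<otimes> A)" "k \<cdot> W.q = tow" "k \<cdot> (W.q \<cdot> fow) = ident C (Y \<otimes> Y \<otimes> A)"
    "W.q \<cdot> (fow \<cdot> tow) = W.q"
proof -
  let ?S = "Y \<otimes> A"
  let ?N = "Box W.\<nu> [A, Y, A] [Y, A]"
  have tow: "tow = Y \<triangleleft> W.\<nu>" by (simp add: ext_left_def)
  have nu: "sl n ?N (sl n M st) = sl n ?N (sl (Suc n) ?N st)" "sl n ?N (sl n E st) = gd n Y (gd (Suc n) A st)" for n st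
    using lift_eq[of "[(0, ?N), (0, M)]" "[A, A, Y, A]" "[(0, ?N), (1, ?N)]" n st]
      lift_eq[of "[(0, ?N), (0, E)]" "[Y, A]" "[]" n st] W.bimodule_ext
    by (simp_all add: gout bimodule_def left_module_def)
  have 1: "run [(1, ?N), (1, M)] (start [Y, A, A, Y, A]) = run [(1, ?N), (2, ?N)] (start [Y, A, A, Y, A])"
    by (simp add: nu)
  have 2: "run [(1, ?N), (1, E)] (start [Y, Y, A]) = run [] (start [Y, Y, A])"
    by (simp add: nu gin)
  have 3: "run [(1, E), (1, ?N)] (start [Y, A, Y, A]) = run [(2, ?N), (1, E)] (start [Y, A, Y, A])"
    by (simp add: exchange[of _ E _ ?N])
  have 4: "run [(1, M), (1, E)] (start [Y, A, Y, A]) = run [] (start [Y, A, Y, A])"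
    by (simp add: M_E gin)
  have co: "is_coequalizer C (W.\<mu> \<triangleright> ?S) (?S \<triangleleft> W.\<nu>) W.q" by (rule W.tq(21))
  have bal: "W.q \<cdot> (Y \<triangleleft> m \<triangleright> Y \<otimes> A) = W.q \<cdot> (Y \<otimes> A \<triangleleft> W.\<nu>)"
    using coequalizerD(7)[OF co] by (simp add: ext_right_eq)
  have k: "induced C W.q tow \<in> hom C W.T (Y \<otimes> Y \<otimes> A)" "induced C W.q tow \<cdot> W.q = tow"
    using induced_coequalizer[OF co, of tow "Y \<otimes> Y \<otimes> A"] diagram_eq[OF 1]
    by (simp_all add: hom_def ext_right_eq tow)
  have s: "tow \<cdot> fow = ident C (Y \<otimes> Y \<otimes> A)" using diagram_eq[OF 2] by (simp add: tow)
  define k where "k = induced C W.q tow"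
  note k = k[folded k_def]
  note [simp] = homD(1-3)[OF k(1)]
  have "k \<cdot> (W.q \<cdot> fow) = (k \<cdot> W.q) \<cdot> fow" by simp
  then have ks: "k \<cdot> (W.q \<cdot> fow) = ident C (Y \<otimes> Y \<otimes> A)" using k(2) s by simp
  \<comment> \<open>The composite sends \<open>y a \<otimes> s\<close> to
    \<open>y 1 \<otimes> a s\<close>, and balancing moves \<open>a\<close> back across the tensor
    sign.\<close>
  have "W.q \<cdot> (fow \<cdot> tow) = W.q \<cdot> ((Y \<otimes> A \<triangleleft> W.\<nu>) \<cdot> (Y \<triangleleft> \<eta> \<triangleright> A \<otimes> Y \<otimes> A))"
    using diagram_eq[OF 3] by (simp add: tow)
  also have "\<dots> = (W.q \<cdot> (Y \<triangleleft> m \<triangleright> Y \<otimes> A)) \<cdot> (Y \<triangleleft> \<eta> \<triangleright> A \<otimes> Y \<otimes> A)" unfolding bal by simp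
  also have "\<dots> = W.q" using diagram_eq[OF 4] by simp
  finally show thesis using that[OF k ks] by simp
qed

text \<open>\<open>k\<close> and \<open>W.q \<cdot> fow\<close> are mutually inverse, and
  representatives agree after \<open>W.q\<close> exactly when they agree after \<open>tow\<close>.
  Under this isomorphism the two definitions coincide.\<close>

lemma ex_casimir_element_iff_ex_central: "(\<exists>e. W.casimir_element e) \<longleftrightarrow> (\<exists>e. central e)"
proof -
  obtain k where k: "k \<in> hom C W.T (Y \<otimes> Y \<otimes> A)" "k \<cdot> W.q = tow" "k \<cdot> (W.q \<cdot> fow) = ident C (Y \<otimes> Y \<otimes> A)"
    "W.q \<cdot> (fow \<cdot> tow) = W.q" by (rule splitting)
  note [simp] = homD(1-3)[OF k(1)]
  have kq: "k \<cdot> (W.q \<cdot> f) = tow \<cdot> f" if "f \<in> arrs C" "target C f = Y \<otimes> A \<otimes> Y \<otimes> A" for f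
  proof -
    have "k \<cdot> (W.q \<cdot> f) = (k \<cdot> W.q) \<cdot> f" using that by simp
    then show ?thesis unfolding k(2) .
  qed
  have qt: "W.q \<cdot> f = W.q \<cdot> (fow \<cdot> (tow \<cdot> f))" if "f \<in> arrs C" "target C f = Y \<otimes> A \<otimes> Y \<otimes> A" for f
  proof -
    have "W.q \<cdot> (fow \<cdot> (tow \<cdot> f)) = (W.q \<cdot> (fow \<cdot> tow)) \<cdot> f" using that by simp
    then show ?thesis unfolding k(4) by simp
  qed
  have cancel: "W.q \<cdot> f = W.q \<cdot> g \<longleftrightarrow> tow \<cdot> f = tow \<cdot> g"
    if "f \<in> arrs C" "target C f = Y \<otimes> A \<otimes> Y \<otimes> A" "g \<in> arrs C" "target C g = Y \<otimes> A \<otimes> Y \<otimes> A" for f g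
    using kq qt that by metis
  have main: "W.casimir_element (W.q \<cdot> (fow \<cdot> e)) \<longleftrightarrow> central e" if e: "e \<in> hom C \<one> (Y \<otimes> Y \<otimes> A)" for e
  proof -
    note [simp] = homD(1-3)[OF e]
    have 1: "W.nuT \<cdot> (Y \<otimes> A \<triangleleft> (W.q \<cdot> (fow \<cdot> e))) = W.q \<cdot> ((mS \<triangleright> Y \<otimes> A) \<cdot> (Y \<otimes> A \<triangleleft> (fow \<cdot> e)))"
    proof -
      have "W.nuT \<cdot> (Y \<otimes> A \<triangleleft> (W.q \<cdot> (fow \<cdot> e))) = (W.nuT \<cdot> (Y \<otimes> A \<triangleleft> W.q)) \<cdot> (Y \<otimes> A \<triangleleft> (fow \<cdot> e))" by simp
      then show ?thesis unfolding W.T_induced(4) by simp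
    qed
    have 2: "W.muT \<cdot> ((W.q \<cdot> (fow \<cdot> e)) \<triangleright> Y \<otimes> A) = W.q \<cdot> ((Y \<otimes> A \<triangleleft> mS) \<cdot> ((fow \<cdot> e) \<triangleright> Y \<otimes> A))"
    proof -
      have "W.muT \<cdot> ((W.q \<cdot> (fow \<cdot> e)) \<triangleright> Y \<otimes> A) = (W.muT \<cdot> (W.q \<triangleright> Y \<otimes> A)) \<cdot> ((fow \<cdot> e) \<triangleright> Y \<otimes> A)" by simp
      then show ?thesis unfolding W.T_induced(6) by simp
    qed
    have 3: "W.mbar \<cdot> (W.q \<cdot> (fow \<cdot> e)) = mS \<cdot> fow \<cdot> e"
    proof -
      have "W.mbar \<cdot> (W.q \<cdot> (fow \<cdot> e)) = (W.mbar \<cdot> W.q) \<cdot> (fow \<cdot> e)" by simp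
      then show ?thesis unfolding W.T_induced(2) by simp
    qed
    have 4: "tow \<cdot> ((mS \<triangleright> Y \<otimes> A) \<cdot> (Y \<otimes> A \<triangleleft> (fow \<cdot> e))) = tow \<cdot> (mS \<triangleright> Y \<otimes> A) \<cdot> (Y \<otimes> A \<triangleleft> (fow \<cdot> e))"
      "tow \<cdot> ((Y \<otimes> A \<triangleleft> mS) \<cdot> ((fow \<cdot> e) \<triangleright> Y \<otimes> A)) = tow \<cdot> (Y \<otimes> A \<triangleleft> mS) \<cdot> ((fow \<cdot> e) \<triangleright> Y \<otimes> A)"
      by simp_all
    have 5: "W.q \<cdot> (fow \<cdot> e) \<in> hom C \<one> W.T" by (simp add: hom_def)
    have 6: "W.q \<cdot> ((mS \<triangleright> Y \<otimes> A) \<cdot> (Y \<otimes> A \<triangleleft> (fow \<cdot> e))) = W.q \<cdot> ((Y \<otimes> A \<triangleleft> mS) \<cdot> ((fow \<cdot> e) \<triangleright> Y \<otimes> A)) \<longleftrightarrow>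
      tow \<cdot> ((mS \<triangleright> Y \<otimes> A) \<cdot> (Y \<otimes> A \<triangleleft> (fow \<cdot> e))) = tow \<cdot> ((Y \<otimes> A \<triangleleft> mS) \<cdot> ((fow \<cdot> e) \<triangleright> Y \<otimes> A))"
      by (rule cancel) simp_all
    show ?thesis unfolding W.casimir_element_def central_def 1 2 3 6 4 using 5 e by blast
  qed
  show ?thesis
  proof
    assume "\<exists>e. central e"
    then obtain e where "central e" by blast
    then show "\<exists>e. W.casimir_element e" using main[of e] by (auto simp: central_def)
  next
    assume "\<exists>e. W.casimir_element e"
    then obtain e where e: "W.casimir_element e" by blast
    then have h: "e \<in> hom C \<one> W.T" by (simp add: W.casimir_element_def)
    note [simp] = homD(1-3)[OF h]
    \<comment> \<open>Tested on the epi \<open>W.q\<close>, this is the other half of invertibility;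
      it represents an arbitrary element of the tensor square by one of the form covered by
      \<open>main\<close>.\<close>
    have "(W.q \<cdot> (fow \<cdot> k)) \<cdot> W.q = ident C W.T \<cdot> W.q"
      using k(2,4) by simp
    then have "W.q \<cdot> (fow \<cdot> k) = ident C W.T"
      by (rule epiD[OF W.tq(17)]) simp_all
    then have "(W.q \<cdot> (fow \<cdot> k)) \<cdot> e = e" by simp
    then have "W.q \<cdot> (fow \<cdot> (k \<cdot> e)) = e" by simp
    moreover have "k \<cdot> e \<in> hom C \<one> (Y \<otimes> Y \<otimes> A)" by (simp add: hom_def)
    ultimately show "\<exists>e. central e" using main[of "k \<cdot> e"] e by auto
  qed
qed

end

theorem proposition6p6:
  fixes C :: "('o, 'a) moncat"
    and A X Y :: 'o
    and m \<eta> \<psi> \<delta> \<epsilon> b d :: 'a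
  defines "\<phi> \<equiv> dual_phi C A Y \<psi> b d"
    and "S \<equiv> Y \<otimes>\<^bsub>C\<^esub> A"
    and "mS \<equiv> wreath_mult C A m X Y \<psi> \<delta> b d"
    and "uS \<equiv> wreath_unit C Y \<epsilon> b"
    and "i \<equiv> wreath_incl C A m Y \<epsilon> b"
  defines "cond_i \<equiv> coseparable_coalgebra (T_sharp C A m \<eta>) (X, \<psi>)
                      (cow_comult C X \<psi> \<delta>) (cow_counit C A X \<psi> \<epsilon>)"
    and "cond_ii \<equiv> separable_algebra (sharp_T C A m \<eta>) (Y, \<phi>)
                      (sharp_T_tensor C (Y, \<phi>) (Y, \<phi>), dual_mult C A X Y \<delta> b d, (Y, \<phi>))
                      ((\<one>\<^bsub>C\<^esub>, ident C A), dual_unit C Y \<epsilon> b, (Y, \<phi>))"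
    and "cond_iii \<equiv> separable_extension C A m \<eta> S mS uS i"
    and "cond_iv \<equiv> separable_ring C A m \<eta> S mS i"
    and "cond_v \<equiv> separable_functor (right_modules C S mS uS) (right_modules C A m \<eta>)
                      (restrict_ob C i) (restrict_arr C i)"
  assumes "strict_monoidal_category C"
    and "has_coequalizers C"
    and "\<And>Z. Z \<in> objs C \<Longrightarrow> left_coflat C Z"
    and "cowreath C A m \<eta> X \<psi> \<delta> \<epsilon>"
    and "dual_pair C X Y b d"
    and "\<And>N \<nu>. left_module C A m \<eta> N \<nu> \<Longrightarrow> robust C A m \<eta> N \<nu>"
  shows "(cond_i \<longleftrightarrow> cond_ii) \<and> (cond_ii \<longleftrightarrow> cond_iii) \<and> (cond_iii \<longleftrightarrow> cond_iv) \<and>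
         (left_tensor_generator C \<one>\<^bsub>C\<^esub> \<longrightarrow> (cond_iv \<longleftrightarrow> cond_v))"
proof -
  interpret strict_monoidal_category C by fact
  have alg: "algebra C A m \<eta>" using \<open>cowreath C A m \<eta> X \<psi> \<delta> \<epsilon>\<close> by (simp add: cowreath_def)
  \<comment> \<open>The ten defining equations come first among the assumptions, so the range
    starting at 12 consists of the hypotheses after strictness.\<close>
  interpret K: coflat_cowreath C A m \<eta> X \<psi> \<delta> \<epsilon> Y b d
    by unfold_locales (fact alg assms(12-16))+
  \<comment> \<open>Condition (i) serves twice: through retractions and their mates it is compared
    with (ii), through Casimir forms with (iii).\<close>
  have 1: "cond_i \<longleftrightarrow> cond_ii"
    unfolding cond_i_def cond_ii_def \<phi>_def K.coseparable_iff_ex_coseparator K.separable_iff_ex_separator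
    by (rule K.ex_coseparator_iff_ex_separator)
  have 2: "cond_i \<longleftrightarrow> cond_iii"
    unfolding cond_i_def cond_iii_def S_def mS_def uS_def i_def
      K.coseparable_iff_ex_casimir K.ex_casimir_iff_ex_central
      K.W.separable_extension_iff_section K.W.ex_section_iff_ex_casimir_element
    by (rule K.ex_casimir_element_iff_ex_central[symmetric])
  have 3: "cond_iii \<longleftrightarrow> cond_iv"
    unfolding cond_iii_def cond_iv_def S_def mS_def uS_def i_def
      K.W.separable_extension_iff_section K.W.separable_ring_iff_section ..
  have 4: "cond_iv \<longleftrightarrow> cond_v" if "left_tensor_generator C \<one>\<^bsub>C\<^esub>"
    unfolding cond_iv_def cond_v_def S_def mS_def uS_def i_def
      K.W.separable_functor_iff_section[OF that] K.W.separable_ring_iff_section ..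
  from 1 2 3 4 show ?thesis by blast
qed

end
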